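(* Let $m(n,3)$ be the number of rank-$3$ matroids on a (fixed, labelled) ground set of size $n$. Then, as $n\to\infty$, \[m(n,3)=\Big(\frac{1+\sqrt 3}{2}e^{\sqrt 3/2-3}\,n+o(n)\Big)^{n^2/6}.\]
   Context: A matroid consists of a finite ground set $E$ and a collection $\mathcal I$ of subsets of $E$ (called independent sets) such that: (i) $\emptyset\in\mathcal I$; (ii) if $A'\subseteq A\subseteq E$ and $A\in\mathcal I$ then $A'\in\mathcal I$; (iii) if $A,B\in\mathcal I$ and $|A|>|B|$, then there is $a\in A\setminus B$ such that $B\cup\{a\}\in\mathcal I$. The rank of a matroid is the maximum size of an independent set. Matroids are counted as labelled objects, i.e. $m(n,3)$ counts the collections $\mathcal I$ on a fixed $n$-element set $E$ that define a matroid of rank $3$ (not isomorphism classes). The asymptotic notation means that there is a function $g$ with $g(n)/n\to 0$ as $n\to\infty$ such that the number equals $\big(\frac{1+\sqrt 3}{2}e^{\sqrt 3/2-3}n+g(n)\big)^{n^2/6}$; here $e$ is the base of the natural logarithm. *)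

theory Defs
  imports Complex_Main
begin

locale matroid =
  fixes E :: "'a set" and \<I> :: "'a set set"
  assumes finite_ground: "finite E"
    and indep_subset_ground: "\<And>A. A \<in> \<I> \<Longrightarrow> A \<subseteq> E"
    and empty_indep: "{} \<in> \<I>"
    and indep_subset: "\<And>A A'. A \<in> \<I> \<Longrightarrow> A' \<subseteq> A \<Longrightarrow> A' \<in> \<I>"
    and augment: "\<And>A B. A \<in> \<I> \<Longrightarrow> B \<in> \<I> \<Longrightarrow> card A > card B \<Longrightarrow>
                    \<exists>a \<in> A - B. B \<union> {a} \<in> \<I>"

definition matroid_rank :: "'a set set \<Rightarrow> nat" where
  "matroid_rank \<I> = Max (card ` \<I>)"

(* Matroids are counted as labelled objects, on the ground set {0, ..., n - 1}. *)
definition num_matroids :: "nat \<Rightarrow> nat \<Rightarrow> nat" where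
  "num_matroids n r = card {\<I>. matroid {..<n} \<I> \<and> matroid_rank \<I> = r}"

(* The cardinality above is that of a finite set, and so is the maximum in the rank. *)
lemma finite_matroids_of_rank: "finite {\<I>. matroid {..<n::nat} \<I> \<and> matroid_rank \<I> = r}"
  by (rule finite_subset[of _ "Pow (Pow {..<n})"]) (auto dest: matroid.indep_subset_ground)

lemma (in matroid) finite_indep_sets: "finite \<I>"
  by (rule finite_subset[of _ "Pow E"]) (auto simp: finite_ground dest: indep_subset_ground)

end

theory Submission
  imports Defs "HOL-Library.FuncSet" "HOL-Combinatorics.Multiset_Permutations" "HOL-Real_Asymp.Real_Asymp"
begin

text \<open>Up to loops and parallel elements, a rank-3 matroid is a linear space: a partition of the pairs of
  points into lines. Loops and parallel classes contribute only a factor $(n+1)^n = e^{o(n^2)}$, and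
  two-point lines carry no information, so the task is to count \<^emph>\<open>packings\<close>, that is, families of
  blocks with at least three points each, any two of which share at most one point.

  A block with $k$ points is worth about $n^{k-2}$ choices and uses up $k(k-1)/2$ of the
  $N = n(n-1)/2$ pairs. Since $(k-2) / (k(k-1)/2)$ is at most $1/3$, with equality exactly for
  $k = 3$ and $k = 4$, the exponent of $n$ is $n^2/6$, and up to a negligible part all pairs are
  covered by triples and quadruples. With $T$ triples and $Q$ quadruples, $3T + 6Q \approx N$, the
  number of packings is about
    $$\frac{(n^3/6)^T}{T!} \cdot \frac{(n^4/24)^Q}{Q!} \cdot e^{-N},$$
  because a random family of this size covers a pair a Poisson(1) number of times. Maximising over
  the fraction $p$ of the pairs that lie in quadruples gives $(1-p)^2 = 2p$, so $p = 2 - \sqrt 3$,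
  and this produces the constant of the theorem. The two halves of the proof make the heuristic
  formula rigorous from below for this one $p$, and from above
  for all $T$ and $Q$ with $3T + 6Q$ close to $N$.

  \<^emph>\<open>Lower bound.\<close> Choose blocks one after the other, quadruples first and then triples, each
  time any block that keeps the family a packing. If the uncovered pairs remain as evenly spread as
  in a random graph of density $\rho$, there are about $\rho^3 n^3/6$ triples and $\rho^6 n^4/24$
  quadruples to choose from, and the product of these numbers along the process is the formula
  above. The process works in any regular hypergraphs with small codegrees (locale
  \<open>regular_hypergraphs\<close>, where the vertices are the pairs and the edges are the blocks). Evenness is
  controlled by a potential, a sum of exponentials of the deviations of all degrees, that does not
  increase on average (\<open>potential_step\<close>). Since averages over the choices are all that
  enters, a backward induction counts the good choice sequences without any probability theory
  (\<open>card_runs_ge\<close>).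

  \<^emph>\<open>Upper bound.\<close> A packing by triples and quadruples is listed in a random order of its blocks.
  Kraft's inequality for the tree of all partial lists, together with the convexity of the
  exponential function, bounds the number of lists by the exponential of the average logarithm of
  the number of available blocks (\<open>card_times_fact_le\<close>). In a random order every pair is still
  uncovered with the same probability $\rho$, whatever the block that contains it, and three (six) pairs in
  different blocks are jointly uncovered with probability at most $\rho^3$ ($\rho^6$); so the average is the one of
  the heuristic formula (\<open>card_mixed_packings_le\<close>). Blocks with five or more points are
  encoded one point at a time (\<open>card_packings_excess_le\<close>), which shows that packings where they
  or the two-point lines cover a positive fraction of the pairs are negligible.\<close>

section \<open>Packings and the matroids that they define\<close>

definition packing :: "nat \<Rightarrow> nat set set \<Rightarrow> bool" where
  "packing n P \<longleftrightarrow> (\<forall>b\<in>P. b \<subseteq> {..<n} \<and> 3 \<le> card b) \<and>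
     (\<forall>b\<in>P. \<forall>c\<in>P. b \<noteq> c \<longrightarrow> card (b \<inter> c) \<le> 1)"

lemma finite_packings: "finite {P. packing n P \<and> Q P}"
  by (rule finite_subset[of _ "Pow (Pow {..<n})"]) (auto simp: packing_def)

lemma packing_finite: "packing n P \<Longrightarrow> finite P"
  by (rule finite_subset[of _ "Pow {..<n}"]) (auto simp: packing_def)

lemma packing_block: "packing n P \<Longrightarrow> b \<in> P \<Longrightarrow> b \<subseteq> {..<n} \<and> finite b \<and> 3 \<le> card b"
  by (auto simp: packing_def intro: finite_subset)

lemma packing_unique:
  assumes "packing n P" "b \<in> P" "c \<in> P" "x \<noteq> y" "{x, y} \<subseteq> b" "{x, y} \<subseteq> c"
  shows "b = c"
proof (rule ccontr)
  assume "b \<noteq> c"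
  then have "card (b \<inter> c) \<le> 1" using assms by (auto simp: packing_def)
  moreover have "card {x, y} \<le> card (b \<inter> c)" using assms packing_block[OF assms(1,2)] by (intro card_mono) auto
  ultimately show False using assms(4) by simp
qed

text \<open>The paving matroid whose three-element circuits are the triples inside a block.\<close>
definition packing_matroid :: "nat \<Rightarrow> nat set set \<Rightarrow> nat set set" where
  "packing_matroid n P = {A. A \<subseteq> {..<n} \<and> (card A \<le> 2 \<or> card A = 3 \<and> (\<forall>b\<in>P. \<not> A \<subseteq> b))}"

lemma obtain_element_of_larger_set:
  assumes "A \<subseteq> {..<n::nat}" "B \<subseteq> {..<n}" "card B < card A"
  obtains a where "a \<in> A - B"
proof -
  have "\<not> A \<subseteq> B" using assms card_mono[of B A] finite_subset[of B "{..<n}"] by auto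
  then show ?thesis using that by blast
qed

lemma matroid_packing_matroid:
  assumes P: "packing n P"
  shows "matroid {..<n} (packing_matroid n P)"
proof
  show "finite {..<n}" by simp
  show "A \<subseteq> {..<n}" if "A \<in> packing_matroid n P" for A using that by (simp add: packing_matroid_def)
  show "{} \<in> packing_matroid n P" by (simp add: packing_matroid_def)
  show "A' \<in> packing_matroid n P" if A: "A \<in> packing_matroid n P" "A' \<subseteq> A" for A A'
  proof -
    have fA: "finite A" using A(1) finite_subset by (auto simp: packing_matroid_def)
    have "card A' \<le> card A" using fA A(2) by (rule card_mono)
    moreover have "A' = A" if "card A' = card A" using fA A(2) that by (rule card_subset_eq)
    ultimately show ?thesis using A by (fastforce simp: packing_matroid_def)
  qed
  show "\<exists>a\<in>A - B. B \<union> {a} \<in> packing_matroid n P"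
    if A: "A \<in> packing_matroid n P" and B: "B \<in> packing_matroid n P" and AB: "card B < card A" for A B
  proof -
    have sub: "A \<subseteq> {..<n}" "B \<subseteq> {..<n}" using A B by (auto simp: packing_matroid_def)
    have fin: "finite A" "finite B" using sub finite_subset by auto
    obtain a where a: "a \<in> A - B" using obtain_element_of_larger_set[OF sub AB] .
    have cBa: "card (B \<union> {x}) = Suc (card B)" if "x \<in> A - B" for x using that fin by simp
    have A3: "card A \<le> 3" using A by (auto simp: packing_matroid_def)
    show ?thesis
    proof (cases "card B \<le> 1")
      case True
      then have "B \<union> {a} \<in> packing_matroid n P" using cBa[OF a] a sub unfolding packing_matroid_def by auto
      then show ?thesis using a by blast
    next
      case False
      then have B2: "card B = 2" and cA: "card A = 3" using AB A3 by auto
      then obtain x y where xy: "B = {x, y}" "x \<noteq> y" by (auto simp: card_2_iff)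
      show ?thesis
      proof (rule ccontr)
        assume neg: "\<not> ?thesis"
        have blk: "\<exists>b\<in>P. B \<union> {z} \<subseteq> b" if z: "z \<in> A - B" for z
        proof -
          have "B \<union> {z} \<notin> packing_matroid n P" using neg z by blast
          moreover have "card (B \<union> {z}) = 3" using cBa[OF z] B2 by simp
          moreover have "B \<union> {z} \<subseteq> {..<n}" using sub z by blast
          ultimately show ?thesis unfolding packing_matroid_def by blast
        qed
        obtain b where b: "b \<in> P" "B \<union> {a} \<subseteq> b" using blk[OF a] by blast
        have "A \<subseteq> b"
        proof
          fix z assume z: "z \<in> A"
          show "z \<in> b"
          proof (cases "z \<in> B")
            case True then show ?thesis using b by blast
          next
            case False
            then obtain c where c: "c \<in> P" "B \<union> {z} \<subseteq> c" using blk z by blast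
            have "b = c" using packing_unique[OF P b(1) c(1) xy(2)] b c xy(1) by blast
            then show ?thesis using c by blast
          qed
        qed
        then show False using A cA b(1) by (auto simp: packing_matroid_def)
      qed
    qed
  qed
qed

text \<open>If every triple were inside a block, then the triples $\{0,1,x\}$ would force a single block with five points.\<close>
lemma packing_small_triple:
  assumes P: "packing n P" "\<forall>b\<in>P. card b \<le> 4" and n: "5 \<le> n"
  shows "\<exists>A. A \<subseteq> {..<n} \<and> card A = 3 \<and> (\<forall>b\<in>P. \<not> A \<subseteq> b)"
proof (rule ccontr)
  assume "\<not> ?thesis"
  then have all: "\<exists>b\<in>P. A \<subseteq> b" if "A \<subseteq> {..<n}" "card A = 3" for A using that by blast
  obtain b where b: "b \<in> P" "{0, 1, 2} \<subseteq> b" using all[of "{0, 1, 2}"] n by auto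
  obtain c where c: "c \<in> P" "{0, 1, 3} \<subseteq> c" using all[of "{0, 1, 3}"] n by auto
  obtain d where d: "d \<in> P" "{0, 1, 4} \<subseteq> d" using all[of "{0, 1, 4}"] n by auto
  have "b = c" using packing_unique[OF P(1) b(1) c(1), of 0 1] b(2) c(2) by simp
  moreover have "b = d" using packing_unique[OF P(1) b(1) d(1), of 0 1] b(2) d(2) by simp
  ultimately have "{0, 1, 2, 3, 4} \<subseteq> b" using b(2) c(2) d(2) by simp
  then have "card {0, 1, 2, 3, 4::nat} \<le> card b" using packing_block[OF P(1) b(1)] by (intro card_mono) simp_all
  moreover have "card {0, 1, 2, 3, 4::nat} = 5" by simp
  moreover have "card b \<le> 4" using P(2) b(1) by blast
  ultimately show False by linarith
qed

lemma matroid_rank_packing_matroid: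
  assumes "packing n P" "\<forall>b\<in>P. card b \<le> 4" "5 \<le> n"
  shows "matroid_rank (packing_matroid n P) = 3"
proof -
  obtain A where A: "A \<in> packing_matroid n P" "card A = 3"
    using packing_small_triple[OF assms] by (auto simp: packing_matroid_def)
  have "finite (packing_matroid n P)"
    using matroid.finite_indep_sets[OF matroid_packing_matroid[OF assms(1)]] .
  then show ?thesis unfolding matroid_rank_def using A
    by (intro Max_eqI) (auto simp: packing_matroid_def intro: rev_image_eqI)
qed

text \<open>Any two points of a block of \<open>P\<close>, completed by a third one, form a dependent triple, hence lie in a
  block of \<open>P'\<close>; the blocks obtained for a fixed pair all coincide. This is what makes a packing
  recoverable from its matroid.\<close>
lemma packing_matroid_block_subset:
  assumes P: "packing n P" "packing n P'" and eq: "packing_matroid n P = packing_matroid n P'" and b: "b \<in> P"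
  shows "\<exists>c\<in>P'. b \<subseteq> c"
proof -
  have tri: "\<exists>c\<in>P'. A \<subseteq> c" if "A \<subseteq> b" "card A = 3" for A
  proof -
    have "A \<subseteq> {..<n}" using that packing_block[OF P(1) b] by blast
    moreover have "A \<notin> packing_matroid n P" using that b by (auto simp: packing_matroid_def)
    ultimately show ?thesis using that unfolding eq by (auto simp: packing_matroid_def)
  qed
  obtain A where A: "A \<subseteq> b" "card A = 3" using packing_block[OF P(1) b] by (meson obtain_subset_with_card_n)
  then obtain x y z where xyz: "A = {x, y, z}" "x \<noteq> y" "x \<noteq> z" "y \<noteq> z" by (auto simp: card_3_iff)
  obtain c where c: "c \<in> P'" "A \<subseteq> c" using tri[OF A] by blast
  have "b \<subseteq> c"
  proof
    fix w assume w: "w \<in> b"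
    show "w \<in> c"
    proof (cases "w = x \<or> w = y")
      case True then show ?thesis using c xyz by blast
    next
      case False
      then have "card {x, y, w} = 3" using xyz by auto
      then obtain d where d: "d \<in> P'" "{x, y, w} \<subseteq> d" using tri[of "{x, y, w}"] w A xyz by auto
      have "c = d" using packing_unique[OF P(2) c(1) d(1) xyz(2)] c d xyz(1) by blast
      then show ?thesis using d by blast
    qed
  qed
  then show ?thesis using c by blast
qed

lemma inj_on_packing_matroid: "inj_on (packing_matroid n) {P. packing n P}"
proof -
  have "P \<subseteq> P'" if P: "packing n P" "packing n P'" and eq: "packing_matroid n P = packing_matroid n P'" for P P'
  proof
    fix b assume b: "b \<in> P"
    obtain c where c: "c \<in> P'" "b \<subseteq> c" using packing_matroid_block_subset[OF P eq b] by blast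
    obtain d where d: "d \<in> P" "c \<subseteq> d" using packing_matroid_block_subset[OF P(2,1) eq[symmetric] c(1)] by blast
    have bb: "finite b" "3 \<le> card b" using packing_block[OF P(1) b] by auto
    have "b \<inter> d = b" using c d by blast
    then have "\<not> card (b \<inter> d) \<le> 1" using bb by simp
    then have "b = d" using P(1) b d(1) unfolding packing_def by blast
    then show "b \<in> P'" using c d by auto
  qed
  then show ?thesis by (intro inj_onI) (simp, blast)
qed

theorem card_small_packings_le_num_matroids:
  assumes "5 \<le> n"
  shows "card {P. packing n P \<and> (\<forall>b\<in>P. card b \<le> 4)} \<le> num_matroids n 3"
  unfolding num_matroids_def
proof (rule card_inj_on_le[of "packing_matroid n"])
  show "inj_on (packing_matroid n) {P. packing n P \<and> (\<forall>b\<in>P. card b \<le> 4)}"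
    by (rule inj_on_subset[OF inj_on_packing_matroid]) auto
  show "packing_matroid n ` {P. packing n P \<and> (\<forall>b\<in>P. card b \<le> 4)} \<subseteq> {\<I>. matroid {..<n} \<I> \<and> matroid_rank \<I> = 3}"
    using matroid_packing_matroid matroid_rank_packing_matroid assms by auto
qed (rule finite_matroids_of_rank)

section \<open>From matroids to packings\<close>

context matroid begin

text \<open>An independent set that contains \<open>y\<close> can be enlarged inside \<open>insert y (A - {x})\<close> as long as it is
  smaller than \<open>A\<close>, because the augmenting element cannot be \<open>x\<close>.\<close>
lemma parallel_exchange:
  assumes A: "A \<in> \<I>" "x \<in> A" and y: "{y} \<in> \<I>" "{x, y} \<notin> \<I>"
  shows "insert y (A - {x}) \<in> \<I>"
proof -
  define F where "F = {B \<in> \<I>. y \<in> B \<and> B \<subseteq> insert y (A - {x})}"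
  have fA: "finite A" using finite_subset[OF indep_subset_ground[OF A(1)] finite_ground] .
  have fF: "finite F" unfolding F_def using finite_indep_sets by simp
  have "{y} \<in> F" using y by (auto simp: F_def)
  then have "F \<noteq> {}" by blast
  then have "Max (card ` F) \<in> card ` F" using fF by (intro Max_in) auto
  then obtain B where B: "B \<in> F" "Max (card ` F) = card B" by blast
  have max: "card C \<le> card B" if "C \<in> F" for C unfolding B(2)[symmetric] using fF that by (intro Max_ge) auto
  have yA: "y \<notin> A"
    using indep_subset[OF A(1), of "{x, y}"] y(2) A(2) by blast
  have Bs: "B \<in> \<I>" "y \<in> B" "B \<subseteq> insert y (A - {x})" using B by (auto simp: F_def)
  have fB: "finite B" using finite_subset[OF Bs(3)] fA by simp
  have "card A \<le> card B"
  proof (rule ccontr)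
    assume "\<not> card A \<le> card B"
    then obtain a where a: "a \<in> A - B" "B \<union> {a} \<in> \<I>" using augment[OF A(1) Bs(1)] by auto
    show False
    proof (cases "a = x")
      case True
      then have "{x, y} \<subseteq> B \<union> {a}" using Bs by blast
      then show False using indep_subset[OF a(2)] y(2) by blast
    next
      case False
      then have "B \<union> {a} \<in> F" using a Bs by (auto simp: F_def)
      then have "card (B \<union> {a}) \<le> card B" by (rule max)
      then show False using a fB by simp
    qed
  qed
  moreover have "card (insert y (A - {x})) = card A"
    using fA yA card.remove[OF fA A(2)] by (subst card_insert_disjoint) (blast, blast, metis)
  ultimately have "B = insert y (A - {x})" using Bs fA
    by (intro card_seteq) auto
  then show ?thesis using Bs by simp
qed

definition nonloop :: "'a \<Rightarrow> bool" where "nonloop x \<longleftrightarrow> {x} \<in> \<I>"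

definition parallel :: "'a \<Rightarrow> 'a \<Rightarrow> bool" where
  "parallel x y \<longleftrightarrow> nonloop x \<and> nonloop y \<and> (x = y \<or> {x, y} \<notin> \<I>)"

lemma parallel_sym: "parallel x y \<Longrightarrow> parallel y x"
  by (auto simp: parallel_def insert_commute)

lemma parallel_trans:
  assumes "parallel x y" "parallel y z" shows "parallel x z"
proof (cases "x = y \<or> y = z \<or> x = z")
  case True then show ?thesis using assms by (auto simp: parallel_def)
next
  case False
  have "{x, z} \<notin> \<I>"
  proof
    assume "{x, z} \<in> \<I>"
    then have "insert y ({x, z} - {x}) \<in> \<I>" using assms False by (intro parallel_exchange) (auto simp: parallel_def nonloop_def)
    moreover have "insert y ({x, z} - {x}) = {y, z}" using False by auto
    ultimately show False using assms False by (auto simp: parallel_def)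
  qed
  then show ?thesis using assms by (auto simp: parallel_def)
qed

text \<open>Elements can be replaced by parallel ones, one at a time; the induction is on the number of
  elements of \<open>A\<close> that are not their own representative.\<close>
lemma indep_representatives:
  assumes r: "\<And>x. nonloop x \<Longrightarrow> parallel x (r x)" "\<And>x. nonloop x \<Longrightarrow> r (r x) = r x"
    and A: "finite A" "\<And>x. x \<in> A \<Longrightarrow> nonloop x" "inj_on r A"
  shows "r ` A \<in> \<I> \<longleftrightarrow> A \<in> \<I>"
  using A
proof (induction "card {x \<in> A. r x \<noteq> x}" arbitrary: A)
  case 0
  then have "r x = x" if "x \<in> A" for x using that by auto
  then show ?case by (metis (no_types, lifting) image_cong image_ident)
next
  case (Suc k)
  obtain x where x: "x \<in> A" "r x \<noteq> x" using Suc(2)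
    by (metis (mono_tags, lifting) card.empty empty_Collect_eq nat.distinct(1))
  define A' where "A' = insert (r x) (A - {x})"
  have nl: "nonloop x" using Suc x by auto
  have rr: "r (r x) = r x" using r nl by auto
  have rxA: "r x \<notin> A" using Suc.prems(3) x rr by (auto dest: inj_onD)
  have px: "parallel x (r x)" using r nl by auto
  have im: "r ` A' = r ` A"
  proof -
    have "r ` A = insert (r x) (r ` (A - {x}))" using x by blast
    then show ?thesis by (simp add: A'_def rr)
  qed
  have "{y \<in> A'. r y \<noteq> y} = {y \<in> A. r y \<noteq> y} - {x}" using rr x rxA by (auto simp: A'_def)
  then have "card {y \<in> A'. r y \<noteq> y} = k" using Suc.hyps(2) Suc.prems(1) x by simp
  moreover have "inj_on r A'" unfolding A'_def inj_on_insert
  proof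
    show "inj_on r (A - {x})" using Suc.prems(3) by (rule inj_on_subset) auto
    show "r (r x) \<notin> r ` (A - {x} - {r x})" using Suc.prems(3) x rr by (auto dest: inj_onD)
  qed
  ultimately have IH: "r ` A' \<in> \<I> \<longleftrightarrow> A' \<in> \<I>" using Suc.prems px
    by (intro Suc.hyps(1)) (auto simp: A'_def parallel_def)
  have np: "{x, r x} \<notin> \<I>" "{r x} \<in> \<I>" "{x} \<in> \<I>" using px x by (auto simp: parallel_def nonloop_def)
  have "A \<in> \<I> \<longleftrightarrow> A' \<in> \<I>"
  proof
    assume "A \<in> \<I>" then show "A' \<in> \<I>" unfolding A'_def using x np by (intro parallel_exchange) auto
  next
    assume "A' \<in> \<I>"
    then have "insert x (A' - {r x}) \<in> \<I>" using np by (intro parallel_exchange) (auto simp: A'_def insert_commute)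
    moreover have "insert x (A' - {r x}) = A" using x rxA by (auto simp: A'_def)
    ultimately show "A \<in> \<I>" by simp
  qed
  then show ?case using IH im by simp
qed

lemma card_le_rank: "A \<in> \<I> \<Longrightarrow> card A \<le> matroid_rank \<I>"
  unfolding matroid_rank_def using finite_indep_sets by (intro Max_ge) auto

end

text \<open>The dependent triples of a simple matroid of rank at most 3: lines are determined by two points.\<close>
definition collinear :: "nat \<Rightarrow> nat set set \<Rightarrow> bool" where
  "collinear n D \<longleftrightarrow> (\<forall>X\<in>D. X \<subseteq> {..<n} \<and> card X = 3) \<and>
     (\<forall>a b c d. {a, b, c} \<in> D \<longrightarrow> {a, b, d} \<in> D \<longrightarrow> c \<noteq> d \<longrightarrow> {a, c, d} \<in> D)"

definition line :: "nat set set \<Rightarrow> nat \<Rightarrow> nat \<Rightarrow> nat set" where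
  "line D a b = {a, b} \<union> {c. {a, b, c} \<in> D}"

definition lines :: "nat set set \<Rightarrow> nat set set" where
  "lines D = {L. \<exists>a b. a \<noteq> b \<and> L = line D a b \<and> 3 \<le> card L}"

lemma line_sym: "line D a b = line D b a"
  by (auto simp: line_def insert_commute)

lemma triple_distinct: "card {a, b, c} = 3 \<longleftrightarrow> a \<noteq> b \<and> a \<noteq> c \<and> b \<noteq> c"
  by (auto simp: card_insert_if)

lemma collinear_D:
  assumes "collinear n D" "{a, b, c} \<in> D" 
  shows "a \<noteq> b \<and> a \<noteq> c \<and> b \<noteq> c \<and> a < n \<and> b < n \<and> c < n"
proof -
  have "{a, b, c} \<subseteq> {..<n}" "card {a, b, c} = 3" using assms unfolding collinear_def by blast+
  then show ?thesis unfolding triple_distinct by simp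
qed

lemma collinear_trans:
  "collinear n D \<Longrightarrow> {a, b, c} \<in> D \<Longrightarrow> {a, b, d} \<in> D \<Longrightarrow> c \<noteq> d \<Longrightarrow> {a, c, d} \<in> D"
  unfolding collinear_def by blast

lemma line_change:
  assumes D: "collinear n D" and x: "x \<in> line D a b" "x \<noteq> a" and ab: "a \<noteq> b"
  shows "line D a x = line D a b"
proof (cases "x = b")
  case False
  have abx: "{a, b, x} \<in> D" using x False by (auto simp: line_def)
  have "c \<in> line D a x \<longleftrightarrow> c \<in> line D a b" for c
  proof (cases "c = a \<or> c = b \<or> c = x")
    case True
    then show ?thesis using abx by (auto simp: line_def insert_commute)
  next
    case c: False
    have "{a, x, c} \<in> D \<longleftrightarrow> {a, b, c} \<in> D"
    proof
      assume "{a, x, c} \<in> D"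
      moreover have "{a, x, b} \<in> D" using abx by (simp add: insert_commute)
      ultimately have "{a, b, c} \<in> D" using collinear_trans[OF D, of a x b c] c by blast
      then show "{a, b, c} \<in> D" .
    next
      assume "{a, b, c} \<in> D"
      then show "{a, x, c} \<in> D" using collinear_trans[OF D abx, of c] c by blast
    qed
    then show ?thesis using c by (simp add: line_def)
  qed
  then show ?thesis by blast
qed simp

lemma line_eqI:
  assumes D: "collinear n D" and ab: "a \<noteq> b" and xy: "x \<in> line D a b" "y \<in> line D a b" "x \<noteq> y"
  shows "line D x y = line D a b"
proof (cases "x = a")
  case True then show ?thesis using line_change[OF D xy(2) _ ab] xy by simp
next
  case False
  have 1: "line D x a = line D a b" using line_change[OF D xy(1) False ab] by (simp add: line_sym)
  have "line D x y = line D x a" using line_change[OF D, of y x a] xy False 1 by auto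
  then show ?thesis using 1 by simp
qed

lemma line_subset:
  assumes D: "collinear n D" and L: "L \<in> lines D"
  shows "L \<subseteq> {..<n}"
proof -
  obtain a b where ab: "a \<noteq> b" "L = line D a b" "3 \<le> card L" using L by (auto simp: lines_def)
  have "L \<noteq> {a, b}" using ab by auto
  then obtain c where "{a, b, c} \<in> D" using ab by (auto simp: line_def)
  then have "a < n" "b < n" using collinear_D[OF D] by auto
  moreover have "c < n" if "{a, b, c} \<in> D" for c using collinear_D[OF D that] by auto
  ultimately show ?thesis using ab by (auto simp: line_def)
qed

lemma packing_lines:
  assumes D: "collinear n D"
  shows "packing n (lines D)"
  unfolding packing_def
proof (intro conjI ballI impI)
  fix L assume L: "L \<in> lines D"
  then show "L \<subseteq> {..<n}" by (rule line_subset[OF D])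
  show "3 \<le> card L" using L by (auto simp: lines_def)
next
  fix L L' assume L: "L \<in> lines D" "L' \<in> lines D" "L \<noteq> L'"
  show "card (L \<inter> L') \<le> 1"
  proof (rule ccontr)
    assume "\<not> card (L \<inter> L') \<le> 1"
    then have "2 \<le> card (L \<inter> L')" by simp
    then obtain S where "S \<subseteq> L \<inter> L'" "card S = 2" by (meson obtain_subset_with_card_n)
    then obtain x y where xy: "x \<in> L \<inter> L'" "y \<in> L \<inter> L'" "x \<noteq> y" by (auto simp: card_2_iff)
    obtain a b a' b' where ab: "a \<noteq> b" "L = line D a b" "a' \<noteq> b'" "L' = line D a' b'" using L by (auto simp: lines_def)
    have "L = line D x y" using line_eqI[OF D ab(1), of x y] xy ab by auto
    moreover have "L' = line D x y" using line_eqI[OF D ab(3), of x y] xy ab by auto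
    ultimately show False using L by simp
  qed
qed

lemma collinear_iff_lines:
  assumes D: "collinear n D"
  shows "X \<in> D \<longleftrightarrow> card X = 3 \<and> (\<exists>L\<in>lines D. X \<subseteq> L)"
proof
  assume X: "X \<in> D"
  then have c: "card X = 3" "X \<subseteq> {..<n}" using D by (auto simp: collinear_def)
  then obtain x y z where xyz: "X = {x, y, z}" "x \<noteq> y" "x \<noteq> z" "y \<noteq> z" by (auto simp: card_3_iff)
  have sub: "X \<subseteq> line D x y" using X xyz by (auto simp: line_def)
  have "line D x y \<subseteq> insert x (insert y {..<n})" using collinear_D[OF D] by (auto simp: line_def)
  then have "finite (line D x y)" using finite_subset by blast
  then have "3 \<le> card (line D x y)" using card_mono[OF _ sub] c by simp
  then show "card X = 3 \<and> (\<exists>L\<in>lines D. X \<subseteq> L)" using c xyz(2) sub unfolding lines_def by blast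
next
  assume "card X = 3 \<and> (\<exists>L\<in>lines D. X \<subseteq> L)"
  then obtain L where X: "card X = 3" "L \<in> lines D" "X \<subseteq> L" by blast
  then obtain x y z where xyz: "X = {x, y, z}" "x \<noteq> y" "x \<noteq> z" "y \<noteq> z" by (auto simp: card_3_iff)
  obtain a b where ab: "a \<noteq> b" "L = line D a b" using X by (auto simp: lines_def)
  have "line D x y = L" using line_eqI[OF D ab(1), of x y] xyz X ab by auto
  then have "z \<in> line D x y" using X xyz by simp
  then show "X \<in> D" using xyz by (auto simp: line_def)
qed

text \<open>The lines with at least three points form a packing that determines the dependent triples.\<close>
lemma card_collinear_le: "card {D. collinear n D} \<le> card {P. packing n P}"
proof (rule card_inj_on_le[of lines])
  show "inj_on lines {D. collinear n D}"
  proof (rule inj_onI)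
    fix D D' assume D: "D \<in> {D. collinear n D}" "D' \<in> {D. collinear n D}" "lines D = lines D'"
    show "D = D'" using collinear_iff_lines[of n D] collinear_iff_lines[of n D'] D by auto
  qed
  show "lines ` {D. collinear n D} \<subseteq> {P. packing n P}" using packing_lines by auto
  show "finite {P. packing n P}" using finite_packings[of n "\<lambda>_. True"] by simp
qed

text \<open>The smallest element parallel to \<open>x\<close>. Loops are sent to \<open>n\<close>, which is outside the ground set, so that
  \<open>rep\<close> also records which elements are loops.\<close>
definition rep :: "nat \<Rightarrow> nat set set \<Rightarrow> nat \<Rightarrow> nat" where
  "rep n \<I> x = (if {x} \<in> \<I> then Min {y. matroid.parallel \<I> x y} else n)"

definition simple_dependent :: "nat \<Rightarrow> nat set set \<Rightarrow> nat set set" where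
  "simple_dependent n \<I> = {X. X \<subseteq> {..<n} \<and> card X = 3 \<and> (\<forall>x\<in>X. {x} \<in> \<I> \<and> rep n \<I> x = x) \<and> X \<notin> \<I>}"

context
  fixes n :: nat and \<I> :: "nat set set"
  assumes M: "matroid {..<n} \<I>"
begin

interpretation matroid "{..<n}" \<I> by (rule M)

lemma nonloop_less: "{x} \<in> \<I> \<Longrightarrow> x < n"
  using indep_subset_ground by blast

lemma rep_parallel: "{x} \<in> \<I> \<Longrightarrow> parallel x (rep n \<I> x)"
proof -
  assume x: "{x} \<in> \<I>"
  have "finite {y. parallel x y}"
    by (rule finite_subset[of _ "{..<n}"]) (auto simp: parallel_def nonloop_def nonloop_less)
  moreover have "parallel x x" using x by (simp add: parallel_def nonloop_def)
  ultimately have "Min {y. parallel x y} \<in> {y. parallel x y}" by (intro Min_in) auto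
  then show ?thesis using x by (simp add: rep_def)
qed

lemma rep_nonloop: "{x} \<in> \<I> \<Longrightarrow> {rep n \<I> x} \<in> \<I>"
  using rep_parallel by (auto simp: parallel_def nonloop_def)

lemma rep_eq_iff:
  assumes "{x} \<in> \<I>" "{y} \<in> \<I>" shows "rep n \<I> x = rep n \<I> y \<longleftrightarrow> parallel x y"
proof
  assume "rep n \<I> x = rep n \<I> y"
  then have "parallel x (rep n \<I> x)" "parallel y (rep n \<I> x)" using rep_parallel[OF assms(1)] rep_parallel[OF assms(2)] by simp_all
  then show "parallel x y" using parallel_trans parallel_sym by blast
next
  assume p: "parallel x y"
  have "{z. parallel x z} = {z. parallel y z}" using parallel_trans[OF p] parallel_trans[OF parallel_sym[OF p]] by blast
  then show "rep n \<I> x = rep n \<I> y" using assms by (simp add: rep_def)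
qed

lemma rep_rep: "{x} \<in> \<I> \<Longrightarrow> rep n \<I> (rep n \<I> x) = rep n \<I> x"
  using rep_eq_iff[OF rep_nonloop] rep_parallel parallel_sym by blast

lemma rep_less_iff: "x < n \<Longrightarrow> rep n \<I> x < n \<longleftrightarrow> {x} \<in> \<I>"
  using nonloop_less[OF rep_nonloop] by (auto simp: rep_def)

lemma collinear_simple_dependent: "collinear n (simple_dependent n \<I>)"
  unfolding collinear_def
proof (intro conjI ballI allI impI)
  fix a b c d assume abc: "{a, b, c} \<in> simple_dependent n \<I>" and abd: "{a, b, d} \<in> simple_dependent n \<I>" and cd: "c \<noteq> d"
  have c3: "card {a, b, c} = 3" "card {a, b, d} = 3" using abc abd unfolding simple_dependent_def by blast+
  then have dist: "a \<noteq> b" "a \<noteq> c" "b \<noteq> c" "a \<noteq> d" "b \<noteq> d" unfolding triple_distinct by auto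
  have r: "{x} \<in> \<I> \<and> rep n \<I> x = x \<and> x < n" if "x \<in> {a, b, c, d}" for x 
    using that abc abd by (auto simp: simple_dependent_def)
  have nI: "{a, b, c} \<notin> \<I>" "{a, b, d} \<notin> \<I>" using abc abd by (auto simp: simple_dependent_def)
  have "{a, b} \<in> \<I>" using rep_eq_iff[of a b] r[of a] r[of b] dist by (auto simp: parallel_def nonloop_def)
  have "{a, c, d} \<notin> \<I>"
  proof
    assume "{a, c, d} \<in> \<I>"
    then have "\<exists>x\<in>{a, c, d} - {a, b}. {a, b} \<union> {x} \<in> \<I>" using \<open>{a, b} \<in> \<I>\<close> dist cd by (intro augment) auto
    then have "{a, b} \<union> {c} \<in> \<I> \<or> {a, b} \<union> {d} \<in> \<I>" by blast
    moreover have "{a, b} \<union> {c} = {a, b, c}" "{a, b} \<union> {d} = {a, b, d}" by auto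
    ultimately show False using nI by simp
  qed
  moreover have "card {a, c, d} = 3" using dist cd unfolding triple_distinct by simp
  ultimately show "{a, c, d} \<in> simple_dependent n \<I>" using r by (auto simp: simple_dependent_def)
qed (auto simp: simple_dependent_def)

text \<open>A rank-3 matroid is determined by its loops and parallel classes (through \<open>rep\<close>) and by the
  dependent triples of representatives.\<close>
lemma indep_iff_rep:
  assumes rk: "matroid_rank \<I> = 3"
  shows "A \<in> \<I> \<longleftrightarrow> A \<subseteq> {..<n} \<and> card A \<le> 3 \<and> (\<forall>x\<in>A. rep n \<I> x < n) \<and> inj_on (rep n \<I>) A \<and>
     (card A = 3 \<longrightarrow> rep n \<I> ` A \<notin> simple_dependent n \<I>)"
proof
  assume A: "A \<in> \<I>"
  have sub: "A \<subseteq> {..<n}" using A by (rule indep_subset_ground)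
  then have fA: "finite A" using finite_subset by blast
  have nl: "{x} \<in> \<I>" if "x \<in> A" for x using indep_subset[OF A, of "{x}"] that by simp
  have inj: "inj_on (rep n \<I>) A"
  proof (rule inj_onI)
    fix x y assume xy: "x \<in> A" "y \<in> A" "rep n \<I> x = rep n \<I> y"
    then have "parallel x y" using rep_eq_iff nl by blast
    moreover have "{x, y} \<in> \<I>" using indep_subset[OF A, of "{x, y}"] xy by simp
    ultimately show "x = y" by (auto simp: parallel_def)
  qed
  have "rep n \<I> ` A \<in> \<I>" using A nl rep_parallel rep_rep fA inj by (subst indep_representatives) (auto simp: nonloop_def)
  moreover have "rep n \<I> x < n" if "x \<in> A" for x using rep_less_iff nl[OF that] that sub by auto
  ultimately show "A \<subseteq> {..<n} \<and> card A \<le> 3 \<and> (\<forall>x\<in>A. rep n \<I> x < n) \<and> inj_on (rep n \<I>) A \<and>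
     (card A = 3 \<longrightarrow> rep n \<I> ` A \<notin> simple_dependent n \<I>)"
    using sub card_le_rank[OF A] rk inj by (auto simp: simple_dependent_def)
next
  assume R: "A \<subseteq> {..<n} \<and> card A \<le> 3 \<and> (\<forall>x\<in>A. rep n \<I> x < n) \<and> inj_on (rep n \<I>) A \<and>
     (card A = 3 \<longrightarrow> rep n \<I> ` A \<notin> simple_dependent n \<I>)"
  have fA: "finite A" using R finite_subset by blast
  have nl: "{x} \<in> \<I>" if "x \<in> A" for x using R rep_less_iff that by auto
  have "card A = 0 \<or> card A = 1 \<or> card A = 2 \<or> card A = 3" using R by linarith
  then consider "A = {}" | "card A = 1" | "card A = 2" | "card A = 3" using fA by auto
  then show "A \<in> \<I>"
  proof cases
    case 1 then show ?thesis using empty_indep by simp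
  next
    case 2 then show ?thesis using nl by (auto simp: card_1_singleton_iff)
  next
    case 3
    then obtain x y where xy: "A = {x, y}" "x \<noteq> y" by (auto simp: card_2_iff)
    then have "rep n \<I> x \<noteq> rep n \<I> y" using R by (auto dest: inj_onD)
    then show ?thesis using rep_eq_iff[of x y] nl xy by (auto simp: parallel_def nonloop_def)
  next
    case 4
    have "card (rep n \<I> ` A) = 3" using R 4 by (simp add: card_image)
    moreover have "rep n \<I> ` A \<subseteq> {..<n}" using R by auto
    moreover have "{rep n \<I> x} \<in> \<I>" "rep n \<I> (rep n \<I> x) = rep n \<I> x" if "x \<in> A" for x
      using rep_nonloop rep_rep nl[OF that] by auto
    ultimately have "rep n \<I> ` A \<in> \<I>" using R 4 by (auto simp: simple_dependent_def)
    then show ?thesis using nl rep_parallel rep_rep fA R by (subst (asm) indep_representatives) (auto simp: nonloop_def)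
  qed
qed

end

theorem num_matroids_le_packings:
  "num_matroids n 3 \<le> (n + 1) ^ n * card {P. packing n P}"
proof -
  define S where "S = {\<I>. matroid {..<n} \<I> \<and> matroid_rank \<I> = 3}"
  define code where "code = (\<lambda>\<I>. (restrict (rep n \<I>) {..<n}, simple_dependent n \<I>))"
  have "card S \<le> card (({..<n} \<rightarrow>\<^sub>E {..n}) \<times> {D. collinear n D})"
  proof (rule card_inj_on_le[of code])
    show "inj_on code S"
    proof (rule inj_onI)
      fix \<I> \<J> assume IJ: "\<I> \<in> S" "\<J> \<in> S" "code \<I> = code \<J>"
      have e: "restrict (rep n \<I>) {..<n} = restrict (rep n \<J>) {..<n}" using IJ(3) by (simp add: code_def)
      have r: "rep n \<I> x = rep n \<J> x" if "x < n" for x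
        using fun_cong[OF e, of x] that by simp
      have d: "simple_dependent n \<I> = simple_dependent n \<J>" using IJ(3) by (simp add: code_def)
      have M: "matroid {..<n} \<I>" "matroid_rank \<I> = 3" "matroid {..<n} \<J>" "matroid_rank \<J> = 3" using IJ by (auto simp: S_def)
      have "A \<in> \<I> \<longleftrightarrow> A \<in> \<J>" for A
      proof (cases "A \<subseteq> {..<n}")
        case True
        then have eqA: "\<forall>x\<in>A. rep n \<I> x = rep n \<J> x" using r by auto
        then have im: "rep n \<I> ` A = rep n \<J> ` A" "inj_on (rep n \<I>) A \<longleftrightarrow> inj_on (rep n \<J>) A" 
            "(\<forall>x\<in>A. rep n \<I> x < n) \<longleftrightarrow> (\<forall>x\<in>A. rep n \<J> x < n)"
          by (simp_all add: image_def inj_on_def)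
        show ?thesis unfolding indep_iff_rep[OF M(1,2)] indep_iff_rep[OF M(3,4)] im d ..
      next
        case False
        then show ?thesis using matroid.indep_subset_ground[OF M(1)] matroid.indep_subset_ground[OF M(3)] by blast
      qed
      then show "\<I> = \<J>" by blast
    qed
    have "rep n \<I> x \<le> n" if "matroid {..<n} \<I>" "x < n" for \<I> x
      using rep_less_iff[OF that] by (auto simp: rep_def)
    then show "code ` S \<subseteq> ({..<n} \<rightarrow>\<^sub>E {..n}) \<times> {D. collinear n D}"
      using collinear_simple_dependent by (auto simp: S_def code_def split: if_splits)
    have "finite {D. collinear n D}"
      by (rule finite_subset[of _ "Pow (Pow {..<n})"]) (auto simp: collinear_def)
    then show "finite (({..<n} \<rightarrow>\<^sub>E {..n}) \<times> {D. collinear n D})" by (intro finite_cartesian_product finite_PiE) auto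
  qed
  also have "\<dots> = (n + 1) ^ n * card {D. collinear n D}" by (simp add: card_cartesian_product card_PiE)
  also have "\<dots> \<le> (n + 1) ^ n * card {P. packing n P}" using card_collinear_le by (intro mult_left_mono) auto
  finally show ?thesis by (simp add: S_def num_matroids_def)
qed

section \<open>The analytic core of the greedy process\<close>

lemma exp_le_quadratic:
  fixes y :: real assumes "\<bar>y\<bar> \<le> 1" shows "exp y \<le> 1 + y + y\<^sup>2"
proof (cases "0 \<le> y")
  case True
  then show ?thesis using assms by (intro exp_bound) auto
next
  case False
  define x where "x = -y"
  have x: "0 < x" "x \<le> 1" using False assms by (auto simp: x_def)
  have "1 + x \<le> exp x" by simp
  then have "exp y \<le> 1 / (1 + x)" using x
    by (simp add: x_def exp_minus field_simps)
  also have "\<dots> \<le> 1 - x + x\<^sup>2"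
  proof -
    have "1 \<le> (1 - x + x\<^sup>2) * (1 + x)" using x by (simp add: algebra_simps power2_eq_square)
    then show ?thesis using x by (simp add: pos_divide_le_eq)
  qed
  finally show ?thesis by (simp add: x_def)
qed

lemma sum_exp_le:
  fixes z :: "'a \<Rightarrow> real"
  assumes S: "finite S" "real (card S) \<le> A" and b: "\<And>e. e \<in> S \<Longrightarrow> \<bar>z e\<bar> \<le> 1"
    and lin: "(\<Sum>e\<in>S. z e) \<le> A * b1" and quad: "(\<Sum>e\<in>S. (z e)\<^sup>2) \<le> A * b2"
    and A: "0 \<le> A"
  shows "(\<Sum>e\<in>S. exp (z e)) \<le> A * exp (b1 + b2)"
proof -
  have "(\<Sum>e\<in>S. exp (z e)) \<le> (\<Sum>e\<in>S. 1 + z e + (z e)\<^sup>2)"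
    by (intro sum_mono exp_le_quadratic b)
  also have "\<dots> = real (card S) + (\<Sum>e\<in>S. z e) + (\<Sum>e\<in>S. (z e)\<^sup>2)"
    by (simp add: sum.distrib)
  also have "\<dots> \<le> A * (1 + (b1 + b2))" using S lin quad by (simp add: algebra_simps)
  also have "\<dots> \<le> A * exp (b1 + b2)" using A by (intro mult_left_mono) auto
  finally show ?thesis .
qed

lemma relative_growth_bounds:
  fixes \<eta> :: real
  assumes "0 \<le> \<eta>" "\<eta> \<le> 1/100" "q \<le> 5"
  shows "1 + q * \<eta> \<le> 1 / (1 - \<eta>) ^ q" "1 / (1 - \<eta>) ^ q \<le> 1 + q * \<eta> + 50 * \<eta>\<^sup>2"
proof -
  have p: "0 < (1 - \<eta>) ^ q" using assms by simp
  have "1 + real q * \<eta> \<le> (1 + \<eta>) ^ q" using assms by (intro Bernoulli_inequality) auto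
  also have "\<dots> \<le> 1 / (1 - \<eta>) ^ q"
  proof -
    have "((1 + \<eta>) * (1 - \<eta>)) ^ q \<le> 1" using assms
      by (intro power_le_one) (auto simp: algebra_simps power2_eq_square[symmetric] power_le_one intro: mult_le_one)
    then show ?thesis using p by (simp add: pos_le_divide_eq power_mult_distrib)
  qed
  finally show "1 + q * \<eta> \<le> 1 / (1 - \<eta>) ^ q" .
  define t where "t = real q * \<eta>"
  have t: "0 \<le> t" "t \<le> 1/20" "t \<le> 5 * \<eta>" unfolding t_def using assms mult_mono[of "real q" 5 \<eta> "1/100"]
    by (auto intro: mult_right_mono)
  have "1 + real q * (- \<eta>) \<le> (1 + (- \<eta>)) ^ q" using assms by (intro Bernoulli_inequality) auto
  then have l: "1 - t \<le> (1 - \<eta>) ^ q" by (simp add: t_def)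
  have "1 / (1 - \<eta>) ^ q \<le> 1 / (1 - t)" using l t by (intro divide_left_mono) auto
  also have "\<dots> \<le> 1 + t + 2 * t\<^sup>2"
  proof -
    have "1 \<le> (1 + t + 2 * t\<^sup>2) * (1 - t)"
    proof -
      have "(1 + t + 2 * t\<^sup>2) * (1 - t) = 1 + t\<^sup>2 * (1 - 2 * t)" by (simp add: algebra_simps power2_eq_square)
      moreover have "0 \<le> t\<^sup>2 * (1 - 2 * t)" using t by (intro mult_nonneg_nonneg) auto
      ultimately show ?thesis by linarith
    qed
    then show ?thesis using t by (simp add: pos_divide_le_eq)
  qed
  also have "t\<^sup>2 \<le> (5 * \<eta>)\<^sup>2" using t by (intro power_mono) auto
  finally show "1 / (1 - \<eta>) ^ q \<le> 1 + q * \<eta> + 50 * \<eta>\<^sup>2"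
    by (simp add: t_def power_mult_distrib)
qed

text \<open>One step of the process, seen from one vertex. Here \<open>Y\<close> is the degree of the vertex relative to its
  expected value, \<open>x e\<close> is the relative loss when the edge \<open>e\<close> is chosen, and \<open>s\<close> is the factor by
  which the expected value shrinks, so that \<open>Y\<close> becomes \<open>s * Y - s * x e\<close>. On average the
  loss is what the expected value predicts, up to a relative error \<open>O(\<xi>)\<close>; the second-order
  term of the exponential is of the same size since \<open>\<kappa> * \<zeta> \<le> \<xi>\<close>. Both errors are absorbed by letting
  the tolerance grow from \<open>\<xi>\<close> to \<open>\<xi>'\<close>, with room to spare in the constant 2200.\<close>
lemma exponential_step:
  fixes x :: "'a \<Rightarrow> real" and Y s \<eta> \<xi> \<zeta> \<kappa> A \<xi>' :: real and q :: nat
  defines "s \<equiv> 1 / (1 - \<eta>) ^ q"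
  assumes S: "finite S" "real (card S) \<le> A" "A - real (card S) \<le> 3 * \<eta> * A" and A: "0 < A"
    and x: "\<And>e. e \<in> S \<Longrightarrow> 0 \<le> x e" "\<And>e. e \<in> S \<Longrightarrow> x e \<le> 6 * \<zeta>"
    and up: "(\<Sum>e\<in>S. x e) \<le> A * (Y * q * \<eta> * (1 + 4 * \<xi>))"
    and lo: "A * (Y * \<eta> * (q - 2 * (real q * \<xi>) - 36 * \<zeta>)) \<le> (\<Sum>e\<in>S. x e)"
    and q: "q \<le> 5" and Y: "0 \<le> Y" "Y \<le> 2"
    and par: "0 \<le> \<eta>" "\<eta> \<le> \<zeta>" "\<zeta> \<le> \<xi>" "\<xi> \<le> 1/100" "\<kappa> \<ge> 1" "\<kappa> * \<zeta> \<le> \<xi>"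
    and \<xi>': "\<xi> * (1 + 2200 * \<eta>) \<le> \<xi>'"
  shows "(\<Sum>e\<in>S. exp (\<kappa> * (s * Y - s * x e - 1 - \<xi>'))) \<le> A * exp (\<kappa> * (Y - 1 - \<xi>))" (is ?up)
    and "(\<Sum>e\<in>S. exp (\<kappa> * (1 - \<xi>' - (s * Y - s * x e)))) \<le> A * exp (\<kappa> * (1 - \<xi> - Y))" (is ?lo)
proof -
  define X where "X = (\<Sum>e\<in>S. x e)"
  define z where "z = (\<lambda>e. (s - 1) * Y - s * x e)"
  have small: "\<eta> \<le> 1/100" "\<zeta> \<le> 1/100" "0 \<le> \<zeta>" "0 \<le> \<xi>" using par by auto
  have s: "1 + q * \<eta> \<le> s" "s \<le> 1 + q * \<eta> + 50 * \<eta>\<^sup>2"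
    using relative_growth_bounds[of \<eta> q] par q small unfolding s_def by auto
  have e2: "50 * \<eta>\<^sup>2 \<le> \<eta>"
  proof -
    have "\<eta> * (50 * \<eta>) \<le> \<eta> * 1" using small par by (intro mult_left_mono) auto
    then show ?thesis by (simp add: power2_eq_square)
  qed
  have s2: "s - 1 \<le> 6 * \<eta>" "s \<le> 2" "1 \<le> s" "0 \<le> s - 1"
  proof -
    have "q * \<eta> \<le> 5 * \<eta>" "0 \<le> q * \<eta>" using q par by (auto intro: mult_right_mono)
    then show "s - 1 \<le> 6 * \<eta>" "s \<le> 2" "1 \<le> s" "0 \<le> s - 1" using s e2 small by linarith+
  qed
  have X0: "0 \<le> X" unfolding X_def using x by (auto intro: sum_nonneg)
  have YA: "0 \<le> A * Y" "0 \<le> A * Y * \<eta>" using A Y par by auto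
  have \<eta>\<xi>: "\<eta> * \<eta> \<le> \<eta> * \<xi>" using par by (intro mult_left_mono) auto
  have \<eta>\<zeta>: "\<eta> * \<zeta> \<le> \<eta> * \<xi>" using par by (intro mult_left_mono) auto
  have q\<xi>: "\<eta> * (q * \<xi>) \<le> \<eta> * (5 * \<xi>)" using par q small by (intro mult_left_mono mult_right_mono) auto
  have YB: "A * Y * (\<eta> * \<xi> * c) \<le> A * (2 * c * (\<eta> * \<xi>))" if "0 \<le> c" for c
  proof -
    have "A * Y * (\<eta> * \<xi> * c) = A * (\<eta> * \<xi> * c) * Y" by simp
    also have "\<dots> \<le> A * (\<eta> * \<xi> * c) * 2" using A par small that Y by (intro mult_left_mono) auto
    finally show ?thesis by (simp add: ac_simps)
  qed
  have zsum: "(\<Sum>e\<in>S. z e) = (s - 1) * Y * card S - s * X"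
    by (simp add: z_def X_def sum_subtractf sum_distrib_left)
  have mean_up: "(\<Sum>e\<in>S. z e) \<le> A * (200 * (\<eta> * \<xi>))"
  proof -
    have "(s - 1) * Y * card S \<le> (s - 1) * Y * A" using S s2 Y by (intro mult_left_mono) auto
    moreover have "(s - 1) * Y * A \<le> (q * \<eta> + 50 * \<eta>\<^sup>2) * (A * Y)"
      using s YA mult_right_mono[of "s - 1" "q * \<eta> + 50 * \<eta>\<^sup>2" "A * Y"] by (simp add: ac_simps)
    moreover have "X \<le> s * X" using s2 X0 mult_right_mono[of 1 s X] by simp
    moreover have "A * (Y * \<eta> * (q - 2 * (real q * \<xi>) - 36 * \<zeta>)) \<le> X" using lo by (simp add: X_def)
    ultimately have "(\<Sum>e\<in>S. z e) \<le> (q * \<eta> + 50 * \<eta>\<^sup>2) * (A * Y) - A * (Y * \<eta> * (q - 2 * (real q * \<xi>) - 36 * \<zeta>))"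
      unfolding zsum by linarith
    also have "\<dots> = A * Y * (50 * (\<eta> * \<eta>) + 2 * (\<eta> * (q * \<xi>)) + 36 * (\<eta> * \<zeta>))"
      by (simp add: algebra_simps power2_eq_square)
    also have "\<dots> \<le> A * Y * (\<eta> * \<xi> * 96)"
      using \<eta>\<xi> \<eta>\<zeta> q\<xi> YA by (intro mult_left_mono) (auto simp: algebra_simps)
    also have "\<dots> \<le> A * (2 * 96 * (\<eta> * \<xi>))" by (rule YB) auto
    also have "\<dots> \<le> A * (200 * (\<eta> * \<xi>))" using A par small by (intro mult_left_mono) (auto intro: mult_right_mono)
    finally show ?thesis .
  qed
  have Xup: "X \<le> A * Y * (q * \<eta> * (1 + 4 * \<xi>))" using up by (simp add: X_def ac_simps)
  have mean_lo: "(\<Sum>e\<in>S. - z e) \<le> A * (200 * (\<eta> * \<xi>))"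
  proof -
    have "(s - 1) * Y * (A - card S) \<le> (s - 1) * Y * (3 * \<eta> * A)" using S s2 Y by (intro mult_left_mono) auto
    also have "\<dots> = (s - 1) * (A * Y * (3 * \<eta>))" by simp
    also have "\<dots> \<le> (6 * \<eta>) * (A * Y * (3 * \<eta>))"
      using s2 YA par by (intro mult_right_mono) auto
    finally have 1: "(s - 1) * Y * (A - card S) \<le> A * Y * (18 * (\<eta> * \<eta>))" by (simp add: ac_simps)
    have 2: "s * X \<le> s * (A * Y * (q * \<eta> * (1 + 4 * \<xi>)))" using Xup s2 by (intro mult_left_mono) auto
    have 3: "A * Y * (q * \<eta>) \<le> A * Y * (s - 1)" using s YA by (intro mult_left_mono) auto
    have 4: "s * (1 + 4 * \<xi>) \<le> 1 + 11 * \<xi>"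
    proof -
      have "s * (1 + 4 * \<xi>) \<le> (1 + 6 * \<eta>) * (1 + 4 * \<xi>)" using s2 small by (intro mult_right_mono) auto
      also have "\<dots> = 1 + 6 * \<eta> + 4 * \<xi> + 24 * (\<eta> * \<xi>)" by (simp add: algebra_simps)
      also have "\<eta> * \<xi> \<le> 1/100 * \<xi>" using small by (intro mult_right_mono) auto
      finally show ?thesis using par small by linarith
    qed
    have "s * (A * Y * (q * \<eta> * (1 + 4 * \<xi>))) = A * Y * (q * \<eta>) * (s * (1 + 4 * \<xi>))" by simp
    also have "\<dots> \<le> A * Y * (q * \<eta>) * (1 + 11 * \<xi>)" using 4 YA par by (intro mult_left_mono) auto
    finally have "s * X \<le> A * Y * (q * \<eta>) + 11 * (A * Y * (\<eta> * (q * \<xi>)))" using 2 by (simp add: algebra_simps)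
    moreover have "A * Y * (\<eta> * (q * \<xi>)) \<le> A * Y * (\<eta> * (5 * \<xi>))" using q\<xi> YA(1) by (rule mult_left_mono)
    moreover have "(\<Sum>e\<in>S. - z e) = s * X - A * Y * (s - 1) + (s - 1) * Y * (A - card S)"
      by (simp add: sum_negf zsum algebra_simps)
    moreover have "A * Y * (18 * (\<eta> * \<eta>)) \<le> A * Y * (18 * (\<eta> * \<xi>))" using mult_left_mono[OF \<eta>\<xi> YA(1)] by simp
    ultimately have "(\<Sum>e\<in>S. - z e) \<le> A * Y * (\<eta> * \<xi> * 73)" using 1 3 by (simp add: algebra_simps)
    also have "\<dots> \<le> A * (2 * 73 * (\<eta> * \<xi>))" by (rule YB) auto
    also have "\<dots> \<le> A * (200 * (\<eta> * \<xi>))" using A par small by (intro mult_left_mono) (auto intro: mult_right_mono)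
    finally show ?thesis .
  qed
  have zabs: "\<bar>z e\<bar> \<le> 12 * \<eta> + 2 * x e" if "e \<in> S" for e
  proof -
    have "(s - 1) * Y \<le> 6 * \<eta> * 2" using s2 Y par by (intro mult_mono) auto
    moreover have "0 \<le> (s - 1) * Y" using s2 Y by auto
    moreover have "0 \<le> s * x e" "s * x e \<le> 2 * x e" using s2 x[OF that] by (auto intro: mult_right_mono)
    ultimately show ?thesis by (simp add: z_def abs_le_iff)
  qed
  have zmax: "\<bar>z e\<bar> \<le> 24 * \<zeta>" if "e \<in> S" for e
    using zabs[OF that] x(2)[OF that] par by linarith
  have zsq: "(\<Sum>e\<in>S. (z e)\<^sup>2) \<le> A * (2000 * (\<eta> * \<zeta>))"
  proof -
    have "(\<Sum>e\<in>S. (z e)\<^sup>2) \<le> (\<Sum>e\<in>S. 24 * \<zeta> * (12 * \<eta> + 2 * x e))"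
    proof (rule sum_mono)
      fix e assume e: "e \<in> S"
      have "(z e)\<^sup>2 = \<bar>z e\<bar> * \<bar>z e\<bar>" by (simp add: power2_eq_square)
      also have "\<dots> \<le> 24 * \<zeta> * (12 * \<eta> + 2 * x e)"
        using zabs[OF e] zmax[OF e] small by (intro mult_mono) auto
      finally show "(z e)\<^sup>2 \<le> 24 * \<zeta> * (12 * \<eta> + 2 * x e)" .
    qed
    also have "\<dots> = 24 * \<zeta> * (12 * \<eta> * card S + 2 * X)"
      by (simp add: sum_distrib_left[symmetric] sum.distrib X_def)
    also have "\<dots> \<le> 24 * \<zeta> * (12 * \<eta> * A + 2 * (30 * \<eta> * A))"
    proof -
      have "X \<le> A * Y * (q * \<eta> * (1 + 4 * \<xi>))" by (rule Xup)
      also have "\<dots> \<le> A * 2 * (5 * \<eta> * 3)" using A Y par q small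
        by (intro mult_mono mult_nonneg_nonneg) auto
      finally have "X \<le> 30 * \<eta> * A" by (simp add: ac_simps)
      moreover have "12 * \<eta> * card S \<le> 12 * \<eta> * A" using S par by (intro mult_left_mono) auto
      ultimately show ?thesis using small by (intro mult_left_mono) linarith+
    qed
    also have "\<dots> = A * (1728 * (\<eta> * \<zeta>))" by simp
    also have "\<dots> \<le> A * (2000 * (\<eta> * \<zeta>))" using A small par by (intro mult_left_mono mult_right_mono) auto
    finally show ?thesis .
  qed
  have kz: "\<bar>\<kappa> * z e\<bar> \<le> 1" if "e \<in> S" for e
  proof -
    have "\<bar>\<kappa> * z e\<bar> = \<kappa> * \<bar>z e\<bar>" using par by (simp add: abs_mult)
    also have "\<dots> \<le> \<kappa> * (24 * \<zeta>)" using zmax[OF that] par by (intro mult_left_mono) auto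
    also have "\<dots> \<le> 1" using par by simp
    finally show ?thesis .
  qed
  have ksq: "(\<Sum>e\<in>S. (\<kappa> * z e)\<^sup>2) \<le> A * (\<kappa> * (2000 * (\<eta> * \<xi>)))"
  proof -
    have "(\<Sum>e\<in>S. (\<kappa> * z e)\<^sup>2) = \<kappa>\<^sup>2 * (\<Sum>e\<in>S. (z e)\<^sup>2)" by (simp add: power_mult_distrib sum_distrib_left)
    also have "\<dots> \<le> \<kappa>\<^sup>2 * (A * (2000 * (\<eta> * \<zeta>)))" using zsq by (intro mult_left_mono) auto
    also have "\<dots> = A * (\<kappa> * (2000 * (\<eta> * (\<kappa> * \<zeta>))))" by (simp add: power2_eq_square)
    also have "\<dots> \<le> A * (\<kappa> * (2000 * (\<eta> * \<xi>)))" using A par by (intro mult_left_mono) auto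
    finally show ?thesis .
  qed
  have core: "(\<Sum>e\<in>S. exp (\<kappa> * w e)) \<le> A * exp (\<kappa> * (2200 * \<eta> * \<xi>))"
    if w: "w = z \<or> w = (\<lambda>e. - z e)" for w
  proof -
    have "(\<Sum>e\<in>S. w e) \<le> A * (200 * (\<eta> * \<xi>))" using mean_up mean_lo w by auto
    then have "\<kappa> * (\<Sum>e\<in>S. w e) \<le> \<kappa> * (A * (200 * (\<eta> * \<xi>)))" using par by (intro mult_left_mono) auto
    then have lin: "(\<Sum>e\<in>S. \<kappa> * w e) \<le> A * (\<kappa> * (200 * (\<eta> * \<xi>)))" by (simp add: sum_distrib_left ac_simps)
    have "(\<Sum>e\<in>S. exp (\<kappa> * w e)) \<le> A * exp (\<kappa> * (200 * (\<eta> * \<xi>)) + \<kappa> * (2000 * (\<eta> * \<xi>)))"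
      using S A kz ksq w by (intro sum_exp_le lin) auto
    also have "\<kappa> * (200 * (\<eta> * \<xi>)) + \<kappa> * (2000 * (\<eta> * \<xi>)) = \<kappa> * (2200 * \<eta> * \<xi>)" by simp
    finally show ?thesis .
  qed
  have fin: "(\<Sum>e\<in>S. exp (\<kappa> * w e)) * exp (\<kappa> * (c - \<xi>')) \<le> A * exp (\<kappa> * (c - \<xi>))"
    if w: "w = z \<or> w = (\<lambda>e. - z e)" for w c
  proof -
    have "(\<Sum>e\<in>S. exp (\<kappa> * w e)) * exp (\<kappa> * (c - \<xi>')) \<le> A * exp (\<kappa> * (2200 * \<eta> * \<xi>)) * exp (\<kappa> * (c - \<xi>'))"
      using core[OF w] by (intro mult_right_mono) auto
    also have "\<dots> = A * exp (\<kappa> * (2200 * \<eta> * \<xi> + c - \<xi>'))" by (simp add: exp_add[symmetric] algebra_simps)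
    also have "\<dots> \<le> A * exp (\<kappa> * (c - \<xi>))" using A \<xi>' par
      by (intro mult_left_mono iffD2[OF exp_le_cancel_iff]) (auto simp: algebra_simps)
    finally show ?thesis .
  qed
  have "(\<Sum>e\<in>S. exp (\<kappa> * (s * Y - s * x e - 1 - \<xi>'))) = (\<Sum>e\<in>S. exp (\<kappa> * z e)) * exp (\<kappa> * ((Y - 1) - \<xi>'))"
    unfolding sum_distrib_right exp_add[symmetric] by (intro sum.cong arg_cong[of _ _ exp]) (auto simp: z_def algebra_simps)
  then show ?up using fin[of z "Y - 1"] by simp
  have "(\<Sum>e\<in>S. exp (\<kappa> * (1 - \<xi>' - (s * Y - s * x e)))) = (\<Sum>e\<in>S. exp (\<kappa> * - z e)) * exp (\<kappa> * ((1 - Y) - \<xi>'))"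
    unfolding sum_distrib_right exp_add[symmetric] by (intro sum.cong arg_cong[of _ _ exp]) (auto simp: z_def algebra_simps)
  then show ?lo using fin[of "\<lambda>e. - z e" "1 - Y"] by (simp add: algebra_simps)
qed

section \<open>A greedy process in regular hypergraphs\<close>

text \<open>Several uniform hypergraphs on the same vertices, indexed by their edge size; each of them is regular
  and has codegrees that are small compared with its degree. Two of them occur below: on the pairs of
  points, the triples are edges with three vertices and the quadruples are edges with six vertices.\<close>
locale regular_hypergraphs =
  fixes V :: "'v set" and K :: "nat set" and H :: "nat \<Rightarrow> 'v set set"
    and D :: "nat \<Rightarrow> real" and \<theta> :: real
  assumes finite_V: "finite V" and V_nonempty: "V \<noteq> {}"
    and K: "K \<subseteq> {1..6}"
    and edge: "\<And>k e. k \<in> K \<Longrightarrow> e \<in> H k \<Longrightarrow> e \<subseteq> V \<and> card e = k"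
    and D_pos: "\<And>k. k \<in> K \<Longrightarrow> 0 < D k"
    and degree: "\<And>k v. k \<in> K \<Longrightarrow> v \<in> V \<Longrightarrow> real (card {e \<in> H k. v \<in> e}) = D k"
    and codegree: "\<And>k u v. k \<in> K \<Longrightarrow> u \<in> V \<Longrightarrow> v \<in> V \<Longrightarrow> u \<noteq> v \<Longrightarrow>
                     real (card {e \<in> H k. u \<in> e \<and> v \<in> e}) \<le> \<theta> * D k"
    and \<theta>_large: "6 / card V \<le> \<theta>"
begin

abbreviation N :: real where "N \<equiv> real (card V)"

text \<open>A state of the process is the set \<open>U\<close> of vertices that are not yet covered; the edges inside \<open>U\<close> are the
  ones that can still be chosen.\<close>
definition edges :: "nat \<Rightarrow> 'v set \<Rightarrow> 'v set set" where
  "edges k U = {e \<in> H k. e \<subseteq> U}"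

definition deg :: "nat \<Rightarrow> 'v set \<Rightarrow> 'v \<Rightarrow> real" where
  "deg k U v = real (card {e \<in> edges k U. v \<in> e})"

definition density :: "'v set \<Rightarrow> real" where
  "density U = card U / N"

text \<open>In a random subset \<open>U\<close> of this density, the \<open>k - 1\<close> other vertices of an edge at \<open>v\<close> all lie in \<open>U\<close> with
  probability \<open>density U ^ (k - 1)\<close>; so \<open>reldeg\<close> is close to 1 in a typical state.\<close>
definition reldeg :: "nat \<Rightarrow> 'v set \<Rightarrow> 'v \<Rightarrow> real" where
  "reldeg k U v = deg k U v / (D k * density U ^ (k - 1))"

lemma N_pos: "0 < N"
  using finite_V V_nonempty by (simp add: card_gt_0_iff)

lemma finite_K: "finite K"
  using K finite_subset by blast

lemma finite_H: "k \<in> K \<Longrightarrow> finite (H k)"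
  by (rule finite_subset[of _ "Pow V"]) (use edge finite_V in auto)

lemma finite_edges: "k \<in> K \<Longrightarrow> finite (edges k U)"
  unfolding edges_def using finite_H by auto

lemma edges_D: "k \<in> K \<Longrightarrow> e \<in> edges k U \<Longrightarrow> e \<subseteq> U \<and> e \<subseteq> V \<and> card e = k \<and> finite e"
  using edge[of k e] finite_subset[OF _ finite_V, of e] by (auto simp: edges_def)

lemma (in -) card_as_sum: "finite A \<Longrightarrow> real (card {x \<in> A. P x}) = (\<Sum>x\<in>A. of_bool (P x))"
  by (simp add: Collect_conj_eq)

lemma codegree_edges:
  assumes "k \<in> K" "u \<in> V" "v \<in> V" "u \<noteq> v"
  shows "real (card {e \<in> edges k U. u \<in> e \<and> v \<in> e}) \<le> \<theta> * D k"
proof -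
  have "card {e \<in> edges k U. u \<in> e \<and> v \<in> e} \<le> card {e \<in> H k. u \<in> e \<and> v \<in> e}"
    using finite_H[OF assms(1)] by (intro card_mono) (auto simp: edges_def)
  then show ?thesis using codegree[OF assms] by linarith
qed

lemma sum_deg:
  assumes "k \<in> K" "U \<subseteq> V"
  shows "(\<Sum>v\<in>U. deg k U v) = real k * card (edges k U)"
proof -
  have fU: "finite U" using assms finite_V finite_subset by blast
  have "(\<Sum>v\<in>U. deg k U v) = (\<Sum>v\<in>U. \<Sum>e\<in>edges k U. of_bool (v \<in> e))"
    unfolding deg_def using assms by (intro sum.cong refl card_as_sum finite_edges)
  also have "\<dots> = (\<Sum>e\<in>edges k U. \<Sum>v\<in>U. of_bool (v \<in> e))" by (rule sum.swap)
  also have "\<dots> = (\<Sum>e\<in>edges k U. real k)"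
  proof (rule sum.cong[OF refl])
    fix e assume e: "e \<in> edges k U"
    have "{v \<in> U. v \<in> e} = e" using edges_D[OF assms(1) e] by auto
    then show "(\<Sum>v\<in>U. of_bool (v \<in> e)) = real k"
      using card_as_sum[OF fU, of "\<lambda>v. v \<in> e"] edges_D[OF assms(1) e] by simp
  qed
  finally show ?thesis by simp
qed

definition loss :: "nat \<Rightarrow> 'v set \<Rightarrow> 'v \<Rightarrow> 'v set \<Rightarrow> real" where
  "loss l U v e = real (card {f \<in> edges l U. v \<in> f \<and> f \<inter> e \<noteq> {}})"

lemma deg_Diff:
  assumes "l \<in> K" "v \<notin> e"
  shows "deg l (U - e) v = deg l U v - loss l U v e"
proof -
  define X Y Z where "X = {f \<in> edges l U. v \<in> f}" and "Y = {f \<in> edges l (U - e). v \<in> f}"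
    and "Z = {f \<in> edges l U. v \<in> f \<and> f \<inter> e \<noteq> {}}"
  have "X = Y \<union> Z" unfolding X_def Y_def Z_def edges_def by blast
  moreover have "Y \<inter> Z = {}" unfolding Y_def Z_def edges_def by blast
  moreover have "finite Y" "finite Z" using finite_edges[OF assms(1)] by (simp_all add: Y_def Z_def)
  ultimately have "card X = card Y + card Z" by (simp add: card_Un_disjoint)
  then show ?thesis by (simp add: deg_def loss_def X_def Y_def Z_def)
qed

lemma loss_le:
  assumes "l \<in> K" "k \<in> K" "U \<subseteq> V" "v \<in> U" "e \<in> edges k U" "v \<notin> e"
  shows "loss l U v e \<le> 6 * (\<theta> * D l)"
proof -
  have e: "e \<subseteq> U" "finite e" "card e = k" using edges_D assms by auto
  have "{f \<in> edges l U. v \<in> f \<and> f \<inter> e \<noteq> {}} = (\<Union>u\<in>e. {f \<in> edges l U. u \<in> f \<and> v \<in> f})" by auto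
  then have "card {f \<in> edges l U. v \<in> f \<and> f \<inter> e \<noteq> {}} \<le> (\<Sum>u\<in>e. card {f \<in> edges l U. u \<in> f \<and> v \<in> f})"
    using card_UN_le[OF e(2), of "\<lambda>u. {f \<in> edges l U. u \<in> f \<and> v \<in> f}"] by simp
  then have "loss l U v e \<le> real (\<Sum>u\<in>e. card {f \<in> edges l U. u \<in> f \<and> v \<in> f})"
    unfolding loss_def by (rule of_nat_mono)
  also have "\<dots> = (\<Sum>u\<in>e. real (card {f \<in> edges l U. u \<in> f \<and> v \<in> f}))" by simp
  also have "\<dots> \<le> (\<Sum>u\<in>e. \<theta> * D l)"
    using assms e by (intro sum_mono codegree_edges) auto
  also have "\<dots> = real k * (\<theta> * D l)" using e by simp
  also have "\<dots> \<le> 6 * (\<theta> * D l)"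
  proof -
    have "0 \<le> \<theta>" using \<theta>_large N_pos by (smt (verit) divide_nonneg_nonneg)
    then show ?thesis using K assms(2) D_pos[OF assms(1)] by (intro mult_right_mono) auto
  qed
  finally show ?thesis .
qed

text \<open>The number of edges that meet \<open>f - {v}\<close> but avoid \<open>v\<close> is the sum of the degrees over \<open>f - {v}\<close>, up to
  double counting and edges through \<open>v\<close>, which the codegrees bound. So the average loss can be
  expressed by degrees alone, and no quantities other than the degrees have to be tracked.\<close>
lemma meeting_bounds:
  assumes k: "k \<in> K" and l: "l \<in> K" and U: "U \<subseteq> V" and f: "f \<in> edges l U" "v \<in> f"
  defines "M \<equiv> real (card {e \<in> edges k U. v \<notin> e \<and> f \<inter> e \<noteq> {}})"
  shows "M \<le> (\<Sum>u\<in>f - {v}. deg k U u)"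
    and "(\<Sum>u\<in>f - {v}. deg k U u) - 36 * (\<theta> * D k) \<le> M"
proof -
  define g where "g = f - {v}"
  have f': "f \<subseteq> U" "card f = l" "finite f" using edges_D[OF l f(1)] by simp_all
  have fg: "finite g" "card g = l - 1" "g \<subseteq> V" "v \<in> V" "v \<notin> g" "f = insert v g"
    using f' f(2) U by (simp_all add: g_def subset_eq insert_absorb)
  have l6: "1 \<le> l" "l \<le> 6" using K l by auto
  have fe: "finite (edges k U)" by (rule finite_edges[OF k])
  have Meq: "M = (\<Sum>e\<in>edges k U. of_bool (v \<notin> e \<and> g \<inter> e \<noteq> {}))"
  proof -
    have "v \<notin> e \<and> f \<inter> e \<noteq> {} \<longleftrightarrow> v \<notin> e \<and> g \<inter> e \<noteq> {}" for e using fg(6) by blast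
    then show ?thesis unfolding M_def card_as_sum[OF fe] by simp
  qed
  have ge: "real (card {u\<in>g. u \<in> e}) = (\<Sum>u\<in>g. of_bool (u \<in> e))" for e by (rule card_as_sum[OF fg(1)])
  have degs: "(\<Sum>u\<in>g. deg k U u) = (\<Sum>e\<in>edges k U. real (card {u\<in>g. u \<in> e}))"
    unfolding deg_def card_as_sum[OF fe] ge by (rule sum.swap)
  show "M \<le> (\<Sum>u\<in>f - {v}. deg k U u)"
    unfolding g_def[symmetric] degs Meq
  proof (rule sum_mono)
    fix e
    show "of_bool (v \<notin> e \<and> g \<inter> e \<noteq> {}) \<le> real (card {u \<in> g. u \<in> e})"
    proof (cases "g \<inter> e = {}")
      case False
      then have "card {u \<in> g. u \<in> e} > 0" using fg by (auto simp: card_gt_0_iff)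
      then show ?thesis by simp
    qed simp
  qed
  \<comment> \<open>Bonferroni: an edge with $j \ge 1$ vertices in $g$ is counted $j \le 1 + j (j - 1)$ times by the degrees.\<close>
  define P where "P = {p \<in> g \<times> g. fst p \<noteq> snd p}"
  have P: "finite P" "card P \<le> 25"
  proof -
    show "finite P" using fg by (auto simp: P_def)
    have "card P \<le> card (g \<times> g)" unfolding P_def using fg by (intro card_mono) auto
    also have "\<dots> = (l - 1) * (l - 1)" using fg by (simp add: card_cartesian_product)
    also have "\<dots> \<le> 5 * 5" using l6 by (intro mult_le_mono) auto
    finally show "card P \<le> 25" by simp
  qed
  have pw: "real (card {u\<in>g. u \<in> e}) \<le> of_bool (v \<notin> e \<and> g \<inter> e \<noteq> {})
      + (\<Sum>p\<in>P. of_bool (fst p \<in> e \<and> snd p \<in> e)) + (\<Sum>u\<in>g. of_bool (u \<in> e \<and> v \<in> e))" for e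
  proof -
    define j where "j = card {u\<in>g. u \<in> e}"
    have P0: "0 \<le> (\<Sum>p\<in>P. of_bool (fst p \<in> e \<and> snd p \<in> e) :: real)" by (intro sum_nonneg) auto
    consider "v \<in> e" | "g \<inter> e = {}" | "v \<notin> e" "g \<inter> e \<noteq> {}" by blast
    then show ?thesis
    proof cases
      case 1
      then show ?thesis using P0 ge[of e] by (auto intro!: add_nonneg_nonneg)
    next
      case 2
      then have "{u\<in>g. u \<in> e} = {}" by auto
      then show ?thesis using P0 by (simp only: card.empty) (auto intro!: add_nonneg_nonneg sum_nonneg)
    next
      case 3
      then obtain u0 where u0: "u0 \<in> g" "u0 \<in> e" by auto
      have "{u\<in>g. u \<in> e} = insert u0 {u\<in>g. u \<in> e \<and> u \<noteq> u0}" using u0 by auto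
      then have "j = card (insert u0 {u\<in>g. u \<in> e \<and> u \<noteq> u0})" unfolding j_def by (rule arg_cong)
      also have "\<dots> = Suc (card {u\<in>g. u \<in> e \<and> u \<noteq> u0})" using fg by (intro card_insert_disjoint) auto
      finally have "j = Suc (card {u\<in>g. u \<in> e \<and> u \<noteq> u0})" .
      moreover have "card {u\<in>g. u \<in> e \<and> u \<noteq> u0} \<le> card {p \<in> P. fst p \<in> e \<and> snd p \<in> e}"
      proof (rule card_inj_on_le[of "\<lambda>u. (u0, u)"])
        show "finite {p \<in> P. fst p \<in> e \<and> snd p \<in> e}" using P(1) by simp
      qed (use u0 in \<open>auto simp: P_def inj_on_def\<close>)
      moreover have "real (card {p \<in> P. fst p \<in> e \<and> snd p \<in> e}) = (\<Sum>p\<in>P. of_bool (fst p \<in> e \<and> snd p \<in> e))"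
        by (rule card_as_sum[OF P(1)])
      moreover have "0 \<le> (\<Sum>u\<in>g. of_bool (u \<in> e \<and> v \<in> e) :: real)" by (intro sum_nonneg) auto
      ultimately show ?thesis using 3 unfolding j_def[symmetric] by simp
    qed
  qed
  have "(\<Sum>u\<in>g. deg k U u) \<le> (\<Sum>e\<in>edges k U. of_bool (v \<notin> e \<and> g \<inter> e \<noteq> {})
      + (\<Sum>p\<in>P. of_bool (fst p \<in> e \<and> snd p \<in> e)) + (\<Sum>u\<in>g. of_bool (u \<in> e \<and> v \<in> e)))"
    unfolding degs by (intro sum_mono pw)
  also have "\<dots> = M + (\<Sum>e\<in>edges k U. \<Sum>p\<in>P. of_bool (fst p \<in> e \<and> snd p \<in> e))
      + (\<Sum>e\<in>edges k U. \<Sum>u\<in>g. of_bool (u \<in> e \<and> v \<in> e))"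
    by (simp add: sum.distrib Meq)
  also have "(\<Sum>e\<in>edges k U. \<Sum>p\<in>P. of_bool (fst p \<in> e \<and> snd p \<in> e)) =
      (\<Sum>p\<in>P. real (card {e\<in>edges k U. fst p \<in> e \<and> snd p \<in> e}))"
    unfolding card_as_sum[OF fe] by (rule sum.swap)
  also have "(\<Sum>e\<in>edges k U. \<Sum>u\<in>g. of_bool (u \<in> e \<and> v \<in> e)) =
      (\<Sum>u\<in>g. real (card {e\<in>edges k U. u \<in> e \<and> v \<in> e}))"
    unfolding card_as_sum[OF fe] by (rule sum.swap)
  also have "(\<Sum>p\<in>P. real (card {e\<in>edges k U. fst p \<in> e \<and> snd p \<in> e})) \<le> (\<Sum>p\<in>P. \<theta> * D k)"
    using fg k by (intro sum_mono codegree_edges) (auto simp: P_def)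
  also have "(\<Sum>u\<in>g. real (card {e\<in>edges k U. u \<in> e \<and> v \<in> e})) \<le> (\<Sum>u\<in>g. \<theta> * D k)"
    using fg k by (intro sum_mono codegree_edges) (auto simp: P_def)
  finally have "(\<Sum>u\<in>g. deg k U u) \<le> M + (card P + card g) * (\<theta> * D k)" by (simp add: algebra_simps)
  also have "\<dots> \<le> M + 36 * (\<theta> * D k)"
  proof -
    have "0 \<le> \<theta>" using \<theta>_large N_pos by (smt (verit) divide_nonneg_nonneg)
    moreover have "card P + card g \<le> 36" using P fg l6 by simp
    ultimately show ?thesis using D_pos[OF k] by (intro add_left_mono mult_right_mono) auto
  qed
  finally show "(\<Sum>u\<in>f - {v}. deg k U u) - 36 * (\<theta> * D k) \<le> M" by (simp add: g_def)
qed

text \<open>Double counting of the pairs of a chosen edge and an edge at \<open>v\<close> that it destroys.\<close>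
lemma sum_loss:
  assumes "k \<in> K" "l \<in> K"
  shows "(\<Sum>e | e \<in> edges k U \<and> v \<notin> e. loss l U v e) =
     (\<Sum>f | f \<in> edges l U \<and> v \<in> f. real (card {e \<in> edges k U. v \<notin> e \<and> f \<inter> e \<noteq> {}}))"
proof -
  have f: "finite {e \<in> edges k U. v \<notin> e}" "finite {f \<in> edges l U. v \<in> f}"
    using finite_edges assms by auto
  have "loss l U v e = (\<Sum>f | f \<in> edges l U \<and> v \<in> f. of_bool (f \<inter> e \<noteq> {}))" for e
    using card_as_sum[OF f(2), of "\<lambda>f. f \<inter> e \<noteq> {}"] by (simp add: loss_def)
  moreover have "real (card {e \<in> edges k U. v \<notin> e \<and> f \<inter> e \<noteq> {}}) = (\<Sum>e | e \<in> edges k U \<and> v \<notin> e. of_bool (f \<inter> e \<noteq> {}))" for f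
    using card_as_sum[OF f(1), of "\<lambda>e. f \<inter> e \<noteq> {}"] by simp
  ultimately show ?thesis using sum.swap by simp
qed

text \<open>A value below 1 forces every relative degree to be within \<open>\<xi>0 / density U ^ 2200\<close> of 1. Letting
  the tolerance grow like a power of the inverse density compensates the accumulating errors.\<close>
definition potential :: "real \<Rightarrow> real \<Rightarrow> 'v set \<Rightarrow> real" where
  "potential \<kappa> \<xi>0 U = (\<Sum>l\<in>K. \<Sum>v\<in>U.
      exp (\<kappa> * (reldeg l U v - 1 - \<xi>0 / density U ^ 2200)) +
      exp (\<kappa> * (1 - \<xi>0 / density U ^ 2200 - reldeg l U v)))"

lemma potential_nonneg: "0 \<le> potential \<kappa> \<xi>0 U"
  unfolding potential_def by (intro sum_nonneg add_nonneg_nonneg) auto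

lemma \<theta>_pos: "0 < \<theta>"
  using \<theta>_large N_pos by (smt (verit) divide_pos_pos)

lemma reldeg_bounds_if_potential_small:
  assumes "potential \<kappa> \<xi>0 U < 1" "l \<in> K" "v \<in> U" "U \<subseteq> V" "0 < \<kappa>"
  shows "\<bar>reldeg l U v - 1\<bar> \<le> \<xi>0 / density U ^ 2200"
proof -
  define E where "E = (\<lambda>l v. exp (\<kappa> * (reldeg l U v - 1 - \<xi>0 / density U ^ 2200)) +
      exp (\<kappa> * (1 - \<xi>0 / density U ^ 2200 - reldeg l U v)))"
  have fU: "finite U" using assms finite_V finite_subset by blast
  have E0: "0 \<le> E l v" for l v unfolding E_def by (intro add_nonneg_nonneg) auto
  have "E l v \<le> (\<Sum>v\<in>U. E l v)" using assms fU E0 by (intro member_le_sum) auto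
  also have "\<dots> \<le> (\<Sum>l\<in>K. \<Sum>v\<in>U. E l v)" using assms finite_K E0 
    by (intro member_le_sum[where f = "\<lambda>l. \<Sum>v\<in>U. E l v"]) (auto intro: sum_nonneg)
  also have "\<dots> < 1" using assms by (simp add: potential_def E_def)
  finally have "E l v < 1" .
  then have "exp (\<kappa> * (reldeg l U v - 1 - \<xi>0 / density U ^ 2200)) < 1" 
      "exp (\<kappa> * (1 - \<xi>0 / density U ^ 2200 - reldeg l U v)) < 1" unfolding E_def
    by (smt (verit) exp_gt_zero)+
  then have "\<kappa> * (reldeg l U v - 1 - \<xi>0 / density U ^ 2200) < 0" 
      "\<kappa> * (1 - \<xi>0 / density U ^ 2200 - reldeg l U v) < 0" by simp_all
  then have "reldeg l U v - 1 - \<xi>0 / density U ^ 2200 < 0" 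
      "1 - \<xi>0 / density U ^ 2200 - reldeg l U v < 0" using assms(5)
     by (simp_all add: mult_less_0_iff)
  then show ?thesis by linarith
qed

lemma edges_count:
  assumes k: "k \<in> K" and U: "U \<subseteq> V" "0 < density U"
    and good: "\<And>v. v \<in> U \<Longrightarrow> \<bar>reldeg k U v - 1\<bar> \<le> \<xi>"
  defines "W \<equiv> D k * density U ^ (k - 1)"
  shows "\<And>v. v \<in> U \<Longrightarrow> deg k U v \<le> (1 + \<xi>) * W"
    and "\<And>v. v \<in> U \<Longrightarrow> (1 - \<xi>) * W \<le> deg k U v"
    and "(1 - \<xi>) * W \<le> k / card U * card (edges k U)"
    and "k / card U * card (edges k U) \<le> (1 + \<xi>) * W"
proof -
  have W: "0 < W" using D_pos[OF k] U by (simp add: W_def)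
  have dW: "deg k U v = reldeg k U v * W" for v
  proof -
    have "reldeg k U v = deg k U v / W" by (simp add: reldeg_def W_def)
    then show ?thesis using W by simp
  qed
  show up: "deg k U v \<le> (1 + \<xi>) * W" if "v \<in> U" for v
    unfolding dW using good[OF that] W by (intro mult_right_mono) auto
  show lo: "(1 - \<xi>) * W \<le> deg k U v" if "v \<in> U" for v
    unfolding dW using good[OF that] W by (intro mult_right_mono) auto
  have cU: "0 < real (card U)" using U N_pos by (simp add: density_def zero_less_divide_iff)
  have "real (card U) * ((1 - \<xi>) * W) \<le> (\<Sum>v\<in>U. deg k U v)"
    using sum_mono[of U "\<lambda>_. (1 - \<xi>) * W" "deg k U"] lo by simp
  then show "(1 - \<xi>) * W \<le> k / card U * card (edges k U)"
    unfolding sum_deg[OF k U(1)] using cU by (simp add: field_simps)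
  have "(\<Sum>v\<in>U. deg k U v) \<le> real (card U) * ((1 + \<xi>) * W)"
    using sum_mono[of U "deg k U" "\<lambda>_. (1 + \<xi>) * W"] up by simp
  then show "k / card U * card (edges k U) \<le> (1 + \<xi>) * W"
    unfolding sum_deg[OF k U(1)] using cU by (simp add: field_simps)
qed

text \<open>Exchanging the sums over the next edge and over the surviving vertices reduces the average over all
  choices to the one-vertex estimate \<open>exponential_step\<close>; vertices that get covered leave the sum, which only helps.\<close>
lemma potential_step:
  assumes k: "k \<in> K" and U: "U \<subseteq> V" "k < card U"
    and \<kappa>: "1 \<le> \<kappa>" "\<kappa> * (\<theta> / density U ^ 5) \<le> \<xi>0" and tol: "\<xi>0 / density U ^ 2200 \<le> 1 / 100"
    and small: "potential \<kappa> \<xi>0 U < 1"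
  shows "(\<Sum>e\<in>edges k U. potential \<kappa> \<xi>0 (U - e)) \<le> card (edges k U) * potential \<kappa> \<xi>0 U"
proof -
  define \<rho> where "\<rho> = density U"
  define \<xi> where "\<xi> = \<xi>0 / \<rho> ^ 2200"
  define \<zeta> where "\<zeta> = \<theta> / \<rho> ^ 5"
  define \<eta> where "\<eta> = real k / card U"
  define A where "A = real (card (edges k U))"
  define W where "W = D k * \<rho> ^ (k - 1)"
  define \<xi>' where "\<xi>' = \<xi>0 / (\<rho> * (1 - \<eta>)) ^ 2200"
  have fU: "finite U" using U finite_V finite_subset by blast
  have k16: "1 \<le> k" "k \<le> 6" using K k by auto
  have cU: "0 < real (card U)" "card U \<le> card V" using U finite_V by (auto intro: card_mono)
  have \<rho>: "0 < \<rho>" "\<rho> \<le> 1" using cU N_pos by (auto simp: \<rho>_def density_def)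
  have \<rho>pow: "0 < \<rho> ^ j" "\<rho> ^ j \<le> 1" for j using \<rho> by (auto simp: power_le_one)
  have \<zeta>: "0 < \<zeta>" using \<theta>_pos \<rho> by (simp add: \<zeta>_def)
  have \<xi>0: "0 < \<xi>0"
  proof -
    have "0 < \<kappa> * (\<theta> / density U ^ 5)" using \<kappa>(1) \<zeta> by (intro mult_pos_pos) (simp_all add: \<zeta>_def \<rho>_def)
    then show ?thesis using \<kappa> by linarith
  qed
  have \<xi>0\<xi>: "\<xi>0 \<le> \<xi>" unfolding \<xi>_def using \<rho>pow[of 2200] \<xi>0 \<rho> by (simp add: le_divide_eq mult_left_le)
  have \<kappa>\<zeta>: "\<kappa> * \<zeta> \<le> \<xi>" using \<kappa> \<xi>0\<xi> by (simp add: \<zeta>_def \<rho>_def)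
  have "1 * \<zeta> \<le> \<kappa> * \<zeta>" using \<kappa> \<zeta> by (intro mult_right_mono) auto
  then have \<zeta>\<xi>: "\<zeta> \<le> \<xi>" using \<kappa>\<zeta> by simp
  have \<xi>: "\<xi> \<le> 1/100" "0 < \<xi>" using tol \<xi>0 \<xi>0\<xi> by (auto simp: \<xi>_def \<rho>_def)
  have \<eta>0: "0 < \<eta>" "\<eta> < 1" using k16 cU U by (auto simp: \<eta>_def)
  have \<eta>\<zeta>: "\<eta> \<le> \<zeta>"
  proof -
    have "\<eta> = (k / N) / \<rho>" using N_pos cU by (simp add: \<eta>_def \<rho>_def density_def)
    also have "\<dots> \<le> \<theta> / \<rho>"
    proof (rule divide_right_mono)
      have "k / N \<le> 6 / N" using k16 N_pos by (intro divide_right_mono) auto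
      then show "k / N \<le> \<theta>" using \<theta>_large by linarith
    qed (use \<rho> in auto)
    also have "\<dots> \<le> \<theta> / \<rho> ^ 5" using \<rho> \<theta>_pos power_decreasing[of 1 5 \<rho>]
      by (intro divide_left_mono) auto
    finally show ?thesis by (simp add: \<zeta>_def)
  qed
  have good: "\<bar>reldeg l U v - 1\<bar> \<le> \<xi>" if "l \<in> K" "v \<in> U" for l v
    using reldeg_bounds_if_potential_small[OF small that U(1)] \<kappa> by (simp add: \<xi>_def \<rho>_def)
  have W: "0 < W" using D_pos[OF k] \<rho> by (simp add: W_def)
  have dens: "0 < density U" using \<rho> by (simp add: \<rho>_def)
  have ec: "v \<in> U \<Longrightarrow> deg k U v \<le> (1 + \<xi>) * W" "v \<in> U \<Longrightarrow> (1 - \<xi>) * W \<le> deg k U v"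
      "(1 - \<xi>) * W \<le> \<eta> * A" "\<eta> * A \<le> (1 + \<xi>) * W" for v
    unfolding W_def A_def \<eta>_def \<rho>_def
    by (rule edges_count[OF k U(1) dens]; use good[OF k] in blast)+
  have A: "0 < A"
  proof -
    have "0 < (1 - \<xi>) * W" using W \<xi> by auto
    then have "0 < \<eta> * A" using ec(3) by linarith
    then show ?thesis using \<eta>0 by (simp add: zero_less_mult_iff)
  qed
  have \<xi>': "\<xi> * (1 + 2200 * \<eta>) \<le> \<xi>'"
  proof -
    have p: "0 < (1 - \<eta>) ^ 2200" using \<eta>0 by simp
    have "1 + real 2200 * \<eta> \<le> (1 + \<eta>) ^ 2200" using \<eta>0 by (intro Bernoulli_inequality) auto
    then have "(1 + real 2200 * \<eta>) * (1 - \<eta>) ^ 2200 \<le> (1 + \<eta>) ^ 2200 * (1 - \<eta>) ^ 2200"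
      using p by (intro mult_right_mono) auto
    also have "\<dots> = ((1 + \<eta>) * (1 - \<eta>)) ^ 2200" by (simp only: power_mult_distrib)
    also have "\<dots> \<le> 1" using \<eta>0 by (intro power_le_one) (auto simp: algebra_simps intro: mult_le_one)
    finally have "1 + 2200 * \<eta> \<le> 1 / (1 - \<eta>) ^ 2200" using p by (simp only: pos_le_divide_eq) simp
    then have "\<xi> * (1 + 2200 * \<eta>) \<le> \<xi> * (1 / (1 - \<eta>) ^ 2200)" using \<xi> by (intro mult_left_mono) auto
    also have "\<dots> = \<xi>'" by (simp only: \<xi>_def \<xi>'_def power_mult_distrib) simp
    finally show ?thesis .
  qed
  have dens_Diff: "density (U - e) = \<rho> * (1 - \<eta>)" if "e \<in> edges k U" for e
  proof -
    have "card (U - e) = card U - k" using edges_D[OF k that] fU by (simp add: card_Diff_subset)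
    then have c: "real (card (U - e)) = card U - real k" using U by simp
    show ?thesis unfolding density_def \<rho>_def \<eta>_def c using cU
      by (simp add: right_diff_distrib diff_divide_distrib)
  qed
  have main: "(\<Sum>e | e \<in> edges k U \<and> v \<notin> e. exp (\<kappa> * (reldeg l (U - e) v - 1 - \<xi>'))) \<le> A * exp (\<kappa> * (reldeg l U v - 1 - \<xi>)) \<and>
      (\<Sum>e | e \<in> edges k U \<and> v \<notin> e. exp (\<kappa> * (1 - \<xi>' - reldeg l (U - e) v))) \<le> A * exp (\<kappa> * (1 - \<xi> - reldeg l U v))"
    if l: "l \<in> K" and v: "v \<in> U" for l v
  proof -
    define q where "q = l - 1"
    define S where "S = {e \<in> edges k U. v \<notin> e}"
    define Y where "Y = reldeg l U v"
    define P where "P = D l * \<rho> ^ q"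
    define x where "x = (\<lambda>e. loss l U v e / P)"
    have l16: "1 \<le> l" "l \<le> 6" using K l by auto
    have P: "0 < P" using D_pos[OF l] \<rho> by (simp add: P_def)
    have degY: "deg l U v = Y * P"
    proof -
      have "Y = deg l U v / P" by (simp add: Y_def reldeg_def P_def q_def \<rho>_def)
      then show ?thesis using P by simp
    qed
    have rel: "reldeg l (U - e) v = 1 / (1 - \<eta>) ^ q * Y - 1 / (1 - \<eta>) ^ q * x e" if "e \<in> S" for e
    proof -
      have "reldeg l (U - e) v = (Y * P - loss l U v e) / (P * (1 - \<eta>) ^ q)"
        using that dens_Diff[of e] deg_Diff[OF l, of v e U] degY
        by (simp add: S_def reldeg_def P_def q_def power_mult_distrib ac_simps)
      also have "\<dots> = 1 / (1 - \<eta>) ^ q * Y - 1 / (1 - \<eta>) ^ q * x e"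
        using P \<eta>0 by (simp add: x_def field_simps)
      finally show ?thesis .
    qed
    have fS: "finite S" using finite_edges[OF k] by (simp add: S_def)
    have cS: "A - card S = deg k U v"
    proof -
      define S' where "S' = {e \<in> edges k U. v \<in> e}"
      have "edges k U = S \<union> S'" "S \<inter> S' = {}" "finite S'"
        using finite_edges[OF k, of U] by (auto simp: S_def S'_def)
      then have "card (edges k U) = card S + card S'" using fS by (simp add: card_Un_disjoint)
      then show ?thesis by (simp add: A_def deg_def S'_def)
    qed
    have S1: "card S \<le> A" using cS by (simp add: deg_def)
    have S2: "A - card S \<le> 3 * \<eta> * A"
    proof -
      have "A - card S \<le> (1 + \<xi>) * W" unfolding cS by (rule ec(1)[OF v])
      also have "\<dots> \<le> 3 * ((1 - \<xi>) * W)" using W \<xi> by (simp add: algebra_simps)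
      also have "\<dots> \<le> 3 * (\<eta> * A)" using ec(3) by simp
      finally show ?thesis by simp
    qed
    have x0: "0 \<le> x e" for e using P by (simp add: x_def loss_def)
    have x1: "x e \<le> 6 * \<zeta>" if "e \<in> S" for e
    proof -
      have "x e \<le> 6 * (\<theta> * D l) / P" unfolding x_def using that P loss_le[OF l k U(1) v]
        by (intro divide_right_mono) (auto simp: S_def)
      also have "\<dots> = 6 * (\<theta> / \<rho> ^ q)" using D_pos[OF l] by (simp add: P_def)
      also have "\<dots> \<le> 6 * (\<theta> / \<rho> ^ 5)" using \<rho> \<theta>_pos l16 
        by (intro mult_left_mono divide_left_mono power_decreasing) (auto simp: q_def)
      finally show ?thesis by (simp add: \<zeta>_def)
    qed
    define F where "F = {f \<in> edges l U. v \<in> f}"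
    have cF: "real (card F) = Y * P" using degY by (simp add: F_def deg_def)
    have fcard: "card (f - {v}) = q" "f - {v} \<subseteq> U" if "f \<in> F" for f
      using that edges_D[OF l, of f U] by (auto simp: F_def q_def)
    have xs: "(\<Sum>e\<in>S. x e) = (\<Sum>f\<in>F. real (card {e \<in> edges k U. v \<notin> e \<and> f \<inter> e \<noteq> {}})) / P"
      unfolding x_def sum_divide_distrib[symmetric] S_def F_def by (simp add: sum_loss[OF k l])
    have up: "(\<Sum>e\<in>S. x e) \<le> A * (Y * q * \<eta> * (1 + 4 * \<xi>))"
    proof -
      have "(\<Sum>f\<in>F. real (card {e \<in> edges k U. v \<notin> e \<and> f \<inter> e \<noteq> {}})) \<le> (\<Sum>f\<in>F. q * ((1 + \<xi>) * W))"
      proof (rule sum_mono)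
        fix f assume f: "f \<in> F"
        have "real (card {e \<in> edges k U. v \<notin> e \<and> f \<inter> e \<noteq> {}}) \<le> (\<Sum>u\<in>f - {v}. deg k U u)"
          using meeting_bounds(1)[OF k l U(1), of f v] f by (simp add: F_def)
        also have "\<dots> \<le> (\<Sum>u\<in>f - {v}. (1 + \<xi>) * W)" using fcard[OF f] by (intro sum_mono ec(1)) auto
        finally show "real (card {e \<in> edges k U. v \<notin> e \<and> f \<inter> e \<noteq> {}}) \<le> q * ((1 + \<xi>) * W)" 
          using fcard[OF f] by simp
      qed
      also have "\<dots> = P * (Y * q * ((1 + \<xi>) * W))" by (simp add: cF)
      finally have "(\<Sum>e\<in>S. x e) \<le> Y * q * ((1 + \<xi>) * W)" unfolding xs using P by (simp add: pos_divide_le_eq ac_simps)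
      also have "\<dots> \<le> Y * q * ((1 + 4 * \<xi>) * (\<eta> * A))"
      proof (rule mult_left_mono)
        have "\<xi> * \<xi> \<le> \<xi> * (1/2)" using \<xi> by (intro mult_left_mono) auto
        then have "1 + \<xi> \<le> (1 + 4 * \<xi>) * (1 - \<xi>)" by (simp add: algebra_simps)
        then have "(1 + \<xi>) * W \<le> (1 + 4 * \<xi>) * (1 - \<xi>) * W" using W by (intro mult_right_mono) auto
        also have "\<dots> \<le> (1 + 4 * \<xi>) * (\<eta> * A)" unfolding mult.assoc using ec(3) \<xi> by (intro mult_left_mono) auto
        finally show "(1 + \<xi>) * W \<le> (1 + 4 * \<xi>) * (\<eta> * A)" .
        show "0 \<le> Y * q" using cF P by (metis mult_nonneg_nonneg of_nat_0_le_iff zero_le_mult_iff not_less)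
      qed
      finally show ?thesis by (simp add: ac_simps)
    qed
    have Y: "0 \<le> Y" "Y \<le> 2" using good[OF l v] \<xi> by (auto simp: Y_def)
    have lo: "A * (Y * \<eta> * (q - 2 * (real q * \<xi>) - 36 * \<zeta>)) \<le> (\<Sum>e\<in>S. x e)"
    proof (cases "0 \<le> q - 2 * (real q * \<xi>) - 36 * \<zeta>")
      case False
      have "0 \<le> A * (Y * \<eta>)" using A Y \<eta>0 by auto
      then have "A * (Y * \<eta>) * (q - 2 * (real q * \<xi>) - 36 * \<zeta>) \<le> 0" using False 
        by (intro mult_nonneg_nonpos) auto
      then show ?thesis using sum_nonneg[of S x] x0 by (simp add: ac_simps)
    next
      case True
      have "(\<Sum>f\<in>F. real (card {e \<in> edges k U. v \<notin> e \<and> f \<inter> e \<noteq> {}})) \<ge> (\<Sum>f\<in>F. q * ((1 - \<xi>) * W) - 36 * (\<theta> * D k))"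
      proof (rule sum_mono)
        fix f assume f: "f \<in> F"
        have "q * ((1 - \<xi>) * W) = (\<Sum>u\<in>f - {v}. (1 - \<xi>) * W)" using fcard[OF f] by simp
        also have "\<dots> \<le> (\<Sum>u\<in>f - {v}. deg k U u)" using fcard[OF f] by (intro sum_mono ec(2)) auto
        finally show "q * ((1 - \<xi>) * W) - 36 * (\<theta> * D k) \<le> real (card {e \<in> edges k U. v \<notin> e \<and> f \<inter> e \<noteq> {}})"
          using meeting_bounds(2)[OF k l U(1), of f v] f by (simp add: F_def)
      qed
      moreover have "(\<Sum>f\<in>F. q * ((1 - \<xi>) * W) - 36 * (\<theta> * D k)) = P * (Y * (q * ((1 - \<xi>) * W) - 36 * (\<theta> * D k)))" 
        by (simp add: cF)
      ultimately have "P * (Y * (q * ((1 - \<xi>) * W) - 36 * (\<theta> * D k))) \<le>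
          (\<Sum>f\<in>F. real (card {e \<in> edges k U. v \<notin> e \<and> f \<inter> e \<noteq> {}}))" by (simp only:)
      then have "Y * (q * ((1 - \<xi>) * W) - 36 * (\<theta> * D k)) \<le> (\<Sum>e\<in>S. x e)" unfolding xs 
        using P by (simp only: pos_le_divide_eq mult.commute[of P])
      moreover have "Y * (\<eta> * A * (q - 2 * (real q * \<xi>) - 36 * \<zeta>)) \<le> Y * (q * ((1 - \<xi>) * W) - 36 * (\<theta> * D k))"
      proof (rule mult_left_mono[OF _ Y(1)])
        have "\<eta> * A * (q - 2 * (real q * \<xi>) - 36 * \<zeta>) \<le> (1 + \<xi>) * W * (q - 2 * (real q * \<xi>) - 36 * \<zeta>)"
          using ec(4) True by (intro mult_right_mono) auto
        also have "\<dots> = W * (q * (1 - \<xi>) - 36 * \<zeta>) - W * (2 * q * \<xi>\<^sup>2 + 36 * \<xi> * \<zeta>)"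
          by (simp add: algebra_simps power2_eq_square)
        also have "\<dots> \<le> W * (q * (1 - \<xi>) - 36 * \<zeta>)" using W \<xi> \<zeta> by simp
        also have "\<dots> = q * ((1 - \<xi>) * W) - 36 * (W * \<zeta>)" by (simp add: algebra_simps)
        also have "\<dots> \<le> q * ((1 - \<xi>) * W) - 36 * (\<theta> * D k)"
        proof -
          have "\<rho> ^ 5 \<le> \<rho> ^ (k - 1)" using \<rho> k16 by (intro power_decreasing) auto
          then have "\<theta> * D k * 1 \<le> \<theta> * D k * (\<rho> ^ (k - 1) / \<rho> ^ 5)" using \<theta>_pos D_pos[OF k] \<rho>
            by (intro mult_left_mono) (auto simp: le_divide_eq)
          then have "\<theta> * D k \<le> W * \<zeta>" by (simp add: W_def \<zeta>_def ac_simps)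
          then show ?thesis by simp
        qed
        finally show "\<eta> * A * (q - 2 * (real q * \<xi>) - 36 * \<zeta>) \<le> q * ((1 - \<xi>) * W) - 36 * (\<theta> * D k)" .
      qed
      ultimately show ?thesis by (simp add: ac_simps)
    qed
    have q5: "q \<le> 5" using l16 by (simp add: q_def)
    have par: "0 \<le> \<eta>" "\<zeta> \<le> \<xi>" using \<eta>0 \<zeta>\<xi> by auto
    note es = exponential_step[OF fS S1 S2 A x0 x1 up lo q5 Y par(1) \<eta>\<zeta> par(2) \<xi>(1) \<kappa>(1) \<kappa>\<zeta> \<xi>']
    have "(\<Sum>e\<in>S. exp (\<kappa> * (reldeg l (U - e) v - 1 - \<xi>'))) = (\<Sum>e\<in>S. exp (\<kappa> * (1 / (1 - \<eta>) ^ q * Y - 1 / (1 - \<eta>) ^ q * x e - 1 - \<xi>')))"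
      "(\<Sum>e\<in>S. exp (\<kappa> * (1 - \<xi>' - reldeg l (U - e) v))) = (\<Sum>e\<in>S. exp (\<kappa> * (1 - \<xi>' - (1 / (1 - \<eta>) ^ q * Y - 1 / (1 - \<eta>) ^ q * x e))))"
      by (intro sum.cong refl, simp add: rel)+
    then show ?thesis using es by (simp add: S_def Y_def)
  qed
  define E where "E = (\<lambda>e l v. exp (\<kappa> * (reldeg l (U - e) v - 1 - \<xi>')) + exp (\<kappa> * (1 - \<xi>' - reldeg l (U - e) v)))"
  have fe: "finite (edges k U)" by (rule finite_edges[OF k])
  have d1: "(\<Sum>v\<in>U - e. E e l v) = (\<Sum>v\<in>U. if v \<notin> e then E e l v else 0)" for e l
    unfolding set_diff_eq using sum.inter_filter[OF fU, of "\<lambda>v. E e l v" "\<lambda>v. v \<notin> e"] by simp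
  have d2: "(\<Sum>e\<in>edges k U. if v \<notin> e then E e l v else 0) = (\<Sum>e | e \<in> edges k U \<and> v \<notin> e. E e l v)" for v l
    using sum.inter_filter[OF fe, of "\<lambda>e. E e l v" "\<lambda>e. v \<notin> e"] by simp
  have "(\<Sum>e\<in>edges k U. potential \<kappa> \<xi>0 (U - e)) = (\<Sum>e\<in>edges k U. \<Sum>l\<in>K. \<Sum>v\<in>U - e. E e l v)"
    unfolding potential_def E_def \<xi>'_def by (intro sum.cong refl) (simp add: dens_Diff)
  also have "\<dots> = (\<Sum>e\<in>edges k U. \<Sum>l\<in>K. \<Sum>v\<in>U. if v \<notin> e then E e l v else 0)"
    by (simp only: d1)
  also have "\<dots> = (\<Sum>l\<in>K. \<Sum>e\<in>edges k U. \<Sum>v\<in>U. if v \<notin> e then E e l v else 0)" by (rule sum.swap)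
  also have "\<dots> = (\<Sum>l\<in>K. \<Sum>v\<in>U. \<Sum>e\<in>edges k U. if v \<notin> e then E e l v else 0)"
    by (intro sum.cong refl sum.swap)
  also have "\<dots> = (\<Sum>l\<in>K. \<Sum>v\<in>U. \<Sum>e | e \<in> edges k U \<and> v \<notin> e. E e l v)"
    by (simp only: d2)
  also have "\<dots> \<le> (\<Sum>l\<in>K. \<Sum>v\<in>U. A * (exp (\<kappa> * (reldeg l U v - 1 - \<xi>)) + exp (\<kappa> * (1 - \<xi> - reldeg l U v))))"
    unfolding E_def sum.distrib distrib_left using main by (intro sum_mono add_mono) auto
  also have "\<dots> = A * potential \<kappa> \<xi>0 U"
    by (simp add: potential_def \<xi>_def \<rho>_def sum_distrib_left)
  finally show ?thesis by (simp add: A_def)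
qed

text \<open>The possible histories of the process when the sizes of the successive edges are prescribed.\<close>
fun runs :: "nat list \<Rightarrow> 'v set \<Rightarrow> 'v set list set" where
  "runs [] U = {[]}"
| "runs (k # ks) U = (\<Union>e\<in>edges k U. (#) e ` runs ks (U - e))"

lemma finite_runs: "set ks \<subseteq> K \<Longrightarrow> finite (runs ks U)"
  by (induction ks arbitrary: U) (auto simp: finite_edges)

lemma card_runs_Cons:
  assumes "k \<in> K" "set ks \<subseteq> K"
  shows "real (card (runs (k # ks) U)) = (\<Sum>e\<in>edges k U. real (card (runs ks (U - e))))"
proof -
  have "card (runs (k # ks) U) = (\<Sum>e\<in>edges k U. card ((#) e ` runs ks (U - e)))"
    unfolding runs.simps using assms by (intro card_UN_disjoint) (auto simp: finite_edges finite_runs)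
  also have "\<dots> = (\<Sum>e\<in>edges k U. card (runs ks (U - e)))"
    by (intro sum.cong refl card_image) auto
  finally show ?thesis by simp
qed

lemma (in -) power_ge_falling_factorial:
  assumes "k \<le> m" "0 < n"
  shows "real (fact m) / (fact (m - k) * n ^ k) \<le> (m / n) ^ k"
proof -
  have "fact m \<le> fact (m - k) * m ^ k" using fact_div_fact_le_pow[OF assms(1)] fact_dvd[of "m - k" m, where 'a = nat]
    by (metis diff_le_self dvd_div_mult_self fact_ge_zero mult.commute mult_le_mono1)
  then have "real (fact m) \<le> real (fact (m - k) * m ^ k)" by (rule of_nat_mono)
  then show ?thesis using assms(2) by (simp add: power_divide field_simps)
qed

text \<open>Backward induction on the number of remaining steps. If the potential is at least 1, the bound is
  trivial. Otherwise the number of choices is close to its expected value, and averaging the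
  induction hypothesis over the choices does not decrease the factor \<open>1 - potential\<close>, because of
  \<open>potential_step\<close>. The falling factorial is a lower bound for the product of the powers of the
  densities, and it telescopes.\<close>
theorem card_runs_ge:
  assumes "set ks \<subseteq> K" "U \<subseteq> V" "sum_list ks + m0 \<le> card U"
    and m0: "0 < m0" and \<kappa>: "1 \<le> \<kappa>" "\<kappa> * (\<theta> / (m0 / N) ^ 5) \<le> \<xi>0" and tol: "\<xi>0 / (m0 / N) ^ 2200 \<le> \<epsilon>" "\<epsilon> \<le> 1 / 100"
  shows "(1 - potential \<kappa> \<xi>0 U) * (\<Prod>k\<leftarrow>ks. (1 - \<epsilon>) * (N * D k / k)) *
           (fact (card U) / (fact (card U - sum_list ks) * N ^ sum_list ks)) \<le> card (runs ks U)"
  using assms(1-3)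
proof (induction ks arbitrary: U)
  case Nil
  have "1 - potential \<kappa> \<xi>0 U \<le> 1" using potential_nonneg[of \<kappa> \<xi>0 U] by simp
  then show ?case by simp
next
  case (Cons k ks)
  define m where "m = card U"
  define s where "s = sum_list ks"
  define E where "E = (\<lambda>k. (1 - \<epsilon>) * (N * D k / real k))"
  define L where "L = prod_list (map E ks)"
  have k: "k \<in> K" "1 \<le> k" "set ks \<subseteq> K" using Cons.prems K by auto
  have E0: "0 \<le> E j" if "j \<in> K" for j unfolding E_def using tol(2) N_pos D_pos[OF that] by simp
  have L0: "0 \<le> L" unfolding L_def using k E0 by (intro prod_list_nonneg) auto
  have fU: "finite U" using Cons.prems finite_V finite_subset by blast
  have m: "k + s + m0 \<le> m" using Cons.prems by (simp add: m_def s_def)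
  define f where "f = (\<lambda>U. 1 - potential \<kappa> \<xi>0 U)"
  show ?case
  proof (cases "potential \<kappa> \<xi>0 U < 1")
    case False
    have "f U * (prod_list (map E (k # ks)) * (fact m / (fact (m - (k + s)) * N ^ (k + s)))) \<le> 0"
      using False L0 E0[OF k(1)] N_pos unfolding f_def
      by (intro mult_nonpos_nonneg mult_nonneg_nonneg divide_nonneg_nonneg) (auto simp: L_def)
    then show ?thesis unfolding E_def f_def m_def s_def by (simp add: mult.assoc)
  next
    case True
    have dens: "m0 / N \<le> density U" "0 < m0 / N" using m m0 N_pos by (auto simp: density_def m_def divide_right_mono)
    have \<xi>00: "0 \<le> \<xi>0"
    proof -
      have "0 \<le> \<kappa> * (\<theta> / (m0 / N) ^ 5)" using \<kappa>(1) \<theta>_pos dens by (intro mult_nonneg_nonneg divide_nonneg_nonneg) auto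
      then show ?thesis using \<kappa> by linarith
    qed
    have c1: "\<kappa> * (\<theta> / density U ^ 5) \<le> \<xi>0"
    proof -
      have "\<kappa> * (\<theta> / density U ^ 5) \<le> \<kappa> * (\<theta> / (m0 / N) ^ 5)"
        using \<kappa>(1) \<theta>_pos dens by (intro mult_left_mono divide_left_mono power_mono mult_pos_pos zero_less_power) auto
      then show ?thesis using \<kappa> by linarith
    qed
    have c2: "\<xi>0 / density U ^ 2200 \<le> \<epsilon>"
    proof -
      have "\<xi>0 / density U ^ 2200 \<le> \<xi>0 / (m0 / N) ^ 2200"
        using \<xi>00 dens by (intro divide_left_mono power_mono mult_pos_pos zero_less_power) auto
      then show ?thesis using tol by linarith
    qed
    have kU: "k < card U" using m m0 by (simp add: m_def)
    have step: "(\<Sum>e\<in>edges k U. potential \<kappa> \<xi>0 (U - e)) \<le> card (edges k U) * potential \<kappa> \<xi>0 U"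
      by (rule potential_step[OF k(1) Cons.prems(2) kU \<kappa>(1) c1 order_trans[OF c2 tol(2)] True])
    have cnt: "E k * (fact m / (fact (m - k) * N ^ k)) \<le> card (edges k U)"
    proof -
      have "(1 - \<epsilon>) * (D k * density U ^ (k - 1)) \<le> k / card U * card (edges k U)"
      proof (rule edges_count(3)[OF k(1) Cons.prems(2)])
        show "\<bar>reldeg k U v - 1\<bar> \<le> \<epsilon>" if "v \<in> U" for v
          using reldeg_bounds_if_potential_small[OF True k(1) that Cons.prems(2)] \<kappa>(1) c2 by linarith
      qed (use dens in linarith)
      then have "(card U / k) * ((1 - \<epsilon>) * (D k * density U ^ (k - 1))) \<le> (card U / k) * (k / card U * card (edges k U))"
        by (intro mult_left_mono) auto
      also have "\<dots> = card (edges k U)" using kU k(2) by simp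
      also have "(card U / k) * ((1 - \<epsilon>) * (D k * density U ^ (k - 1))) = E k * (m / N) ^ k"
        using power_Suc[of "m / N" "k - 1"] k(2) N_pos by (simp add: E_def density_def m_def)
      finally have "E k * (m / N) ^ k \<le> card (edges k U)" .
      moreover have "fact m / (fact (m - k) * N ^ k) \<le> (m / N) ^ k"
        using power_ge_falling_factorial[of k m "card V"] kU N_pos by (simp add: m_def)
      ultimately show ?thesis using mult_left_mono[OF _ E0[OF k(1)]] by fastforce
    qed
    define R where "R = fact (m - k) / (fact (m - k - s) * N ^ s)"
    have R0: "0 \<le> R" unfolding R_def by simp
    have "f U * (E k * (fact m / (fact (m - k) * N ^ k))) * (L * R) \<le> f U * card (edges k U) * (L * R)"
      using cnt True L0 R0 by (intro mult_right_mono mult_left_mono) (auto simp: f_def)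
    also have "\<dots> \<le> (\<Sum>e\<in>edges k U. f (U - e)) * (L * R)"
      using step L0 R0 by (intro mult_right_mono) (auto simp: f_def sum_subtractf algebra_simps)
    also have "\<dots> = (\<Sum>e\<in>edges k U. f (U - e) * L * R)" by (simp add: sum_distrib_right mult.assoc)
    also have "\<dots> \<le> (\<Sum>e\<in>edges k U. real (card (runs ks (U - e))))"
    proof (rule sum_mono)
      fix e assume e: "e \<in> edges k U"
      have ce: "card (U - e) = m - k" using edges_D[OF k(1) e] fU by (simp add: card_Diff_subset m_def)
      have "(1 - potential \<kappa> \<xi>0 (U - e)) * (\<Prod>k\<leftarrow>ks. (1 - \<epsilon>) * (N * D k / k)) *
           (fact (card (U - e)) / (fact (card (U - e) - sum_list ks) * N ^ sum_list ks)) \<le> card (runs ks (U - e))"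
        using Cons.prems m ce by (intro Cons.IH) (auto simp: s_def)
      then show "f (U - e) * L * R \<le> card (runs ks (U - e))"
        by (simp add: f_def L_def R_def E_def ce s_def)
    qed
    also have "\<dots> = card (runs (k # ks) U)" using k by (simp add: card_runs_Cons del: runs.simps)
    also have "f U * (E k * (fact m / (fact (m - k) * N ^ k))) * (L * R) =
        f U * (E k * L) * (fact m / (fact (m - (k + s)) * N ^ (k + s)))"
      using N_pos by (simp add: R_def power_add ac_simps)
    finally show ?thesis by (simp add: f_def L_def E_def m_def s_def del: runs.simps)
  qed
qed

end

lemma power_le_exp_fact: "real n ^ n \<le> exp (real n) * fact n"
proof -
  have "real n ^ n / fact n = (\<Sum>k\<in>{n}. real n ^ k /\<^sub>R fact k)" by (simp add: divide_inverse mult.commute)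
  also have "\<dots> \<le> (\<Sum>k. real n ^ k /\<^sub>R fact k)"
    by (intro sum_le_suminf) (use summable_exp_generic[of "real n"] in auto)
  also have "\<dots> = exp (real n)" by (simp add: exp_def)
  finally show ?thesis by (simp add: field_simps)
qed

text \<open>The upper half of Stirling's formula, up to a factor that is linear in \<open>n\<close>. (The lower half is a single
  term of the exponential series.)\<close>
lemma fact_le_exp: "fact (Suc n) \<le> exp 1 * real (Suc n) * (real (Suc n) / exp 1) ^ Suc n"
proof (induction n)
  case (Suc n)
  define m where "m = real (Suc n)"
  have m: "1 \<le> m" by (simp add: m_def)
  have "exp 1 * (m ^ Suc n) \<le> (m + 1) ^ Suc n * (m + 1) / m"
  proof -
    have "ln m + 1 / (m + 1) \<le> ln (m + 1)"
    proof -
      have "ln (m / (m + 1)) \<le> m / (m + 1) - 1" using m by (intro ln_le_minus_one) auto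
      also have "\<dots> = - (1 / (m + 1))" using m by (simp add: field_simps)
      finally show ?thesis using m by (simp add: ln_div)
    qed
    then have "(m + 1) * (ln m + 1 / (m + 1)) \<le> (m + 1) * ln (m + 1)" using m by (intro mult_left_mono) auto
    moreover have "(m + 1) * (ln m + 1 / (m + 1)) = m * ln m + ln m + 1" using m
      by (simp add: distrib_left distrib_right)
    moreover have "real (Suc n) = m" "real (Suc (Suc n)) = m + 1" by (simp_all add: m_def)
    ultimately have "1 + real (Suc n) * ln m \<le> real (Suc (Suc n)) * ln (m + 1) - ln m" by (simp only:)
    then have "exp (1 + real (Suc n) * ln m) \<le> exp (real (Suc (Suc n)) * ln (m + 1) - ln m)" by simp
    then show ?thesis using m by (simp add: exp_add exp_diff exp_of_nat_mult del: of_nat_Suc power_Suc) (simp add: mult_ac)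
  qed
  then have "exp 1 * m * (m ^ Suc n) \<le> (m + 1) ^ Suc n * (m + 1)" using m by (simp add: field_simps)
  then have key: "exp 1 * m * (m / exp 1) ^ Suc n \<le> (m + 1) * ((m + 1) / exp 1) ^ Suc n"
    by (simp add: power_divide field_simps)
  have "fact (Suc (Suc n)) = (m + 1) * fact (Suc n)" by (simp add: m_def)
  also have "\<dots> \<le> (m + 1) * (exp 1 * m * (m / exp 1) ^ Suc n)" using Suc.IH m by (intro mult_left_mono) (auto simp: m_def)
  also have "\<dots> \<le> (m + 1) * ((m + 1) * ((m + 1) / exp 1) ^ Suc n)" using key m by (intro mult_left_mono) auto
  also have "\<dots> = exp 1 * (m + 1) * ((m + 1) / exp 1) ^ Suc (Suc n)" by simp
  finally show ?case by (simp add: m_def algebra_simps)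
qed simp

lemma ln_fact_le:
  assumes "1 \<le> n" shows "ln (fact n) \<le> n * ln n - n + ln n + 1"
proof -
  have "fact n \<le> exp 1 * real n * (real n / exp 1) ^ n" using fact_le_exp[of "n - 1"] assms by simp
  then have "ln (fact n) \<le> ln (exp 1 * real n * (real n / exp 1) ^ n)" using assms by (subst ln_le_cancel_iff) auto
  also have "\<dots> = n * ln n - n + ln n + 1" using assms by (simp add: ln_mult ln_realpow ln_div algebra_simps)
  finally show ?thesis .
qed

context regular_hypergraphs
begin

text \<open>At the start all relative degrees are exactly 1. The densities contribute at least $N!/N^N \ge e^{-N}$,
  whatever the prescribed sizes.\<close>
corollary card_runs_full_ge:
  fixes \<kappa> \<xi>0 \<epsilon> :: real and m0 :: nat
  assumes "set ks \<subseteq> K" "sum_list ks + m0 \<le> card V"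
    and m0: "0 < m0" and \<kappa>: "1 \<le> \<kappa>" "\<kappa> * (\<theta> / (m0 / N) ^ 5) \<le> \<xi>0" and tol: "\<xi>0 / (m0 / N) ^ 2200 \<le> \<epsilon>" "\<epsilon> \<le> 1 / 100"
    and init: "card K * N * exp (- \<kappa> * \<xi>0) \<le> 1 / 4"
  shows "(\<Prod>k\<leftarrow>ks. (1 - \<epsilon>) * (N * D k / k)) * (exp (- N) / 2) \<le> card (runs ks V)"
proof -
  have dV: "density V = 1" using N_pos by (simp add: density_def)
  have "potential \<kappa> \<xi>0 V = (\<Sum>l\<in>K. \<Sum>v\<in>V. exp (\<kappa> * - \<xi>0) + exp (\<kappa> * - \<xi>0))"
    unfolding potential_def
  proof (intro sum.cong refl)
    fix l v assume "l \<in> K" "v \<in> V"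
    moreover have "edges l V = H l" if "l \<in> K" using edge[OF that] by (auto simp: edges_def)
    ultimately have "reldeg l V v = 1" using D_pos[of l] degree[of l v] by (simp add: reldeg_def dV deg_def)
    then show "exp (\<kappa> * (reldeg l V v - 1 - \<xi>0 / density V ^ 2200)) +
       exp (\<kappa> * (1 - \<xi>0 / density V ^ 2200 - reldeg l V v)) = exp (\<kappa> * - \<xi>0) + exp (\<kappa> * - \<xi>0)" by (simp add: dV)
  qed
  also have "\<dots> = 2 * (card K * N * exp (- \<kappa> * \<xi>0))" by simp
  also have "\<dots> \<le> 1 / 2" using init by simp
  finally have pot: "1 / 2 \<le> 1 - potential \<kappa> \<xi>0 V" by simp
  define n where "n = card V"
  define s where "s = sum_list ks"
  define P where "P = (\<Prod>k\<leftarrow>ks. (1 - \<epsilon>) * (N * D k / k))"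
  have P0: "0 \<le> P" unfolding P_def
  proof (rule prod_list_nonneg)
    fix x assume "x \<in> set (map (\<lambda>k. (1 - \<epsilon>) * (N * D k / k)) ks)"
    then obtain k where "k \<in> K" "x = (1 - \<epsilon>) * (N * D k / k)" using assms(1) by auto
    then show "0 \<le> x" using tol(2) N_pos D_pos[of k] by simp
  qed
  have s: "s \<le> n" using assms(2) by (simp add: s_def n_def)
  have fac: "exp (- N) \<le> fact n / (fact (n - s) * N ^ s)"
  proof -
    have "fact (n - s) * n ^ s \<le> n ^ n"
    proof -
      have "(fact (n - s) :: nat) \<le> (n - s) ^ (n - s)" using fact_le_power[of "n - s", where 'a = nat] by simp
      also have "\<dots> \<le> n ^ (n - s)" by (intro power_mono) auto
      finally have "fact (n - s) * n ^ s \<le> n ^ (n - s) * n ^ s" by (intro mult_right_mono) auto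
      then show ?thesis using s by (simp flip: power_add)
    qed
    then have "real (fact (n - s) * n ^ s) \<le> real (n ^ n)" by (rule of_nat_mono)
    also have "\<dots> \<le> exp (real n) * fact n" using power_le_exp_fact[of n] by simp
    finally have "fact (n - s) * N ^ s \<le> exp N * fact n" by (simp add: n_def)
    then show ?thesis using N_pos by (simp add: exp_minus field_simps)
  qed
  have "P * (exp (- N) / 2) = 1 / 2 * P * exp (- N)" by simp
  also have "\<dots> \<le> (1 - potential \<kappa> \<xi>0 V) * P * (fact n / (fact (n - s) * N ^ s))"
    using pot P0 fac by (intro mult_mono mult_nonneg_nonneg) auto
  also have "\<dots> \<le> card (runs ks V)"
    unfolding P_def n_def s_def using assms by (intro card_runs_ge) auto
  finally show ?thesis by (simp add: P_def)
qed

end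

section \<open>Greedy packings by triples and quadruples\<close>

definition pairs :: "nat set \<Rightarrow> nat set set" where
  "pairs b = {p. p \<subseteq> b \<and> card p = 2}"

lemma pairs_finite: "finite b \<Longrightarrow> finite (pairs b)"
  by (rule finite_subset[of _ "Pow b"]) (auto simp: pairs_def)

lemma card_pairs: "finite b \<Longrightarrow> card (pairs b) = card b choose 2"
  unfolding pairs_def by (rule n_subsets)

lemma real_choose_2: "real (n choose 2) = real n * (real n - 1) / 2"
  by (cases n) (simp_all add: choose_two real_of_nat_div algebra_simps)

lemma Union_pairs: assumes "2 \<le> card b" shows "\<Union>(pairs b) = b"
proof
  show "b \<subseteq> \<Union>(pairs b)"
  proof
    fix x assume x: "x \<in> b"
    have "b \<noteq> {x}" using assms by auto
    then obtain y where "y \<in> b" "y \<noteq> x" using x by blast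
    then have "{x, y} \<in> pairs b" using x by (auto simp: pairs_def)
    then show "x \<in> \<Union>(pairs b)" by blast
  qed
qed (auto simp: pairs_def)

lemma card_supersets:
  assumes A: "finite A" and W: "W \<subseteq> A" "card W \<le> k"
  shows "card {b. W \<subseteq> b \<and> b \<subseteq> A \<and> card b = k} = (card A - card W) choose (k - card W)"
proof -
  have fW: "finite W" using A W finite_subset by blast
  have "bij_betw (\<lambda>b. b - W) {b. W \<subseteq> b \<and> b \<subseteq> A \<and> card b = k} {c. c \<subseteq> A - W \<and> card c = k - card W}"
  proof (rule bij_betw_byWitness[where f' = "\<lambda>c. c \<union> W"])
    show "(\<lambda>b. b - W) ` {b. W \<subseteq> b \<and> b \<subseteq> A \<and> card b = k} \<subseteq> {c. c \<subseteq> A - W \<and> card c = k - card W}"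
      using fW by (auto simp: card_Diff_subset)
    show "(\<lambda>c. c \<union> W) ` {c. c \<subseteq> A - W \<and> card c = k - card W} \<subseteq> {b. W \<subseteq> b \<and> b \<subseteq> A \<and> card b = k}"
    proof clarify
      fix c assume c: "c \<subseteq> A - W" "card c = k - card W"
      then have "finite c" "c \<inter> W = {}" using A finite_subset by blast+
      then have "card (c \<union> W) = k" using c W fW by (simp add: card_Un_disjoint)
      then show "W \<subseteq> c \<union> W \<and> c \<union> W \<subseteq> A \<and> card (c \<union> W) = k" using c W by blast
    qed
  qed auto
  then have "card {b. W \<subseteq> b \<and> b \<subseteq> A \<and> card b = k} = card {c. c \<subseteq> A - W \<and> card c = k - card W}"
    by (rule bij_betw_same_card)
  also have "\<dots> = card (A - W) choose (k - card W)" using A by (intro n_subsets) auto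
  finally show ?thesis using A W fW by (simp add: card_Diff_subset)
qed

text \<open>The number of points of a block that contains \<open>k\<close> pairs, for \<open>k\<close> equal to 3 or 6.\<close>
definition bsize :: "nat \<Rightarrow> nat" where "bsize k = (if k = 3 then 3 else 4)"

definition block_graph :: "nat \<Rightarrow> nat \<Rightarrow> nat set set set" where
  "block_graph n k = pairs ` {b. b \<subseteq> {..<n} \<and> card b = bsize k}"

definition block_degree :: "nat \<Rightarrow> nat \<Rightarrow> real" where
  "block_degree n k = (if k = 3 then real n - 2 else (real n - 2) * (real n - 3) / 2)"

lemma card_block_graph:
  assumes "finite W" and P: "\<And>b. 2 \<le> card b \<Longrightarrow> P (pairs b) \<longleftrightarrow> W \<subseteq> b"
  shows "card {e \<in> block_graph n k. P e} = card {b. W \<subseteq> b \<and> b \<subseteq> {..<n} \<and> card b = bsize k}"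
proof -
  have "{e \<in> block_graph n k. P e} = pairs ` {b. W \<subseteq> b \<and> b \<subseteq> {..<n} \<and> card b = bsize k}"
    using P by (auto simp: block_graph_def bsize_def)
  moreover have "inj_on pairs {b. W \<subseteq> b \<and> b \<subseteq> {..<n} \<and> card b = bsize k}"
    by (rule inj_on_inverseI[where g = Union]) (auto simp: Union_pairs bsize_def)
  ultimately show ?thesis by (simp add: card_image)
qed

lemma regular_hypergraphs_pairs:
  assumes n: "5 \<le> n"
  shows "regular_hypergraphs (pairs {..<n}) {3, 6} (block_graph n) (block_degree n) (12 / n)"
proof
  show "finite (pairs {..<n})" by (simp add: pairs_finite)
  have "{0, 1} \<in> pairs {..<n}" using n by (auto simp: pairs_def)
  then show "pairs {..<n} \<noteq> {}" by blast
  show "{3, 6} \<subseteq> {1..6::nat}" by simp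
  show "e \<subseteq> pairs {..<n} \<and> card e = k" if k: "k \<in> {3, 6}" and e: "e \<in> block_graph n k" for k e
  proof -
    obtain b where b: "b \<subseteq> {..<n}" "card b = bsize k" "e = pairs b" using e by (auto simp: block_graph_def)
    have "finite b" using b(1) finite_subset by blast
    then have "card e = k" using b k by (auto simp: card_pairs bsize_def choose_two)
    then show ?thesis using b by (auto simp: pairs_def)
  qed
  show "0 < block_degree n k" for k using n by (auto simp: block_degree_def)
  show "real (card {e \<in> block_graph n k. v \<in> e}) = block_degree n k" if "k \<in> {3, 6}" "v \<in> pairs {..<n}" for k v
  proof -
    have v: "v \<subseteq> {..<n}" "card v = 2" using that by (auto simp: pairs_def)
    have "card {e \<in> block_graph n k. v \<in> e} = card {b. v \<subseteq> b \<and> b \<subseteq> {..<n} \<and> card b = bsize k}"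
      using v finite_subset by (intro card_block_graph) (auto simp: pairs_def)
    also have "\<dots> = (n - 2) choose (bsize k - 2)" using v by (subst card_supersets) (auto simp: bsize_def)
    also have "real \<dots> = block_degree n k"
      using n by (simp add: bsize_def block_degree_def real_choose_2 of_nat_diff)
    finally show ?thesis .
  qed
  show "real (card {e \<in> block_graph n k. u \<in> e \<and> v \<in> e}) \<le> 12 / real n * block_degree n k"
    if "k \<in> {3, 6}" "u \<in> pairs {..<n}" "v \<in> pairs {..<n}" "u \<noteq> v" for k u v
  proof -
    define W where "W = u \<union> v"
    have uv: "u \<subseteq> {..<n}" "card u = 2" "v \<subseteq> {..<n}" "card v = 2" using that by (auto simp: pairs_def)
    have fin: "finite u" "finite v" using uv finite_subset by blast+
    have W: "W \<subseteq> {..<n}" "finite W" using uv fin by (auto simp: W_def)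
    have W4: "card W \<le> 4" using card_Un_le[of u v] uv by (simp add: W_def)
    have W3: "3 \<le> card W"
    proof (rule ccontr)
      assume "\<not> 3 \<le> card W"
      then have "card W \<le> 2" by simp
      then have "card W \<le> card u" "card W \<le> card v" using uv by simp_all
      then have "u = W" "v = W" using card_seteq[OF W(2), of u] card_seteq[OF W(2), of v] by (auto simp: W_def)
      then show False using that by simp
    qed
    have "card {e \<in> block_graph n k. u \<in> e \<and> v \<in> e} = card {b. W \<subseteq> b \<and> b \<subseteq> {..<n} \<and> card b = bsize k}"
      using uv W by (intro card_block_graph) (auto simp: pairs_def W_def)
    also have "real \<dots> \<le> (if k = 3 then 1 else real n - 3)"
    proof (cases "card W \<le> bsize k")
      case True
      have c: "card {b. W \<subseteq> b \<and> b \<subseteq> {..<n} \<and> card b = bsize k} = (n - card W) choose (bsize k - card W)"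
        using W True by (subst card_supersets) auto
      have "card W = 3 \<or> card W = 4" using W3 W4 by linarith
      then show ?thesis unfolding c using True n by (auto simp: bsize_def split: if_splits)
    next
      case False
      have "{b. W \<subseteq> b \<and> b \<subseteq> {..<n} \<and> card b = bsize k} = {}"
      proof (rule equals0I)
        fix b assume b: "b \<in> {b. W \<subseteq> b \<and> b \<subseteq> {..<n} \<and> card b = bsize k}"
        then have "card W \<le> card b" by (intro card_mono) (auto intro: finite_subset)
        then show False using b False by simp
      qed
      then show ?thesis using n by (simp only: card.empty) simp
    qed
    also have "\<dots> \<le> 12 / real n * block_degree n k"
    proof -
      have "1 \<le> 12 / real n * (real n - 2)" using n by (simp add: field_simps)
      moreover have h: "1 \<le> 6 / real n * (real n - 2)" using n by (simp add: field_simps)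
      have "(real n - 3) * 1 \<le> (real n - 3) * (6 / real n * (real n - 2))" using n h by (intro mult_left_mono) auto
      moreover have "(real n - 3) * (6 / real n * (real n - 2)) = 12 / real n * ((real n - 2) * (real n - 3) / 2)" by simp
      ultimately show ?thesis by (auto simp only: block_degree_def mult_1_right split: if_splits)
    qed
    finally show ?thesis .
  qed
  have "real (card (pairs {..<n})) = real n * (real n - 1) / 2" by (simp add: card_pairs real_choose_2)
  then have "6 / real (card (pairs {..<n})) = 12 / real n / (real n - 1)" by (simp only:) simp
  also have "\<dots> \<le> 12 / real n / 1" using n by (intro divide_left_mono) auto
  finally show "6 / real (card (pairs {..<n})) \<le> 12 / real n" by simp
qed

context
  fixes n :: nat assumes n: "5 \<le> n"
begin

interpretation regular_hypergraphs "pairs {..<n}" "{3, 6}" "block_graph n" "block_degree n" "12 / n"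
  by (rule regular_hypergraphs_pairs[OF n])

lemma runs_structure:
  assumes "es \<in> runs ks U"
  shows "list_all2 (\<lambda>e k. e \<in> block_graph n k) es ks \<and> sorted_wrt (\<lambda>e f. e \<inter> f = {}) es \<and> (\<forall>e\<in>set es. e \<subseteq> U)"
  using assms
proof (induction ks arbitrary: U es)
  case (Cons k ks)
  then obtain e es' where e: "e \<in> edges k U" "es' \<in> runs ks (U - e)" "es = e # es'" by auto
  have "e \<in> block_graph n k" "e \<subseteq> U" using e(1) by (auto simp: edges_def)
  then show ?case using Cons.IH[OF e(2)] e(3) by auto
qed simp

text \<open>A packing arises from at most \<open>Q!\<close> orders of its quadruples and \<open>T!\<close> orders of its triples.\<close>
lemma card_runs_le_packings:
  "card (runs (replicate Q 6 @ replicate T 3) (pairs {..<n})) \<le> 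
     fact Q * fact T * card {P. packing n P \<and> (\<forall>b\<in>P. card b \<le> 4)}"
proof -
  define R where "R = runs (replicate Q 6 @ replicate T 3) (pairs {..<n})"
  define \<phi> where "\<phi> = (\<lambda>es :: nat set set list. Union ` set es)"
  have fR: "finite R" unfolding R_def by (rule finite_runs) auto
  have R: "take Q es @ drop Q es = es \<and> distinct (take Q es) \<and> distinct (drop Q es) \<and>
      length (take Q es) = Q \<and> length (drop Q es) = T \<and>
      set (take Q es) = {e \<in> set es. card e = 6} \<and> set (drop Q es) = {e \<in> set es. card e = 3} \<and>
      pairs ` \<phi> es = set es \<and> packing n (\<phi> es) \<and> (\<forall>b\<in>\<phi> es. card b \<le> 4)" if es: "es \<in> R" for es
  proof -
    have la: "list_all2 (\<lambda>e k. e \<in> block_graph n k) es (replicate Q 6 @ replicate T 3)"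
      and sw: "sorted_wrt (\<lambda>e f. e \<inter> f = {}) es" using runs_structure es unfolding R_def by blast+
    have len: "length es = Q + T" using list_all2_lengthD[OF la] by simp
    have q: "e \<in> block_graph n 6" if "e \<in> set (take Q es)" for e
    proof -
      obtain i where i: "i < Q" "e = es ! i" using \<open>e \<in> set (take Q es)\<close> len by (auto simp: in_set_conv_nth)
      show ?thesis using list_all2_nthD[OF la, of i] i len by (simp add: nth_append)
    qed
    have t: "e \<in> block_graph n 3" if "e \<in> set (drop Q es)" for e
    proof -
      obtain i where i: "i < T" "e = es ! (Q + i)" using \<open>e \<in> set (drop Q es)\<close> len by (auto simp: in_set_conv_nth)
      show ?thesis using list_all2_nthD[OF la, of "Q + i"] i len by (simp add: nth_append)
    qed
    have un: "set es = set (take Q es) \<union> set (drop Q es)" by (metis append_take_drop_id set_append)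
    have e_cases: "e \<in> block_graph n 6 \<or> e \<in> block_graph n 3" if "e \<in> set es" for e using that un q t by blast
    have c6: "card e = 6" if "e \<in> set (take Q es)" for e using edge[of 6 e] q[OF that] by simp
    have c3: "card e = 3" if "e \<in> set (drop Q es)" for e using edge[of 3 e] t[OF that] by simp
    have ne: "e \<noteq> {}" if "e \<in> set es" for e
    proof -
      have "card e = 6 \<or> card e = 3" using that c6 c3 unfolding un by blast
      then show ?thesis by auto
    qed
    have dist: "distinct es" and disj: "\<And>e f. e \<in> set es \<Longrightarrow> f \<in> set es \<Longrightarrow> e \<noteq> f \<Longrightarrow> e \<inter> f = {}"
      using sw ne by (induction es) auto
    have blk: "\<Union>e \<subseteq> {..<n} \<and> 3 \<le> card (\<Union>e) \<and> card (\<Union>e) \<le> 4 \<and> pairs (\<Union>e) = e" if e: "e \<in> set es" for e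
    proof -
      obtain b where b: "b \<subseteq> {..<n}" "card b \<in> {3, 4}" "e = pairs b"
        using e_cases[OF e] by (auto simp: block_graph_def bsize_def)
      have "2 \<le> card b" using b(2) by auto
      then have "\<Union>e = b" unfolding b(3) by (rule Union_pairs)
      then show ?thesis using b by auto
    qed
    have meet: "card (\<Union>e \<inter> \<Union>f) \<le> 1" if ef: "e \<in> set es" "f \<in> set es" "\<Union>e \<noteq> \<Union>f" for e f
    proof (rule ccontr)
      assume "\<not> card (\<Union>e \<inter> \<Union>f) \<le> 1"
      then have "2 \<le> card (\<Union>e \<inter> \<Union>f)" by simp
      then obtain p where p: "p \<subseteq> \<Union>e \<inter> \<Union>f" "card p = 2" by (meson obtain_subset_with_card_n)
      then have "p \<in> pairs (\<Union>e)" "p \<in> pairs (\<Union>f)" by (auto simp: pairs_def)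
      then have "p \<in> e \<inter> f" using blk ef by auto
      then show False using disj[of e f] ef by auto
    qed
    have "packing n (\<phi> es)"
      unfolding packing_def \<phi>_def using meet by (simp add: blk)
    moreover have "pairs ` \<phi> es = set es"
    proof -
      have "pairs ` \<phi> es = (\<lambda>e. pairs (\<Union>e)) ` set es" by (simp add: \<phi>_def image_image)
      also have "\<dots> = (\<lambda>e. e) ` set es" by (intro image_cong refl) (simp add: blk)
      finally show ?thesis by simp
    qed
    moreover have "\<forall>b\<in>\<phi> es. card b \<le> 4" by (simp add: blk \<phi>_def)
    moreover have "set (take Q es) = {e \<in> set es. card e = 6}" "set (drop Q es) = {e \<in> set es. card e = 3}"
      unfolding un using c6 c3 by auto
    ultimately show ?thesis using dist len by simp
  qed
  have fibre: "card {es \<in> R. \<phi> es = P} \<le> fact Q * fact T" for P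
  proof (cases "{es \<in> R. \<phi> es = P} = {}")
    case True then show ?thesis by (simp only: card.empty)
  next
    case False
    then obtain es0 where es0: "es0 \<in> R" "\<phi> es0 = P" by blast
    define X where "X = {e \<in> pairs ` P. card e = 6}"
    define Y where "Y = {e \<in> pairs ` P. card e = 3}"
    have set_es: "set es = pairs ` P" if "es \<in> R" "\<phi> es = P" for es using R[OF that(1)] unfolding that(2) by blast
    have "set (take Q es0) = X" "set (drop Q es0) = Y"
      using R[OF es0(1)] unfolding X_def Y_def set_es[OF es0, symmetric] by blast+
    moreover have "distinct (take Q es0)" "distinct (drop Q es0)" "length (take Q es0) = Q" "length (drop Q es0) = T"
      using R[OF es0(1)] by blast+
    then have "card (set (take Q es0)) = Q" "card (set (drop Q es0)) = T" by (simp_all only: distinct_card)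
    moreover have "finite (set (take Q es0))" "finite (set (drop Q es0))" by simp_all
    ultimately have X: "card X = Q" "card Y = T" and f: "finite X" "finite Y" by (simp_all only:)
    have "{es \<in> R. \<phi> es = P} \<subseteq> (\<lambda>(a, b). a @ b) ` (permutations_of_set X \<times> permutations_of_set Y)"
    proof
      fix es assume "es \<in> {es \<in> R. \<phi> es = P}"
      then have es: "es \<in> R" "\<phi> es = P" by auto
      have "take Q es \<in> permutations_of_set X" "drop Q es \<in> permutations_of_set Y"
        using R[OF es(1)] unfolding permutations_of_set_def X_def Y_def set_es[OF es, symmetric] by blast+
      then show "es \<in> (\<lambda>(a, b). a @ b) ` (permutations_of_set X \<times> permutations_of_set Y)"
        by (intro image_eqI[of _ _ "(take Q es, drop Q es)"]) simp_all
    qed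
    then have "card {es \<in> R. \<phi> es = P} \<le> card ((\<lambda>(a, b). a @ b) ` (permutations_of_set X \<times> permutations_of_set Y))"
      by (intro card_mono) auto
    also have "\<dots> \<le> card (permutations_of_set X \<times> permutations_of_set Y)" by (intro card_image_le) auto
    also have "\<dots> = fact Q * fact T" using X f by (simp add: card_cartesian_product)
    finally show ?thesis .
  qed
  define S where "S = {P. packing n P \<and> (\<forall>b\<in>P. card b \<le> 4)}"
  have fS: "finite S" unfolding S_def by (rule finite_packings)
  have "\<phi> es \<in> S" if "es \<in> R" for es using R[OF that] by (simp add: S_def)
  then have "R = (\<Union>P\<in>S. {es \<in> R. \<phi> es = P})" by blast
  then have "card R = card (\<Union>P\<in>S. {es \<in> R. \<phi> es = P})" by (rule arg_cong)
  also have "\<dots> \<le> (\<Sum>P\<in>S. card {es \<in> R. \<phi> es = P})" by (rule card_UN_le[OF fS])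
  also have "\<dots> \<le> (\<Sum>P\<in>S. fact Q * fact T)" by (intro sum_mono fibre)
  finally show ?thesis by (simp add: R_def S_def mult.commute)
qed

theorem small_packings_ge:
  fixes \<kappa> \<xi>0 \<epsilon> :: real and Q T m0 :: nat
  defines "M \<equiv> real n * (real n - 1) / 2"
  assumes "6 * real Q + 3 * real T + real m0 \<le> M"
    and m0: "0 < m0" and \<kappa>: "1 \<le> \<kappa>" "\<kappa> * (12 / n / (m0 / M) ^ 5) \<le> \<xi>0" and tol: "\<xi>0 / (m0 / M) ^ 2200 \<le> \<epsilon>" "\<epsilon> \<le> 1 / 100"
    and init: "2 * M * exp (- \<kappa> * \<xi>0) \<le> 1 / 4"
  shows "((1 - \<epsilon>) * (n * (real n - 1) * (real n - 2) * (real n - 3) / 24)) ^ Q *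
     ((1 - \<epsilon>) * (n * (real n - 1) * (real n - 2) / 6)) ^ T * (exp (- M) / 2)
     \<le> fact Q * fact T * card {P. packing n P \<and> (\<forall>b\<in>P. card b \<le> 4)}"
proof -
  have NM: "real (card (pairs {..<n})) = M" by (simp add: M_def card_pairs real_choose_2)
  let ?ks = "replicate Q 6 @ replicate T (3::nat)"
  have "real (sum_list ?ks + m0) \<le> real (card (pairs {..<n}))" unfolding NM using assms(2) by (simp add: sum_list_replicate)
  then have s: "sum_list ?ks + m0 \<le> card (pairs {..<n})" by (simp only: of_nat_le_iff)
  have ks: "set ?ks \<subseteq> {3, 6}" by auto
  have "(\<Prod>k\<leftarrow>?ks. (1 - \<epsilon>) * (M * block_degree n k / real k)) * (exp (- M) / 2) \<le> real (card (runs ?ks (pairs {..<n})))"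
    using card_runs_full_ge[OF ks s m0 \<kappa>(1), of \<xi>0 \<epsilon>] \<kappa>(2) tol init unfolding NM by simp
  also have "\<dots> \<le> real (fact Q * fact T * card {P. packing n P \<and> (\<forall>b\<in>P. card b \<le> 4)})"
    using card_runs_le_packings by (rule of_nat_mono)
  finally show ?thesis by (simp add: prod_list_replicate block_degree_def M_def mult.assoc)
qed

end

section \<open>The lower bound\<close>

text \<open>Stirling's bound for the factorial. The upper bound \<open>X\<close> replaces \<open>m\<close> where an error in \<open>m\<close> does no
  harm, because the numbers of blocks are only approximately proportional to $n^2$.\<close>
lemma ln_fact_quotient_ge:
  fixes c X :: real
  assumes "1 \<le> m" "real m \<le> X" "1 \<le> c" 
  shows "m * ln (c / X) + m - ln X - 1 \<le> m * ln c - ln (fact m)"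
proof -
  have "ln (fact m) \<le> m * ln m - m + ln m + 1" by (rule ln_fact_le[OF assms(1)])
  moreover have "m * ln m \<le> m * ln X" "ln m \<le> ln X" using assms by (auto intro!: mult_left_mono)
  moreover have "m * ln (c / X) = m * ln c - m * ln X" using assms by (simp add: ln_div algebra_simps)
  ultimately show ?thesis by linarith
qed

text \<open>The greedy process with the optimal proportion of quadruples, stopped when a fraction \<open>\<rho>\<close> of the
  pairs is left. Uncovered pairs simply become two-point lines, but each of them costs a factor of
  about $n^{1/3}$, so that \<open>\<rho>\<close> has to be of smaller order than $1 / \ln n$. With the initial
  tolerance $n^{-1/4}$ for the relative degrees and $\kappa = \sqrt n$, the potential is tiny at the start.\<close>
lemma num_matroids_ge_at:
  fixes n :: nat and \<delta> \<rho> :: real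
  defines "N \<equiv> real n * (real n - 1) / 2" and "\<Lambda> \<equiv> ln ((1 + sqrt 3) / 2)"
    and "B \<equiv> ln (real n) + ln ((1 + sqrt 3) / 2) + ln ((1 - \<delta>) * (1 - 3 / real n) ^ 3)"
  assumes n: "5 \<le> n" and \<delta>: "0 < \<delta>" "\<delta> \<le> 1 / 100" and \<rho>: "0 < \<rho>" "\<rho> \<le> 1"
    and c1: "sqrt n * (12 / real n / \<rho> ^ 5) \<le> n powr (- 1 / 4)"
    and c2: "real n powr (- 1 / 4) / \<rho> ^ 2200 \<le> \<delta>"
    and c3: "2 * N * exp (- sqrt n * n powr (- 1 / 4)) \<le> 1 / 4"
    and B: "0 \<le> B"
    and c6: "1 \<le> (2 - sqrt 3) / 6 * (N * (1 - \<rho>) - 1)" and c7: "1 \<le> (sqrt 3 - 1) / 3 * (N * (1 - \<rho>) - 1)"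
  shows "0 < num_matroids n 3"
    and "(N * (1 - \<rho>) / 3 - 4) * B + sqrt 3 / 6 * (N * (1 - \<rho>) - 1) - N - ln 2 - 4 - 4 * ln n \<le> ln (num_matroids n 3)"
proof -
  \<comment> \<open>The optimal fraction of the pairs that lie in quadruples.\<close>
  define p where "p = 2 - sqrt (3::real)"
  have sq: "sqrt 3 * sqrt 3 = (3::real)" "1 < sqrt (3::real)" "sqrt (3::real) < 2" by (auto intro: real_less_lsqrt)
  have p: "0 < p" "p < 1" "sqrt 3 - 1 = 1 - p" "2 * p = (1 - p)\<^sup>2" "(1 + sqrt 3) / 2 = 1 / (1 - p)"
    using sq by (auto simp: p_def power2_eq_square field_simps)
  \<comment> \<open>At least this many pairs stay uncovered.\<close>
  define m0 where "m0 = nat \<lceil>\<rho> * N\<rceil>"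
  define Q where "Q = nat \<lfloor>p / 6 * (N - m0)\<rfloor>"
  define T where "T = nat \<lfloor>(1 - p) / 3 * (N - m0)\<rfloor>"
  have N: "0 < N" using n by (simp add: N_def)
  have m0: "\<rho> * N \<le> m0" "m0 < \<rho> * N + 1" "0 < m0" using N \<rho> unfolding m0_def by (auto intro: order_less_le_trans) linarith+
  have NM: "N * (1 - \<rho>) - 1 \<le> N - m0" using m0 by (simp add: algebra_simps)
  have q1: "1 \<le> p / 6 * (N - m0)"
    using order_trans[OF c6[folded p_def] mult_left_mono[OF NM, of "p / 6"]] p(1) by simp
  have t1: "1 \<le> (1 - p) / 3 * (N - m0)"
    using order_trans[OF c7[unfolded p(3)] mult_left_mono[OF NM, of "(1 - p) / 3"]] p(2) by simp
  have Q: "p / 6 * (N - m0) - 1 \<le> Q" "Q \<le> p / 6 * (N - m0)" "1 \<le> Q" using q1 unfolding Q_def by (auto simp: le_nat_iff le_floor_iff) linarith+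
  have T: "(1 - p) / 3 * (N - m0) - 1 \<le> T" "T \<le> (1 - p) / 3 * (N - m0)" "1 \<le> T" using t1 unfolding T_def by (auto simp: le_nat_iff le_floor_iff) linarith+
  define C4 where "C4 = (1 - \<delta>) * (n * (real n - 1) * (real n - 2) * (real n - 3) / 24)"
  define C3 where "C3 = (1 - \<delta>) * (n * (real n - 1) * (real n - 2) / 6)"
  define Z where "Z = card {P. packing n P \<and> (\<forall>b\<in>P. card b \<le> 4)}"
  have main: "C4 ^ Q * C3 ^ T * (exp (- N) / 2) \<le> fact Q * fact T * Z"
    unfolding C4_def C3_def Z_def
  proof (rule small_packings_ge[OF n, of Q T m0 "sqrt n" "n powr (- 1 / 4)" \<delta>, folded N_def])
    show "6 * real Q + 3 * real T + real m0 \<le> N" using Q T by (simp add: algebra_simps)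
    show "1 \<le> sqrt (real n)" using n by simp
    have r: "\<rho> \<le> m0 / N" using m0 N by (simp add: le_divide_eq)
    have "sqrt n * (12 / real n / (m0 / N) ^ 5) \<le> sqrt n * (12 / real n / \<rho> ^ 5)"
      using r \<rho> by (intro mult_left_mono divide_left_mono power_mono mult_pos_pos zero_less_power) auto
    then show "sqrt n * (12 / real n / (m0 / N) ^ 5) \<le> real n powr (- 1 / 4)" using c1 by linarith
    have "real n powr (- 1 / 4) / (m0 / N) ^ 2200 \<le> real n powr (- 1 / 4) / \<rho> ^ 2200"
      using r \<rho> by (intro divide_left_mono power_mono mult_pos_pos zero_less_power) auto
    then show "real n powr (- 1 / 4) / (m0 / N) ^ 2200 \<le> \<delta>" using c2 by linarith
  qed (use m0 \<delta> c3 in auto)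
  have n3: "3 / real n < 1" using n by simp
  define \<phi> where "\<phi> = (1 - \<delta>) * (1 - 3 / real n) ^ 3"
  have \<phi>: "0 < \<phi>" using n3 \<delta> by (simp add: \<phi>_def)
  have \<phi>1: "\<phi> \<le> 1" unfolding \<phi>_def using n3 \<delta> by (intro mult_le_one power_le_one) auto
  have u: "1 - 3 / real n \<le> 1 - i / real n" if "i \<le> 3" for i using n that by (simp add: divide_right_mono)
  have C3\<phi>: "real n ^ 3 / 6 * \<phi> \<le> C3"
  proof -
    have "(1 - 3 / real n) ^ 3 = (1 - 3 / real n) * (1 - 3 / real n) * (1 - 3 / real n)" by (simp add: power3_eq_cube)
    also have "\<dots> \<le> 1 * (1 - 1 / real n) * (1 - 2 / real n)" using n3 n u[of 1] u[of 2] by (intro mult_mono) auto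
    finally have "real n ^ 3 / 6 * (1 - \<delta>) * (1 - 3 / real n) ^ 3 \<le> real n ^ 3 / 6 * (1 - \<delta>) * ((1 - 1 / real n) * (1 - 2 / real n))"
      using \<delta> by (intro mult_left_mono) auto
    also have "\<dots> = C3" using n unfolding C3_def by (simp add: field_simps power3_eq_cube)
    finally show ?thesis by (simp add: \<phi>_def)
  qed
  have C4\<phi>: "real n ^ 4 / 24 * \<phi> \<le> C4"
  proof -
    have "(1 - 3 / real n) ^ 3 = (1 - 3 / real n) * (1 - 3 / real n) * (1 - 3 / real n)" by (simp add: power3_eq_cube)
    also have "\<dots> \<le> (1 - 1 / real n) * (1 - 2 / real n) * (1 - 3 / real n)" using n3 n u[of 1] u[of 2] by (intro mult_mono) auto
    finally have "real n ^ 4 / 24 * (1 - \<delta>) * (1 - 3 / real n) ^ 3 \<le> real n ^ 4 / 24 * (1 - \<delta>) * ((1 - 1 / real n) * (1 - 2 / real n) * (1 - 3 / real n))"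
      using \<delta> by (intro mult_left_mono) auto
    also have "\<dots> = C4" using n unfolding C4_def by (simp add: field_simps power4_eq_xxxx)
    finally show ?thesis by (simp add: \<phi>_def)
  qed
  \<comment> \<open>Asymptotically the numbers of quadruples and of triples.\<close>
  define X4 where "X4 = p * (real n)\<^sup>2 / 12"
  define X3 where "X3 = (1 - p) * (real n)\<^sup>2 / 6"
  have Nn: "N \<le> (real n)\<^sup>2 / 2" using n by (simp add: N_def power2_eq_square field_simps)
  have "N - m0 \<le> (real n)\<^sup>2 / 2" using Nn by simp
  then have "p / 6 * (N - m0) \<le> p / 6 * ((real n)\<^sup>2 / 2)" "(1 - p) / 3 * (N - m0) \<le> (1 - p) / 3 * ((real n)\<^sup>2 / 2)"
    using p by (auto intro!: mult_left_mono)
  then have X: "Q \<le> X4" "T \<le> X3" using Q T by (auto simp: X4_def X3_def)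
  have X0: "1 \<le> X4" "1 \<le> X3" using X Q(3) T(3) by linarith+
  have Xn: "X4 \<le> (real n)\<^sup>2" "X3 \<le> (real n)\<^sup>2" using p by (auto simp: X4_def X3_def field_simps intro: mult_right_mono add_increasing)
  have Bdef: "B = ln n + \<Lambda> + ln \<phi>" by (simp add: B_def \<Lambda>_def \<phi>_def)
  have \<Lambda>: "\<Lambda> = - ln (1 - p)" unfolding \<Lambda>_def p(5) using p by (simp add: ln_div)
  have eB: "exp B = n / (1 - p) * \<phi>" unfolding Bdef \<Lambda> using n p \<phi> by (simp add: exp_add exp_diff)
  have "1 \<le> exp B" using B by simp
  have r3: "B \<le> ln (C3 / X3)" "1 \<le> C3"
  proof -
    have "exp B = (real n ^ 3 / 6 * \<phi>) / X3" unfolding eB X3_def using n p by (simp add: field_simps power3_eq_cube power2_eq_square)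
    also have "\<dots> \<le> C3 / X3" using C3\<phi> X0 by (intro divide_right_mono) auto
    finally have e: "exp B \<le> C3 / X3" .
    then have "0 < C3 / X3" using exp_gt_zero[of B] by linarith
    then show "B \<le> ln (C3 / X3)" using e by (simp add: ln_ge_iff)
    have "1 \<le> C3 / X3" using e \<open>1 \<le> exp B\<close> by linarith
    then show "1 \<le> C3" using X0 by (simp add: le_divide_eq split: if_splits)
  qed
  have r4: "2 * B \<le> ln (C4 / X4)" "1 \<le> C4"
  proof -
    have "exp (2 * B) = exp B ^ 2" by (simp add: exp_of_nat_mult[of 2, symmetric])
    also have "\<dots> = (real n)\<^sup>2 / (2 * p) * (\<phi> * \<phi>)" unfolding eB p(4) by (simp add: power2_eq_square)
    also have "\<dots> \<le> (real n)\<^sup>2 / (2 * p) * (\<phi> * 1)" using \<phi> \<phi>1 p by (intro mult_left_mono) auto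
    also have "\<dots> = (real n ^ 4 / 24 * \<phi>) / X4" unfolding X4_def using n p by (simp add: field_simps power4_eq_xxxx power2_eq_square)
    also have "\<dots> \<le> C4 / X4" using C4\<phi> X0 by (intro divide_right_mono) auto
    finally have e: "exp (2 * B) \<le> C4 / X4" .
    then have "0 < C4 / X4" using exp_gt_zero[of "2 * B"] by linarith
    then show "2 * B \<le> ln (C4 / X4)" using e by (simp add: ln_ge_iff)
    have "1 \<le> exp (2 * B)" using B by simp
    then have "1 \<le> C4 / X4" using e by linarith
    then show "1 \<le> C4" using X0 by (simp add: le_divide_eq split: if_splits)
  qed
  have pos: "0 < C4 ^ Q * C3 ^ T * (exp (- N) / 2)" using r3 r4 by simp
  then have "0 < real (fact Q * fact T * Z)" using main by (simp add: order_less_le_trans)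
  then have Z: "0 < Z" by (simp add: zero_less_mult_iff)
  have ZM: "Z \<le> num_matroids n 3" unfolding Z_def by (rule card_small_packings_le_num_matroids[OF n])
  then show "0 < num_matroids n 3" using Z by simp
  have "ln (C4 ^ Q * C3 ^ T * (exp (- N) / 2)) \<le> ln (fact Q * fact T * Z)"
    using main pos by (subst ln_le_cancel_iff) (auto intro: order_less_le_trans)
  then have lnZ: "Q * ln C4 - ln (fact Q) + (T * ln C3 - ln (fact T)) - N - ln 2 \<le> ln Z"
    using r3 r4 Z by (simp add: ln_mult ln_div ln_realpow)
  have "Q * (2 * B) + Q - ln X4 - 1 \<le> Q * ln C4 - ln (fact Q)"
    using ln_fact_quotient_ge[OF Q(3) X(1) r4(2)] mult_left_mono[OF r4(1), of "real Q"] by simp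
  moreover have "T * B + T - ln X3 - 1 \<le> T * ln C3 - ln (fact T)"
    using ln_fact_quotient_ge[OF T(3) X(2) r3(2)] mult_left_mono[OF r3(1), of "real T"] by simp
  moreover have "ln X4 \<le> 2 * ln n" "ln X3 \<le> 2 * ln n"
  proof -
    have "ln X4 \<le> ln ((real n)\<^sup>2)" "ln X3 \<le> ln ((real n)\<^sup>2)" using Xn X0 n by (subst ln_le_cancel_iff; simp)+
    then show "ln X4 \<le> 2 * ln n" "ln X3 \<le> 2 * ln n" using n by (simp_all add: ln_realpow)
  qed
  moreover have "(N * (1 - \<rho>) / 3 - 4) * B \<le> (T + 2 * real Q) * B"
  proof (rule mult_right_mono[OF _ B])
    show "N * (1 - \<rho>) / 3 - 4 \<le> T + 2 * real Q" using Q(1) T(1) NM by (simp add: algebra_simps)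
  qed
  moreover have "sqrt 3 / 6 * (N * (1 - \<rho>) - 1) \<le> T + real Q + 2"
  proof -
    have "sqrt 3 / 6 * (N * (1 - \<rho>) - 1) \<le> sqrt 3 / 6 * (N - m0)" using NM by (intro mult_left_mono) auto
    also have "\<dots> = p / 6 * (N - m0) + (1 - p) / 3 * (N - m0)" by (simp add: p_def field_simps)
    finally show ?thesis using Q(1) T(1) by linarith
  qed
  moreover have "(T + 2 * real Q) * B = T * B + Q * (2 * B)" by (simp add: algebra_simps)
  moreover have "ln Z \<le> ln (num_matroids n 3)" using Z ZM by simp
  ultimately show "(N * (1 - \<rho>) / 3 - 4) * B + sqrt 3 / 6 * (N * (1 - \<rho>) - 1) - N - ln 2 - 4 - 4 * ln n \<le> ln (num_matroids n 3)"
    using lnZ by linarith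
qed

definition growth_constant :: real where
  "growth_constant = (1 + sqrt 3) / 2 * exp (sqrt 3 / 2 - 3)"

lemma growth_constant_pos: "0 < growth_constant"
  unfolding growth_constant_def by (intro mult_pos_pos) (auto intro: add_pos_pos)

lemma ln_growth_constant: "ln growth_constant = ln ((1 + sqrt 3) / 2) + sqrt 3 / 2 - 3"
proof -
  have "0 < (1 + sqrt 3) / (2::real)" by (auto intro: add_pos_pos)
  then have "ln growth_constant = ln ((1 + sqrt 3) / 2) + ln (exp (sqrt 3 / 2 - 3))"
    unfolding growth_constant_def by (rule ln_mult_pos) simp
  then show ?thesis by simp
qed

theorem ln_num_matroids_ge:
  assumes "0 < \<epsilon>"
  shows "\<forall>\<^sub>F n in sequentially. 0 < num_matroids n 3 \<and>
     (real n)\<^sup>2 / 6 * (ln n + ln growth_constant - \<epsilon>) \<le> ln (num_matroids n 3)"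
proof -
  \<comment> \<open>The tolerance \<open>\<delta>\<close> of the degrees costs a factor \<open>1 - \<delta>\<close> in every step.\<close>
  define \<delta> where "\<delta> = min (1 / 100) (1 - exp (- \<epsilon> / 2))"
  have \<delta>: "0 < \<delta>" "\<delta> \<le> 1 / 100" "- \<epsilon> / 2 \<le> ln (1 - \<delta>)"
  proof -
    show "0 < \<delta>" using assms by (auto simp: \<delta>_def)
    show "\<delta> \<le> 1 / 100" unfolding \<delta>_def by (rule min.cobounded1)
    have "exp (- \<epsilon> / 2) \<le> 1 - \<delta>" by (auto simp: \<delta>_def)
    moreover have "0 < 1 - \<delta>" by (auto simp: \<delta>_def)
    ultimately show "- \<epsilon> / 2 \<le> ln (1 - \<delta>)" by (simp add: ln_ge_iff)
  qed
  \<comment> \<open>The exponent is so small that $n^{-1/4} \rho^{-2200}$ still tends to 0.\<close>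
  define \<rho> where "\<rho> = (\<lambda>n::nat. real n powr (- 1 / 20000))"
  define N where "N = (\<lambda>n::nat. real n * (real n - 1) / 2)"
  define \<Lambda> where "\<Lambda> = ln ((1 + sqrt 3) / 2)"
  define s where "s = sqrt (3::real)"
  have sq: "1 < sqrt (3::real)" "sqrt (3::real) < 2" by (auto intro: real_less_lsqrt)
  define B where "B = (\<lambda>n::nat. ln (real n) + \<Lambda> + ln ((1 - \<delta>) * (1 - 3 / real n) ^ 3))"
  define F where "F = (\<lambda>n. (N n * (1 - \<rho> n) / 3 - 4) * B n + s / 6 * (N n * (1 - \<rho> n) - 1) - N n - ln 2 - 4 - 4 * ln n)"
  have "(\<lambda>n. F n / ((real n)\<^sup>2 / 6) - ln n) \<longlonglongrightarrow> \<Lambda> + ln (1 - \<delta>) + s / 2 - 3"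
    unfolding F_def B_def N_def \<rho>_def using \<delta>(1,2) by (real_asymp simp: field_simps)
  moreover have "ln growth_constant - \<epsilon> < \<Lambda> + ln (1 - \<delta>) + s / 2 - 3"
    using \<delta>(3) assms by (simp add: ln_growth_constant \<Lambda>_def s_def)
  ultimately have lim: "\<forall>\<^sub>F n in sequentially. ln growth_constant - \<epsilon> < F n / ((real n)\<^sup>2 / 6) - ln n"
    by (rule order_tendstoD)
  have e1: "\<forall>\<^sub>F n::nat in sequentially. sqrt n * (12 / real n / \<rho> n ^ 5) \<le> n powr (- 1 / 4)"
    unfolding \<rho>_def by real_asymp
  have e2: "\<forall>\<^sub>F n::nat in sequentially. real n powr (- 1 / 4) / \<rho> n ^ 2200 \<le> \<delta>"
  proof -
    have "(\<lambda>n. real n powr (- 7 / 50)) \<longlonglongrightarrow> 0" by real_asymp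
    then have "\<forall>\<^sub>F n in sequentially. real n powr (- 7 / 50) < \<delta>" using \<delta>(1) by (rule order_tendstoD)
    then show ?thesis using eventually_gt_at_top[of 0]
    proof eventually_elim
      case (elim n)
      have "\<rho> n ^ 2200 = real n powr (- 11 / 100)"
        using elim(2) unfolding \<rho>_def by (subst powr_realpow[symmetric]) (simp_all add: powr_powr)
      then have "real n powr (- 1 / 4) / \<rho> n ^ 2200 = real n powr (- 1 / 4 - (- 11 / 100))" by (simp only: powr_diff)
      also have "- 1 / 4 - (- 11 / 100) = (- 7 / 50 :: real)" by simp
      finally show ?case using elim(1) by linarith
    qed
  qed
  have e3: "\<forall>\<^sub>F n::nat in sequentially. 2 * N n * exp (- sqrt n * n powr (- 1 / 4)) \<le> 1 / 4"
    unfolding N_def by real_asymp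
  have "filterlim (\<lambda>n::nat. N n * (1 - \<rho> n) - 1) at_top sequentially" unfolding N_def \<rho>_def by real_asymp
  then have big: "\<forall>\<^sub>F n::nat in sequentially. c \<le> N n * (1 - \<rho> n) - 1" for c by (simp add: filterlim_at_top)
  have "filterlim B at_top sequentially" unfolding B_def using \<delta>(1,2) by real_asymp
  then have e4: "\<forall>\<^sub>F n in sequentially. 0 \<le> B n" by (simp add: filterlim_at_top)
  have e5: "\<forall>\<^sub>F n in sequentially. 5 \<le> n" by (rule eventually_ge_at_top)
  show ?thesis
    using lim e1 e2 e3 e4 e5 big[of "6 / (2 - sqrt 3)"] big[of "3 / (sqrt 3 - 1)"]
  proof eventually_elim
    case (elim n)
    have \<rho>: "0 < \<rho> n" "\<rho> n \<le> 1" 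
      using elim(6) powr_mono[of "- 1 / 20000" 0 "real n"] unfolding \<rho>_def by auto
    have b: "1 \<le> (2 - sqrt 3) / 6 * (N n * (1 - \<rho> n) - 1)" "1 \<le> (sqrt 3 - 1) / 3 * (N n * (1 - \<rho> n) - 1)"
      using elim(7,8) sq by (auto simp: field_simps)
    note ge = num_matroids_ge_at[OF elim(6) \<delta>(1,2) \<rho> elim(2,3), folded N_def \<Lambda>_def, folded B_def]
    have "0 < num_matroids n 3" "F n \<le> ln (num_matroids n 3)"
      using num_matroids_ge_at[OF elim(6) \<delta>(1,2) \<rho> elim(2,3)] elim(4,5) b by (auto simp: F_def N_def B_def \<Lambda>_def s_def)
    moreover have "(real n)\<^sup>2 / 6 * (ln n + ln growth_constant - \<epsilon>) \<le> F n"
    proof -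
      have n0: "0 < (real n)\<^sup>2 / 6" using elim(6) by simp
      have "ln n + ln growth_constant - \<epsilon> \<le> F n / ((real n)\<^sup>2 / 6)" using elim(1) by simp
      then show ?thesis using n0 by (simp only: pos_le_divide_eq mult.commute)
    qed
    ultimately show ?case by simp
  qed
qed

section \<open>Counting by random orders\<close>

lemma sum_permutations_Cons:
  assumes "finite S" "S \<noteq> {}"
  shows "(\<Sum>xs\<in>permutations_of_set S. f xs) = (\<Sum>x\<in>S. \<Sum>ys\<in>permutations_of_set (S - {x}). f (x # ys))"
proof -
  have "(\<Sum>xs\<in>permutations_of_set S. f xs) = (\<Sum>x\<in>S. \<Sum>xs\<in>(#) x ` permutations_of_set (S - {x}). f xs)"
    unfolding permutations_of_set_nonempty[OF assms(2)] using assms by (intro sum.UNION_disjoint) auto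
  also have "\<dots> = (\<Sum>x\<in>S. \<Sum>ys\<in>permutations_of_set (S - {x}). f (x # ys))"
  proof -
    have "(\<Sum>xs\<in>(#) x ` P. f xs) = (\<Sum>ys\<in>P. f (x # ys))" for x P by (subst sum.reindex) (auto simp: inj_on_def)
    then show ?thesis by (simp only:)
  qed
  finally show ?thesis .
qed

lemma sum_permutations_nth:
  fixes g :: "'a \<Rightarrow> real"
  assumes "finite S" "i < card S"
  shows "(\<Sum>xs\<in>permutations_of_set S. g (xs ! i)) = fact (card S - 1) * (\<Sum>b\<in>S. g b)"
  using assms
proof (induction i arbitrary: S)
  case 0
  then have "S \<noteq> {}" by auto
  then show ?case using 0 by (simp add: sum_permutations_Cons sum_distrib_left)
next
  case (Suc i)
  then have ne: "S \<noteq> {}" by auto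
  have "(\<Sum>xs\<in>permutations_of_set S. g (xs ! Suc i)) = (\<Sum>x\<in>S. \<Sum>ys\<in>permutations_of_set (S - {x}). g (ys ! i))"
    using Suc ne by (simp add: sum_permutations_Cons)
  also have "\<dots> = (\<Sum>x\<in>S. fact (card S - 2) * (\<Sum>b\<in>S - {x}. g b))"
    using Suc by (intro sum.cong refl) (simp add: Suc.IH numeral_2_eq_2)
  also have "\<dots> = fact (card S - 2) * (\<Sum>x\<in>S. (\<Sum>b\<in>S. g b) - g x)"
    using Suc.prems by (simp add: sum_distrib_left sum_diff1)
  also have "(\<Sum>x\<in>S. (\<Sum>b\<in>S. g b) - g x) = (card S - 1) * (\<Sum>b\<in>S. g b)"
    using Suc.prems by (simp add: sum_subtractf of_nat_diff algebra_simps)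
  also have "fact (card S - 2) * ((card S - 1) * (\<Sum>b\<in>S. g b)) = fact (card S - 1) * (\<Sum>b\<in>S. g b)"
  proof -
    have "card S - 1 = Suc (card S - 2)" using Suc.prems by simp
    then show ?thesis by (simp add: fact_Suc del: of_nat_diff)
  qed
  finally show ?case .
qed

text \<open>The first element of a random order of $M$ elements avoids \<open>R\<close>, which has $r$ elements, with probability
  $1 - r/M \le (1 - 1/M)^r$; so the bound for single elements can be multiplied as if their
  positions were independent.\<close>
lemma card_permutations_avoiding:
  assumes "finite S" "R \<subseteq> S" "i \<le> card S"
  shows "real (card {xs \<in> permutations_of_set S. R \<inter> set (take i xs) = {}}) \<le> ((real (card S) - i) / card S) ^ card R * fact (card S)"
  using assms
proof (induction i arbitrary: S)
  case 0
  show ?case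
  proof (cases "S = {}")
    case True
    then show ?thesis using 0 by simp
  next
    case False
    then show ?thesis using 0 by (simp add: card_gt_0_iff)
  qed
next
  case (Suc i)
  define M where "M = card S"
  define r where "r = card R"
  have ne: "S \<noteq> {}" using Suc.prems by auto
  have M: "Suc i \<le> M" "r \<le> M" using Suc.prems by (auto simp: M_def r_def intro: card_mono)
  have fR: "finite R" using Suc.prems finite_subset by blast
  have "real (card {xs \<in> permutations_of_set S. R \<inter> set (take (Suc i) xs) = {}}) =
      (\<Sum>xs\<in>permutations_of_set S. of_bool (R \<inter> set (take (Suc i) xs) = {}))"
    by (simp add: Collect_conj_eq)
  also have "\<dots> = (\<Sum>x\<in>S. \<Sum>ys\<in>permutations_of_set (S - {x}). of_bool (x \<notin> R \<and> R \<inter> set (take i ys) = {}))"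
    by (subst sum_permutations_Cons[OF Suc.prems(1) ne]) (intro sum.cong refl arg_cong[where f = of_bool], auto)
  also have "\<dots> = (\<Sum>x\<in>S. of_bool (x \<notin> R) * real (card {ys \<in> permutations_of_set (S - {x}). R \<inter> set (take i ys) = {}}))"
    by (intro sum.cong refl) (auto simp: Collect_conj_eq)
  also have "\<dots> = (\<Sum>x\<in>S - R. real (card {ys \<in> permutations_of_set (S - {x}). R \<inter> set (take i ys) = {}}))"
    using Suc.prems(1) by (intro sum.mono_neutral_cong_right) auto
  also have "\<dots> \<le> (\<Sum>x\<in>S - R. ((real (M - 1) - i) / real (M - 1)) ^ r * fact (M - 1))"
  proof (rule sum_mono)
    fix x assume x: "x \<in> S - R"
    have RS: "R \<subseteq> S - {x}" and iM: "i \<le> M - 1" using x Suc.prems M by auto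
    have "card (S - {x}) = M - 1" using x Suc.prems(1) by (simp add: M_def)
    then show "real (card {ys \<in> permutations_of_set (S - {x}). R \<inter> set (take i ys) = {}}) \<le> ((real (M - 1) - i) / real (M - 1)) ^ r * fact (M - 1)"
      using Suc.IH[of "S - {x}"] Suc.prems(1) RS iM by (simp add: r_def)
  qed
  also have "\<dots> = (real M - r) * (((real (M - 1) - i) / real (M - 1)) ^ r * fact (M - 1))"
    using Suc.prems fR M by (simp add: card_Diff_subset M_def r_def of_nat_diff)
  also have "\<dots> \<le> ((real M - Suc i) / M) ^ r * fact M"
  proof (cases "M = 1 \<or> r = 0")
    case True
    have fM: "fact M = real M * fact (M - 1)" using M by (simp add: fact_reduce)
    show ?thesis
    proof (cases "r = 0")
      case True then show ?thesis using fM by simp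
    next
      case False
      then have "M = 1" "r = 1" "i = 0" using True M by auto
      then show ?thesis by simp
    qed
  next
    case False
    then have M2: "2 \<le> M" using M by auto
    have e: "real (M - 1) - i = real M - Suc i" using M by (simp add: of_nat_diff)
    have fM: "fact M = real M * fact (M - 1)" using M by (simp add: fact_reduce)
    have "1 + real r * (- 1 / M) \<le> (1 + (- 1 / M)) ^ r" using M2 by (intro Bernoulli_inequality) (auto simp: field_simps)
    then have "(real M - r) / M \<le> ((real M - 1) / M) ^ r" using M2 by (simp add: field_simps power_divide) 
    then have b: "real M - r \<le> M * ((real M - 1) / M) ^ r" using M2 by (simp add: field_simps)
    have x0: "0 \<le> real M - Suc i" using M by simp
    have "(real M - r) * (((real (M - 1) - i) / real (M - 1)) ^ r * fact (M - 1)) \<le>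
        (M * ((real M - 1) / M) ^ r) * (((real (M - 1) - i) / real (M - 1)) ^ r * fact (M - 1))"
      using b x0 e by (intro mult_right_mono) auto
    also have "\<dots> = (((real M - 1) / M) * ((real M - Suc i) / (real M - 1))) ^ r * fact M"
      unfolding e fM power_mult_distrib using M2 by (simp add: of_nat_diff)
    also have "((real M - 1) / M) * ((real M - Suc i) / (real M - 1)) = (real M - Suc i) / M" using M2 by simp
    finally show ?thesis .
  qed
  finally show ?case by (simp add: M_def r_def)
qed

fun sequences :: "'a set \<Rightarrow> ('a set \<Rightarrow> 'a \<Rightarrow> bool) \<Rightarrow> nat \<Rightarrow> 'a list set" where
  "sequences B ok 0 = {[]}"
| "sequences B ok (Suc m) = (\<Union>xs\<in>sequences B ok m. (\<lambda>b. xs @ [b]) ` {b \<in> B. ok (set xs) b})"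

definition available_weight :: "'a set \<Rightarrow> ('a set \<Rightarrow> 'a \<Rightarrow> bool) \<Rightarrow> ('a \<Rightarrow> real) \<Rightarrow> 'a set \<Rightarrow> real" where
  "available_weight B ok w R = (\<Sum>b | b \<in> B \<and> ok R b. w b)"

lemma finite_sequences: "finite B \<Longrightarrow> finite (sequences B ok m)"
  by (induction m) auto

lemma set_sequences: "xs \<in> sequences B ok m \<Longrightarrow> set xs \<subseteq> B"
  by (induction m arbitrary: xs) (simp, fastforce)

lemma length_sequences: "xs \<in> sequences B ok m \<Longrightarrow> length xs = m"
  by (induction m arbitrary: xs) auto

text \<open>The product is the probability of the list when each element is drawn, from those that are
  admissible, with probability proportional to its weight.\<close>
lemma kraft_inequality:
  assumes B: "finite B" and w: "\<And>i b. i < m \<Longrightarrow> b \<in> B \<Longrightarrow> 0 < w i b"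
  shows "(\<Sum>xs\<in>sequences B ok m. \<Prod>i<m. w i (xs ! i) / available_weight B ok (w i) (set (take i xs))) \<le> (1::real)"
  using w
proof (induction m)
  case (Suc m)
  define W where "W = (\<lambda>m xs. \<Prod>i<m. w i (xs ! i) / available_weight B ok (w i) (set (take i xs)))"
  have W0: "0 \<le> W m xs" if "xs \<in> sequences B ok m" for xs
    unfolding W_def
  proof (rule prod_nonneg)
    fix i assume i: "i \<in> {..<m}"
    have "set xs \<subseteq> B" using that by (rule set_sequences)
    moreover have "xs ! i \<in> set xs" using i length_sequences[OF that] by simp
    ultimately have "0 < w i (xs ! i)" using Suc.prems i by auto
    moreover have "0 \<le> available_weight B ok (w i) (set (take i xs))"
      unfolding available_weight_def using Suc.prems i by (intro sum_nonneg) (auto intro: less_imp_le)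
    ultimately show "0 \<le> w i (xs ! i) / available_weight B ok (w i) (set (take i xs))" by simp
  qed
  have "(\<Sum>xs\<in>sequences B ok (Suc m). W (Suc m) xs) =
      (\<Sum>xs\<in>sequences B ok m. \<Sum>ys\<in>(\<lambda>b. xs @ [b]) ` {b \<in> B. ok (set xs) b}. W (Suc m) ys)"
    unfolding sequences.simps using B by (intro sum.UNION_disjoint) (auto simp: finite_sequences)
  also have "\<dots> = (\<Sum>xs\<in>sequences B ok m. \<Sum>b | b \<in> B \<and> ok (set xs) b. W m xs * (w m b / available_weight B ok (w m) (set xs)))"
  proof (intro sum.cong refl)
    fix xs assume xs: "xs \<in> sequences B ok m"
    have l: "length xs = m" by (rule length_sequences[OF xs])
    have "W (Suc m) (xs @ [b]) = W m xs * (w m b / available_weight B ok (w m) (set xs))" for b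
      unfolding W_def using l by (simp add: nth_append)
    then show "(\<Sum>ys\<in>(\<lambda>b. xs @ [b]) ` {b \<in> B. ok (set xs) b}. W (Suc m) ys) =
       (\<Sum>b | b \<in> B \<and> ok (set xs) b. W m xs * (w m b / available_weight B ok (w m) (set xs)))"
      by (subst sum.reindex) (auto simp: inj_on_def)
  qed
  also have "\<dots> = (\<Sum>xs\<in>sequences B ok m. W m xs * (available_weight B ok (w m) (set xs) / available_weight B ok (w m) (set xs)))"
  proof -
    have "(\<Sum>b | b \<in> B \<and> ok (set xs) b. W m xs * (w m b / Z)) = W m xs * ((\<Sum>b | b \<in> B \<and> ok (set xs) b. w m b) / Z)" for xs Z
      by (simp only: sum_distrib_left sum_divide_distrib)
    then show ?thesis by (simp only: available_weight_def)
  qed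
  also have "\<dots> \<le> (\<Sum>xs\<in>sequences B ok m. W m xs)"
    using W0 by (intro sum_mono mult_left_le) auto
  also have "\<dots> \<le> 1" unfolding W_def using Suc by simp
  finally show ?case by (simp add: W_def)
qed simp

text \<open>Jensen's inequality for the exponential function: if \<open>h\<close> satisfies Kraft's inequality, then the
  average of \<open>h\<close> is at least the logarithm of the number of elements.\<close>
lemma card_le_exp_average:
  fixes h :: "'a \<Rightarrow> real" and c :: real
  assumes "finite X" "(\<Sum>x\<in>X. exp (- h x)) \<le> 1" "(\<Sum>x\<in>X. h x) \<le> card X * c"
  shows "real (card X) \<le> exp c"
proof -
  have "exp (- c) * card X \<le> exp (- c) * (card X + (\<Sum>x\<in>X. c - h x))"
    using assms by (intro mult_left_mono) (auto simp: sum_subtractf)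
  also have "\<dots> = (\<Sum>x\<in>X. exp (- c) * (1 + (c - h x)))"
  proof -
    have "card X + (\<Sum>x\<in>X. c - h x) = (\<Sum>x\<in>X. 1 + (c - h x))" by (simp add: sum.distrib)
    then show ?thesis by (simp only: sum_distrib_left)
  qed
  also have "\<dots> \<le> (\<Sum>x\<in>X. exp (- c) * exp (c - h x))"
    by (intro sum_mono mult_left_mono) auto
  also have "\<dots> \<le> 1" using assms by (simp add: exp_add[symmetric])
  finally show ?thesis by (simp add: exp_minus field_simps)
qed

text \<open>The left-hand side counts the orderings of all members of \<open>F\<close>. By Kraft's inequality its logarithm
  is at most an average over orderings of sums of logarithms of available weights, and
  $\ln x \le \ln z + x/z - 1$ replaces the average of a logarithm by the logarithm of a bound on
  the average.\<close>
theorem card_times_fact_le: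
  fixes w :: "nat \<Rightarrow> 'a \<Rightarrow> real"
  assumes B: "finite B" and F: "finite F" "\<And>S. S \<in> F \<Longrightarrow> S \<subseteq> B \<and> card S = M"
    and ok: "\<And>S R b. S \<in> F \<Longrightarrow> R \<subseteq> S \<Longrightarrow> b \<in> S - R \<Longrightarrow> ok R b"
    and w: "\<And>i b. i < M \<Longrightarrow> b \<in> B \<Longrightarrow> 0 < w i b" and z: "\<And>i. i < M \<Longrightarrow> 0 < z i"
    and avg_z: "\<And>S i. S \<in> F \<Longrightarrow> i < M \<Longrightarrow>
        (\<Sum>xs\<in>permutations_of_set S. available_weight B ok (w i) (set (take i xs))) \<le> fact M * z i"
    and avg_w: "\<And>S. S \<in> F \<Longrightarrow> (\<Sum>xs\<in>permutations_of_set S. \<Sum>i<M. - ln (w i (xs ! i))) \<le> fact M * G"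
  shows "card F * fact M \<le> exp ((\<Sum>i<M. ln (z i)) + G)"
proof -
  define X where "X = (\<Union>S\<in>F. permutations_of_set S)"
  define Z where "Z = (\<lambda>i xs. available_weight B ok (w i) (set (take i xs)))"
  define h where "h = (\<lambda>xs. \<Sum>i<M. ln (Z i xs) - ln (w i (xs ! i)))"
  have fS: "finite S" if "S \<in> F" for S using F(2)[OF that] B finite_subset by blast
  have cX: "card X = card F * fact M"
  proof -
    have "card X = (\<Sum>S\<in>F. card (permutations_of_set S))" unfolding X_def using F(1)
      by (intro card_UN_disjoint) (auto dest: permutations_of_setD)
    also have "\<dots> = (\<Sum>S\<in>F. fact M)" using fS F(2) by (intro sum.cong refl) simp
    finally show ?thesis by simp
  qed
  have fX: "finite X" unfolding X_def using F(1) by auto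
  have okxs: "ok (set (take i xs)) (xs ! i)" "xs ! i \<in> B" "length xs = M" if "S \<in> F" "xs \<in> permutations_of_set S" "i < M" for S xs i
  proof -
    have p: "set xs = S" "distinct xs" using that by (auto simp: permutations_of_set_def)
    show l: "length xs = M" using length_finite_permutations_of_set[OF that(2)] F(2)[OF that(1)] by simp
    have "xs ! i \<in> S" using p l that by auto
    then show "xs ! i \<in> B" using F(2)[OF that(1)] by blast
    have "xs ! i \<notin> set (take i xs)" using p(2) l that(3) by (auto simp: in_set_conv_nth nth_eq_iff_index_eq)
    then show "ok (set (take i xs)) (xs ! i)" using \<open>xs ! i \<in> S\<close> p set_take_subset[of i xs] by (intro ok[OF that(1)]) auto
  qed
  have Zpos: "0 < Z i xs" if "S \<in> F" "xs \<in> permutations_of_set S" "i < M" for S xs i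
    unfolding Z_def available_weight_def using okxs[OF that] w[OF that(3)] B
    by (intro sum_pos2[of _ "xs ! i"]) (auto intro: less_imp_le)
  have seq: "X \<subseteq> sequences B ok M"
  proof
    fix xs assume "xs \<in> X"
    then obtain S where S: "S \<in> F" "xs \<in> permutations_of_set S" by (auto simp: X_def)
    have l: "length xs = M" using length_finite_permutations_of_set[OF S(2)] F(2)[OF S(1)] by simp
    have "take i xs \<in> sequences B ok i" if "i \<le> M" for i using that
    proof (induction i)
      case (Suc i)
      have "take (Suc i) xs = take i xs @ [xs ! i]" using Suc.prems l by (simp add: take_Suc_conv_app_nth)
      then show ?case using Suc okxs[OF S, of i] by auto
    qed simp
    from this[of M] show "xs \<in> sequences B ok M" using l by simp
  qed
  have "(\<Sum>xs\<in>X. exp (- h xs)) = (\<Sum>xs\<in>X. \<Prod>i<M. w i (xs ! i) / Z i xs)"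
  proof (rule sum.cong[OF refl])
    fix xs assume "xs \<in> X"
    then obtain S where S: "S \<in> F" "xs \<in> permutations_of_set S" by (auto simp: X_def)
    have "exp (- h xs) = (\<Prod>i<M. exp (ln (w i (xs ! i)) - ln (Z i xs)))"
      by (simp add: h_def exp_sum[symmetric] sum_negf[symmetric])
    also have "\<dots> = (\<Prod>i<M. w i (xs ! i) / Z i xs)"
      using Zpos[OF S] okxs[OF S] w by (intro prod.cong refl) (simp add: exp_diff)
    finally show "exp (- h xs) = (\<Prod>i<M. w i (xs ! i) / Z i xs)" .
  qed
  also have "\<dots> \<le> (\<Sum>xs\<in>sequences B ok M. \<Prod>i<M. w i (xs ! i) / Z i xs)"
  proof (rule sum_mono2[OF finite_sequences[OF B] seq])
    fix xs assume xs: "xs \<in> sequences B ok M - X"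
    have xsB: "set xs \<subseteq> B" using xs set_sequences by blast
    show "0 \<le> (\<Prod>i<M. w i (xs ! i) / Z i xs)"
    proof (rule prod_nonneg)
      fix i assume i: "i \<in> {..<M}"
      then have "xs ! i \<in> B" using xsB length_sequences[of xs B ok M] xs by auto
      then have "0 < w i (xs ! i)" using w i by auto
      moreover have "0 \<le> Z i xs" unfolding Z_def available_weight_def using w i by (intro sum_nonneg) (auto intro: less_imp_le)
      ultimately show "0 \<le> w i (xs ! i) / Z i xs" by simp
    qed
  qed
  also have "\<dots> \<le> 1" unfolding Z_def using B w by (rule kraft_inequality)
  finally have 1: "(\<Sum>xs\<in>X. exp (- h xs)) \<le> 1" .
  have 2: "(\<Sum>xs\<in>X. h xs) \<le> card X * ((\<Sum>i<M. ln (z i)) + G)"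
  proof -
    have "(\<Sum>xs\<in>permutations_of_set S. h xs) \<le> fact M * ((\<Sum>i<M. ln (z i)) + G)" if S: "S \<in> F" for S
    proof -
      have cp: "card (permutations_of_set S) = fact M" using fS[OF S] F(2)[OF S] by simp
      have "(\<Sum>xs\<in>permutations_of_set S. h xs) \<le>
          (\<Sum>xs\<in>permutations_of_set S. (\<Sum>i<M. ln (z i)) + (\<Sum>i<M. Z i xs / z i - 1) + (\<Sum>i<M. - ln (w i (xs ! i))))"
      proof (rule sum_mono)
        fix xs assume xs: "xs \<in> permutations_of_set S"
        have "ln (Z i xs) \<le> ln (z i) + (Z i xs / z i - 1)" if i: "i < M" for i
        proof -
          have "ln (Z i xs / z i) \<le> Z i xs / z i - 1" using Zpos[OF S xs i] z[OF i] by (intro ln_le_minus_one) auto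
          then show ?thesis using Zpos[OF S xs i] z[OF i] by (simp add: ln_div)
        qed
        then have "h xs \<le> (\<Sum>i<M. ln (z i) + (Z i xs / z i - 1) + - ln (w i (xs ! i)))"
          unfolding h_def by (intro sum_mono) auto
        then show "h xs \<le> (\<Sum>i<M. ln (z i)) + (\<Sum>i<M. Z i xs / z i - 1) + (\<Sum>i<M. - ln (w i (xs ! i)))"
          by (simp only: sum.distrib)
      qed
      also have "\<dots> = fact M * (\<Sum>i<M. ln (z i)) + (\<Sum>xs\<in>permutations_of_set S. \<Sum>i<M. Z i xs / z i - 1)
          + (\<Sum>xs\<in>permutations_of_set S. \<Sum>i<M. - ln (w i (xs ! i)))"
        using cp by (simp only: sum.distrib) simp
      also have "(\<Sum>xs\<in>permutations_of_set S. \<Sum>i<M. Z i xs / z i - 1) \<le> 0"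
      proof -
        have "(\<Sum>xs\<in>permutations_of_set S. \<Sum>i<M. Z i xs / z i - 1) = (\<Sum>i<M. \<Sum>xs\<in>permutations_of_set S. Z i xs / z i - 1)"
          by (rule sum.swap)
        also have "\<dots> = (\<Sum>i<M. (\<Sum>xs\<in>permutations_of_set S. Z i xs) / z i - fact M)"
          using cp by (simp add: sum_subtractf sum_divide_distrib)
        also have "\<dots> \<le> 0"
        proof (rule sum_nonpos)
          fix i assume "i \<in> {..<M}"
          then have i: "i < M" by simp
          have "(\<Sum>xs\<in>permutations_of_set S. Z i xs) \<le> fact M * z i" unfolding Z_def by (rule avg_z[OF S i])
          then show "(\<Sum>xs\<in>permutations_of_set S. Z i xs) / z i - fact M \<le> 0" using z[OF i] by (simp add: pos_divide_le_eq)
        qed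
        finally show ?thesis .
      qed
      finally show ?thesis using avg_w[OF S] by (simp add: algebra_simps)
    qed
    then have "(\<Sum>S\<in>F. \<Sum>xs\<in>permutations_of_set S. h xs) \<le> (\<Sum>S\<in>F. fact M * ((\<Sum>i<M. ln (z i)) + G))"
      by (rule sum_mono)
    moreover have "(\<Sum>xs\<in>X. h xs) = (\<Sum>S\<in>F. \<Sum>xs\<in>permutations_of_set S. h xs)"
      unfolding X_def using F(1) by (intro sum.UNION_disjoint) (auto dest: permutations_of_setD)
    ultimately show ?thesis using cX by (simp add: mult.assoc)
  qed
  have "real (card X) \<le> exp ((\<Sum>i<M. ln (z i)) + G)" by (rule card_le_exp_average[OF fX 1 2])
  then show ?thesis using cX by simp
qed

section \<open>The number of packings by triples and quadruples\<close>

lemma packing_pairs_disjoint: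
  assumes "packing n S" "b \<in> S" "c \<in> S" "b \<noteq> c" shows "pairs b \<inter> pairs c = {}"
proof (rule ccontr)
  assume "pairs b \<inter> pairs c \<noteq> {}"
  then obtain p where p: "p \<subseteq> b" "p \<subseteq> c" "card p = 2" by (auto simp: pairs_def)
  then obtain x y where "p = {x, y}" "x \<noteq> y" by (auto simp: card_2_iff)
  then show False using packing_unique[OF assms(1-3), of x y] p assms(4) by auto
qed

lemma packing_pair_count:
  assumes S: "packing n S"
  shows "card {p \<in> pairs {..<n}. \<forall>c\<in>S. \<not> p \<subseteq> c} + (\<Sum>c\<in>S. card c choose 2) = n choose 2"
proof -
  define U where "U = {p \<in> pairs {..<n}. \<forall>c\<in>S. \<not> p \<subseteq> c}"
  have fS: "finite S" by (rule packing_finite[OF S])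
  have fc: "finite c" "c \<subseteq> {..<n}" if "c \<in> S" for c using packing_block[OF S that] by auto
  have fP: "finite (pairs {..<n})" by (simp add: pairs_finite)
  have split: "pairs {..<n} = U \<union> (\<Union>c\<in>S. pairs c)" "U \<inter> (\<Union>c\<in>S. pairs c) = {}"
    using fc by (auto simp: U_def pairs_def)
  have "card (\<Union>c\<in>S. pairs c) = (\<Sum>c\<in>S. card (pairs c))"
    using fS packing_pairs_disjoint[OF S] pairs_finite fc by (intro card_UN_disjoint) auto
  also have "\<dots> = (\<Sum>c\<in>S. card c choose 2)" using fc by (intro sum.cong refl card_pairs)
  finally have "card U + (\<Sum>c\<in>S. card c choose 2) = card (pairs {..<n})"
    using split fP by (metis card_Un_disjoint finite_Un)
  then show ?thesis by (simp add: U_def card_pairs)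
qed

text \<open>The blocks that make \<open>b\<close> unavailable.\<close>
definition touching :: "nat set set \<Rightarrow> nat set \<Rightarrow> nat set set" where
  "touching S b = {c \<in> S. 2 \<le> card (b \<inter> c)}"

text \<open>If no block of \<open>S\<close> contains two of the pairs of \<open>b\<close>, then the pairs of \<open>b\<close> lie in distinct blocks.\<close>
lemma card_touching_ge:
  assumes b: "finite b" and S: "finite S" and cov: "\<And>p. p \<in> pairs b \<Longrightarrow> \<exists>c\<in>S. p \<subseteq> c"
    and gen: "\<And>c. c \<in> S \<Longrightarrow> card (b \<inter> c) \<le> 2"
  shows "card b choose 2 \<le> card (touching S b)"
proof -
  obtain f where f: "\<And>p. p \<in> pairs b \<Longrightarrow> f p \<in> S \<and> p \<subseteq> f p" using cov by metis
  have eq: "b \<inter> f p = p" if "p \<in> pairs b" for p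
  proof -
    have "p \<subseteq> b \<inter> f p" "card (b \<inter> f p) \<le> card p" using f[OF that] gen[of "f p"] that by (auto simp: pairs_def)
    then show ?thesis using b card_seteq[of "b \<inter> f p" p] by simp
  qed
  have "card (pairs b) \<le> card (touching S b)"
  proof (rule card_inj_on_le[of f])
    show "inj_on f (pairs b)" using eq by (intro inj_onI) metis
    show "f ` pairs b \<subseteq> touching S b"
    proof
      fix c assume "c \<in> f ` pairs b"
      then obtain p where p: "p \<in> pairs b" "c = f p" by blast
      then have "b \<inter> c = p" "card p = 2" using eq by (auto simp: pairs_def)
      then show "c \<in> touching S b" using f[OF p(1)] p(2) by (simp add: touching_def)
    qed
    show "finite (touching S b)" using S by (simp add: touching_def)
  qed
  then show ?thesis using b by (simp add: card_pairs)
qed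

text \<open>The sets whose pairs are not covered by distinct blocks; for them the probability
  to be available can be much larger than for the others, but they are few.\<close>
definition degenerate :: "nat \<Rightarrow> nat set set \<Rightarrow> nat \<Rightarrow> nat set set" where
  "degenerate n S k = {b. b \<subseteq> {..<n} \<and> card b = k \<and>
     ((\<exists>p\<in>pairs b. \<forall>c\<in>S. \<not> p \<subseteq> c) \<or> (\<exists>c\<in>S. 3 \<le> card (b \<inter> c)))}"

lemma card_degenerate_le:
  assumes S: "packing n S" "\<And>c. c \<in> S \<Longrightarrow> card c \<le> 4" and k: "3 \<le> k" 
  shows "card (degenerate n S k) \<le> card {p \<in> pairs {..<n}. \<forall>c\<in>S. \<not> p \<subseteq> c} * n ^ (k - 2) + card S * (4 * n ^ (k - 3))"
proof -
  define U where "U = {p \<in> pairs {..<n}. \<forall>c\<in>S. \<not> p \<subseteq> c}"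
  define X where "X = (\<lambda>W. {b. W \<subseteq> b \<and> b \<subseteq> {..<n} \<and> card b = k})"
  have fS: "finite S" by (rule packing_finite[OF S(1)])
  have fU: "finite U" by (simp add: U_def pairs_finite)
  have fX: "finite (X W)" for W unfolding X_def by (rule finite_subset[of _ "Pow {..<n}"]) auto
  have cX: "card (X W) \<le> n ^ (k - card W)" if "W \<subseteq> {..<n}" "card W \<le> k" for W
  proof -
    have "card (X W) = (n - card W) choose (k - card W)" unfolding X_def using that by (subst card_supersets) auto
    also have "\<dots> \<le> (n - card W) ^ (k - card W)" by (cases "k - card W \<le> n - card W") (auto intro: binomial_le_pow simp: binomial_eq_0)
    also have "\<dots> \<le> n ^ (k - card W)" by (intro power_mono) auto
    finally show ?thesis .
  qed
  have "degenerate n S k \<subseteq> (\<Union>p\<in>U. X p) \<union> (\<Union>c\<in>S. \<Union>t\<in>{t. t \<subseteq> c \<and> card t = 3}. X t)"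
  proof
    fix b assume b: "b \<in> degenerate n S k"
    then consider p where "p \<in> pairs b" "\<forall>c\<in>S. \<not> p \<subseteq> c" | c where "c \<in> S" "3 \<le> card (b \<inter> c)"
      by (auto simp: degenerate_def)
    then show "b \<in> (\<Union>p\<in>U. X p) \<union> (\<Union>c\<in>S. \<Union>t\<in>{t. t \<subseteq> c \<and> card t = 3}. X t)"
    proof cases
      case 1
      then have "p \<in> U" "b \<in> X p" using b by (auto simp: U_def X_def degenerate_def pairs_def)
      then show ?thesis by blast
    next
      case 2
      obtain t where "t \<subseteq> b \<inter> c" "card t = 3" using 2(2) by (meson obtain_subset_with_card_n)
      then have "t \<in> {t. t \<subseteq> c \<and> card t = 3}" "b \<in> X t" using b by (auto simp: X_def degenerate_def)
      then show ?thesis using 2(1) by blast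
    qed
  qed
  moreover have ft: "finite {t. t \<subseteq> c \<and> card t = 3}" if "c \<in> S" for c
    using packing_block[OF S(1) that] by auto
  ultimately have "card (degenerate n S k) \<le> card ((\<Union>p\<in>U. X p) \<union> (\<Union>c\<in>S. \<Union>t\<in>{t. t \<subseteq> c \<and> card t = 3}. X t))"
    using fX fS fU by (intro card_mono) auto
  also have "\<dots> \<le> card (\<Union>p\<in>U. X p) + card (\<Union>c\<in>S. \<Union>t\<in>{t. t \<subseteq> c \<and> card t = 3}. X t)" by (rule card_Un_le)
  also have "card (\<Union>p\<in>U. X p) \<le> (\<Sum>p\<in>U. card (X p))" by (rule card_UN_le[OF fU])
  also have "(\<Sum>p\<in>U. card (X p)) \<le> (\<Sum>p\<in>U. n ^ (k - 2))"
  proof (rule sum_mono)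
    fix p assume "p \<in> U"
    then have "p \<subseteq> {..<n}" "card p = 2" by (auto simp: U_def pairs_def)
    then show "card (X p) \<le> n ^ (k - 2)" using cX[of p] k by simp
  qed
  also have "card (\<Union>c\<in>S. \<Union>t\<in>{t. t \<subseteq> c \<and> card t = 3}. X t) \<le> (\<Sum>c\<in>S. card (\<Union>t\<in>{t. t \<subseteq> c \<and> card t = 3}. X t))"
    by (rule card_UN_le[OF fS])
  also have "\<dots> \<le> (\<Sum>c\<in>S. 4 * n ^ (k - 3))"
  proof (rule sum_mono)
    fix c assume c: "c \<in> S"
    have "card (\<Union>t\<in>{t. t \<subseteq> c \<and> card t = 3}. X t) \<le> (\<Sum>t\<in>{t. t \<subseteq> c \<and> card t = 3}. card (X t))"
      by (rule card_UN_le[OF ft[OF c]])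
    also have "\<dots> \<le> (\<Sum>t\<in>{t. t \<subseteq> c \<and> card t = 3}. n ^ (k - 3))"
    proof (rule sum_mono)
      fix t assume "t \<in> {t. t \<subseteq> c \<and> card t = 3}"
      then have "t \<subseteq> {..<n}" "card t = 3" using packing_block[OF S(1) c] by auto
      then show "card (X t) \<le> n ^ (k - 3)" using cX[of t] k by simp
    qed
    also have "\<dots> = (card c choose 3) * n ^ (k - 3)" using packing_block[OF S(1) c] by (simp add: n_subsets)
    also have "\<dots> \<le> 4 * n ^ (k - 3)"
    proof -
      have "card c = 3 \<or> card c = 4" using packing_block[OF S(1) c] S(2)[OF c] by linarith
      then have "card c choose 3 \<le> 4" by (auto simp: numeral_eq_Suc)
      then show ?thesis by (rule mult_right_mono) simp
    qed
    finally show "card (\<Union>t\<in>{t. t \<subseteq> c \<and> card t = 3}. X t) \<le> 4 * n ^ (k - 3)" .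
  qed
  finally show ?thesis by (simp add: U_def)
qed

definition mixed_packings :: "nat \<Rightarrow> nat \<Rightarrow> nat \<Rightarrow> nat set set set" where
  "mixed_packings n T Q = {S. packing n S \<and> (\<forall>b\<in>S. card b \<in> {3, 4}) \<and>
     card {b \<in> S. card b = 3} = T \<and> card {b \<in> S. card b = 4} = Q}"

lemma mixed_packing_sum:
  fixes f :: "nat \<Rightarrow> 'a :: comm_semiring_1"
  assumes S: "S \<in> mixed_packings n T Q"
  shows "(\<Sum>b\<in>S. f (card b)) = of_nat T * f 3 + of_nat Q * f 4"
proof -
  have P: "packing n S" and c34: "\<forall>b\<in>S. card b \<in> {3, 4}" and TQ: "card {b \<in> S. card b = 3} = T" "card {b \<in> S. card b = 4} = Q"
    using S by (auto simp: mixed_packings_def)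
  have fS: "finite S" by (rule packing_finite[OF P])
  have sp: "S = {b \<in> S. card b = 3} \<union> {b \<in> S. card b = 4}" using c34 by auto
  have "(\<Sum>b\<in>S. f (card b)) = (\<Sum>b | b \<in> S \<and> card b = 3. f (card b)) + (\<Sum>b | b \<in> S \<and> card b = 4. f (card b))"
    by (subst sp, rule sum.union_disjoint) (use fS in auto)
  then show ?thesis by (simp add: TQ)
qed

lemma mixed_packing_counts:
  assumes S: "S \<in> mixed_packings n T Q"
  shows "card S = T + Q"
    and "card {p \<in> pairs {..<n}. \<forall>c\<in>S. \<not> p \<subseteq> c} + (3 * T + 6 * Q) = n choose 2"
proof -
  have P: "packing n S" using S by (auto simp: mixed_packings_def)
  show "card S = T + Q" using mixed_packing_sum[OF S, of "\<lambda>_. 1 :: nat"] by simp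
  show "card {p \<in> pairs {..<n}. \<forall>c\<in>S. \<not> p \<subseteq> c} + (3 * T + 6 * Q) = n choose 2"
    using packing_pair_count[OF P] mixed_packing_sum[OF S, of "\<lambda>k. k choose 2"] by (simp add: choose_two)
qed

lemma ln_one_plus_power_le:
  fixes a :: real assumes "0 \<le> a" "0 < k" shows "ln (1 + a ^ k) \<le> k * a"
proof -
  have "1 + a ^ k \<le> (1 + a) ^ k" using assms(2)
  proof (induction k rule: nat_induct_non_zero)
    case (Suc k)
    have "1 + a ^ Suc k \<le> (1 + a) * (1 + a ^ k)" using assms(1) by (simp add: algebra_simps)
    also have "\<dots> \<le> (1 + a) * (1 + a) ^ k" using Suc assms(1) by (intro mult_left_mono) auto
    finally show ?case by simp
  qed simp
  then have "ln (1 + a ^ k) \<le> ln ((1 + a) ^ k)" using assms(1) by (subst ln_le_cancel_iff) (auto intro: add_pos_nonneg)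
  also have "\<dots> = k * ln (1 + a)" using assms(1) by (simp add: ln_realpow)
  also have "\<dots> \<le> k * a" using assms(1) by (intro mult_left_mono ln_add_one_self_le_self) auto
  finally show ?thesis .
qed

lemma sum_inverse_sqrt_le: "(\<Sum>i<m. 1 / sqrt (real (Suc i))) \<le> 2 * sqrt m"
proof (induction m)
  case (Suc m)
  define a b where "a = sqrt (real m)" and "b = sqrt (real (Suc m))"
  have ab: "0 \<le> a" "0 < b" "b * b = a * a + 1" "a \<le> b" by (auto simp: a_def b_def)
  have "1 / b \<le> 2 * (b - a)"
  proof -
    have "0 \<le> (b - a) * (b - a)" by simp
    then have "1 \<le> 2 * (b - a) * b" using ab by (simp add: algebra_simps)
    then show ?thesis using ab by (simp add: pos_divide_le_eq)
  qed
  then show ?case using Suc by (simp add: a_def b_def)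
qed simp

lemma sum_ln_Suc: "(\<Sum>i<m. ln (real (Suc i))) = ln (fact m)"
  by (induction m) (simp_all add: ln_mult add.commute)

lemma sum_ln_remaining:
  fixes M :: nat
  assumes "0 < M" shows "(\<Sum>i<M. ln ((real M - i) / M)) = ln (fact M) - M * ln M"
proof -
  have "(\<Sum>i<M. ln ((real M - i) / M)) = (\<Sum>i<M. ln (real (Suc (M - Suc i))) - ln M)"
    by (intro sum.cong refl) (auto simp: ln_div of_nat_diff)
  also have "\<dots> = (\<Sum>i<M. ln (real (Suc (M - Suc i)))) - M * ln M" by (simp add: sum_subtractf)
  also have "(\<Sum>i<M. ln (real (Suc (M - Suc i)))) = ln (fact M)"
    using sum.nat_diff_reindex[of "\<lambda>i. ln (real (Suc i))" M] sum_ln_Suc[of M] by simp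
  finally show ?thesis .
qed

text \<open>Shows that the error terms \<open>\<eta> / sqrt \<rho>\<close>, which blow up towards the end of the list, are harmless on
  average.\<close>
lemma sum_inverse_sqrt_remaining:
  fixes M :: nat
  assumes "0 < M" shows "(\<Sum>i<M. 1 / sqrt ((real M - i) / M)) \<le> 2 * M"
proof -
  have "(\<Sum>i<M. 1 / sqrt ((real M - i) / M)) = (\<Sum>i<M. sqrt M * (1 / sqrt (real (Suc (M - Suc i)))))"
    by (intro sum.cong refl) (auto simp: real_sqrt_divide of_nat_diff)
  also have "\<dots> = sqrt M * (\<Sum>i<M. 1 / sqrt (real (Suc (M - Suc i))))" by (simp add: sum_distrib_left)
  also have "(\<Sum>i<M. 1 / sqrt (real (Suc (M - Suc i)))) \<le> 2 * sqrt M"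
    using sum.nat_diff_reindex[of "\<lambda>i. 1 / sqrt (real (Suc i))" M] sum_inverse_sqrt_le[of M] by simp
  also have "sqrt M * (2 * sqrt M) = 2 * real M" by (simp add: mult.left_commute)
  finally show ?thesis by (simp add: mult_left_mono)
qed

text \<open>A set \<open>b\<close> is available after \<open>i\<close> steps if none of the blocks that touch it is among the first \<open>i\<close>. A
  set that is not degenerate is touched by at least as many blocks as it has pairs, which gives the
  exponents 3 and 6.\<close>
lemma average_available_weight_le:
  fixes a\<^sub>3 a\<^sub>4 :: real and n :: nat
  defines "B \<equiv> {b. b \<subseteq> {..<n} \<and> card b \<in> {3, 4}}" and "ok \<equiv> \<lambda>R b. \<forall>c\<in>R. card (b \<inter> c) \<le> 1"
    and "w \<equiv> \<lambda>b :: nat set. if card b = 3 then a\<^sub>3 else a\<^sub>4"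
  assumes S: "S \<in> mixed_packings n T Q" and i: "i < T + Q" and a: "0 \<le> a\<^sub>3" "0 \<le> a\<^sub>4"
    and d: "card (degenerate n S 3) \<le> \<delta> * real n ^ 3" "card (degenerate n S 4) \<le> \<delta> * real n ^ 4"
  defines "\<rho> \<equiv> (real (T + Q) - i) / real (T + Q)"
  shows "(\<Sum>xs\<in>permutations_of_set S. available_weight B ok w (set (take i xs))) \<le>
     fact (T + Q) * (a\<^sub>3 * (real n ^ 3 / 6 * \<rho> ^ 3 + \<delta> * real n ^ 3) + a\<^sub>4 * (real n ^ 4 / 24 * \<rho> ^ 6 + \<delta> * real n ^ 4))"
proof -
  have P: "packing n S" using S by (auto simp: mixed_packings_def)
  have fS: "finite S" by (rule packing_finite[OF P])
  have cS: "card S = T + Q" by (rule mixed_packing_counts(1)[OF S])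
  have \<rho>: "0 \<le> \<rho>" "\<rho> \<le> 1" using i by (auto simp: \<rho>_def field_simps)
  have fB: "finite B" unfolding B_def by (rule finite_subset[of _ "Pow {..<n}"]) auto
  define q where "q = (\<lambda>b. \<Sum>xs\<in>permutations_of_set S. of_bool (ok (set (take i xs)) b) :: real)"
  have q: "q b \<le> \<rho> ^ card (touching S b) * fact (T + Q)" if "b \<in> B" for b
  proof -
    have "q b = real (card {xs \<in> permutations_of_set S. ok (set (take i xs)) b})" by (simp add: q_def Collect_conj_eq)
    also have "{xs \<in> permutations_of_set S. ok (set (take i xs)) b} \<subseteq> {xs \<in> permutations_of_set S. touching S b \<inter> set (take i xs) = {}}"
      by (auto simp: ok_def touching_def)
    then have "real (card {xs \<in> permutations_of_set S. ok (set (take i xs)) b}) \<le>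
        real (card {xs \<in> permutations_of_set S. touching S b \<inter> set (take i xs) = {}})"
      by (intro of_nat_mono card_mono) auto
    also have "\<dots> \<le> \<rho> ^ card (touching S b) * fact (T + Q)"
      using card_permutations_avoiding[OF fS, of "touching S b" i] i cS by (auto simp: touching_def \<rho>_def)
    finally show ?thesis .
  qed
  have q1: "q b \<le> (if b \<in> degenerate n S (card b) then 1 else \<rho> ^ (card b choose 2)) * fact (T + Q)" if b: "b \<in> B" for b
  proof (rule order_trans[OF q[OF b]], rule mult_right_mono)
    show "\<rho> ^ card (touching S b) \<le> (if b \<in> degenerate n S (card b) then 1 else \<rho> ^ (card b choose 2))"
    proof (cases "b \<in> degenerate n S (card b)")
      case True then show ?thesis using \<rho> by (simp add: power_le_one)
    next
      case False
      have "card b choose 2 \<le> card (touching S b)"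
      proof (rule card_touching_ge[OF _ fS])
        show "finite b" using b by (auto simp: B_def intro: finite_subset)
        show "\<exists>c\<in>S. p \<subseteq> c" if "p \<in> pairs b" for p using False b that by (auto simp: degenerate_def B_def)
        show "card (b \<inter> c) \<le> 2" if "c \<in> S" for c
        proof (rule ccontr)
          assume "\<not> card (b \<inter> c) \<le> 2"
          then have "3 \<le> card (b \<inter> c)" by simp
          then show False using False b that by (auto simp: degenerate_def B_def)
        qed
      qed
      then show ?thesis using False \<rho> by (simp add: power_decreasing)
    qed
  qed simp
  have half: "(\<Sum>b | b \<subseteq> {..<n} \<and> card b = k. q b) \<le> fact (T + Q) * (real n ^ k / fact k * \<rho> ^ (k choose 2) + \<delta> * real n ^ k)"
    if k: "k \<in> {3, 4}" for k
  proof -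
    have fk: "finite {b. b \<subseteq> {..<n} \<and> card b = k}" by (rule finite_subset[of _ "Pow {..<n}"]) auto
    have "(\<Sum>b | b \<subseteq> {..<n} \<and> card b = k. q b) \<le>
       (\<Sum>b | b \<subseteq> {..<n} \<and> card b = k. (of_bool (b \<in> degenerate n S k) + \<rho> ^ (k choose 2)) * fact (T + Q))"
    proof (rule sum_mono)
      fix b assume "b \<in> {b. b \<subseteq> {..<n} \<and> card b = k}"
      then have b: "b \<in> B" "card b = k" using k by (auto simp: B_def)
      show "q b \<le> (of_bool (b \<in> degenerate n S k) + \<rho> ^ (k choose 2)) * fact (T + Q)"
        by (rule order_trans[OF q1[OF b(1)]], rule mult_right_mono) (use b \<rho> in auto)
    qed
    also have "\<dots> = (real (card ({b. b \<subseteq> {..<n} \<and> card b = k} \<inter> degenerate n S k)) + real (n choose k) * \<rho> ^ (k choose 2)) * fact (T + Q)"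
      using fk by (simp add: sum_distrib_right[symmetric] sum.distrib n_subsets)
    also have "{b. b \<subseteq> {..<n} \<and> card b = k} \<inter> degenerate n S k = degenerate n S k" by (auto simp: degenerate_def)
    also have "(real (card (degenerate n S k)) + real (n choose k) * \<rho> ^ (k choose 2)) * fact (T + Q) \<le>
        (\<delta> * real n ^ k + real n ^ k / fact k * \<rho> ^ (k choose 2)) * fact (T + Q)"
    proof (intro mult_right_mono add_mono)
      show "real (card (degenerate n S k)) \<le> \<delta> * real n ^ k" using k d by auto
      have "real (n choose k) * fact k \<le> real n ^ k"
        using binomial_fact_lemma[of k n] by (metis binomial_fact_pow of_nat_fact of_nat_le_iff of_nat_mult of_nat_power)
      then show "real (n choose k) \<le> real n ^ k / fact k" by (simp add: field_simps)
    qed (use \<rho> in auto)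
    finally show ?thesis by (simp add: algebra_simps)
  qed
  have "(\<Sum>xs\<in>permutations_of_set S. available_weight B ok w (set (take i xs))) =
     (\<Sum>xs\<in>permutations_of_set S. \<Sum>b\<in>B. w b * of_bool (ok (set (take i xs)) b))"
  proof (intro sum.cong refl)
    fix xs
    have "available_weight B ok w R = (\<Sum>b\<in>B. if ok R b then w b else 0)" for R
      unfolding available_weight_def by (rule sum.inter_filter[OF fB])
    also have "(\<Sum>b\<in>B. if ok R b then w b else 0) = (\<Sum>b\<in>B. w b * of_bool (ok R b))" for R
      by (intro sum.cong refl) simp
    finally show "available_weight B ok w (set (take i xs)) = (\<Sum>b\<in>B. w b * of_bool (ok (set (take i xs)) b))" .
  qed
  also have "\<dots> = (\<Sum>b\<in>B. w b * q b)" unfolding q_def sum_distrib_left by (rule sum.swap)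
  also have "\<dots> = (\<Sum>b | b \<subseteq> {..<n} \<and> card b = 3. w b * q b) + (\<Sum>b | b \<subseteq> {..<n} \<and> card b = 4. w b * q b)"
  proof -
    have "B = {b. b \<subseteq> {..<n} \<and> card b = 3} \<union> {b. b \<subseteq> {..<n} \<and> card b = 4}" by (auto simp: B_def)
    moreover have "finite {b. b \<subseteq> {..<n} \<and> card b = k}" for k by (rule finite_subset[of _ "Pow {..<n}"]) auto
    ultimately show ?thesis by (simp add: sum.union_disjoint disjoint_iff)
  qed
  also have "\<dots> = a\<^sub>3 * (\<Sum>b | b \<subseteq> {..<n} \<and> card b = 3. q b) + a\<^sub>4 * (\<Sum>b | b \<subseteq> {..<n} \<and> card b = 4. q b)"
    unfolding sum_distrib_left by (intro arg_cong2[where f = "(+)"] sum.cong refl) (auto simp: w_def)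
  also have "\<dots> \<le> a\<^sub>3 * (fact (T + Q) * (real n ^ 3 / fact 3 * \<rho> ^ (3 choose 2) + \<delta> * real n ^ 3)) +
     a\<^sub>4 * (fact (T + Q) * (real n ^ 4 / fact 4 * \<rho> ^ (4 choose 2) + \<delta> * real n ^ 4))"
    using half[of 3] half[of 4] a by (intro add_mono mult_left_mono) auto
  also have "\<dots> = fact (T + Q) * (a\<^sub>3 * (real n ^ 3 / 6 * \<rho> ^ 3 + \<delta> * real n ^ 3) + a\<^sub>4 * (real n ^ 4 / 24 * \<rho> ^ 6 + \<delta> * real n ^ 4))"
    by (simp add: choose_two fact_numeral algebra_simps)
  finally show ?thesis .
qed

text \<open>Quadruples have their weight multiplied by $\rho^{-3}$, so that they are drawn with
  a constant probability throughout the process, as in a random order. The formula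
  obtained in this way depends on \<open>T\<close> and \<open>Q\<close> through $-M \ln M$, where $M = T + Q$; replacing this by
  its tangent at the optimal value \<open>X\<close> of \<open>M\<close>, and fixing the probabilities \<open>\<alpha>\<close> and \<open>\<beta>\<close> of the
  two kinds of blocks at their optimal values, leaves a bound that is linear in \<open>T + 2 * Q\<close>.\<close>
theorem card_mixed_packings_le:
  fixes \<eta> \<delta> :: real
  assumes n: "1 \<le> n" "2 / \<delta> \<le> n" and \<eta>: "0 < \<eta>" and \<delta>: "\<delta> = \<eta> ^ 12 / 24"
    and gap: "real (n choose 2) - (3 * T + 6 * Q) \<le> \<delta> * (real n)\<^sup>2 / 2" and M: "0 < T + Q"
  shows "card (mixed_packings n T Q) \<le>
     exp ((T + 2 * real Q) * (ln n + ln ((1 + sqrt 3) / 2) - 3) + sqrt 3 / 12 * (real n)\<^sup>2 + 6 * (1 + 2 * ln n) + 4 * \<eta> * (real n)\<^sup>2)"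
proof (cases "mixed_packings n T Q = {}")
  case True then show ?thesis by simp
next
  case False
  define m where "m = T + Q"
  \<comment> \<open>The optimal fraction of the pairs that lie in quadruples.\<close>
  define p where "p = 2 - sqrt (3::real)"
  have sq: "sqrt 3 * sqrt 3 = (3::real)" "1 < sqrt (3::real)" "sqrt (3::real) < 2" by (auto intro: real_less_lsqrt)
  have p: "0 < p" "p < 1" "2 * p = (1 - p)\<^sup>2" "(1 + sqrt 3) / 2 = 1 / (1 - p)"
    using sq by (auto simp: p_def power2_eq_square field_simps)
  define \<alpha> where "\<alpha> = (1 - p) / (1 - p / 2)"
  define \<beta> where "\<beta> = (p / 2) / (1 - p / 2)"
  have \<alpha>\<beta>: "0 < \<alpha>" "0 < \<beta>" "\<alpha> + \<beta> = 1"
  proof -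
    show "0 < \<alpha>" "0 < \<beta>" using p(1,2) by (auto simp: \<alpha>_def \<beta>_def)
    have "\<alpha> + \<beta> = (1 - p + p / 2) / (1 - p / 2)" unfolding \<alpha>_def \<beta>_def by (rule add_divide_distrib[symmetric])
    then show "\<alpha> + \<beta> = 1" using p(2) by simp
  qed
  have \<delta>0: "0 < \<delta>" unfolding \<delta> using \<eta> by simp
  have n0: "0 < real n" using n by simp
  define \<rho> where "\<rho> = (\<lambda>i::nat. (real m - i) / m)"
  have m0: "0 < real m" unfolding m_def using M by (simp only: of_nat_0_less_iff)
  have \<rho>: "0 < \<rho> i" "\<rho> i \<le> 1" if "i < m" for i using that by (auto simp: \<rho>_def)
  have deg: "card (degenerate n S 3) \<le> \<delta> * real n ^ 3 \<and> card (degenerate n S 4) \<le> \<delta> * real n ^ 4 \<and> 6 * real m \<le> (real n)\<^sup>2"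
    if S: "S \<in> mixed_packings n T Q" for S
  proof -
    define u where "u = card {p \<in> pairs {..<n}. \<forall>c\<in>S. \<not> p \<subseteq> c}"
    have P: "packing n S" "\<And>c. c \<in> S \<Longrightarrow> card c \<le> 4" using S by (auto simp: mixed_packings_def)
    have "real (u + (3 * T + 6 * Q)) = real (n choose 2)" using mixed_packing_counts(2)[OF S] by (simp add: u_def)
    then have u: "real u + (3 * T + 6 * Q) = real n * (real n - 1) / 2" "real u \<le> \<delta> * (real n)\<^sup>2 / 2"
      using gap by (simp_all add: real_choose_2)
    have m6: "6 * real m \<le> (real n)\<^sup>2"
    proof -
      have "real n * (real n - 1) \<le> (real n)\<^sup>2" by (simp add: power2_eq_square algebra_simps)
      then show ?thesis using u(1) by (simp add: m_def)
    qed
    have n2: "(real n)\<^sup>2 \<le> \<delta> * real n ^ 3 / 2"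
    proof -
      have "2 \<le> \<delta> * n" using n(2) \<delta>0 by (simp add: field_simps)
      then have "(real n)\<^sup>2 * 2 \<le> (real n)\<^sup>2 * (\<delta> * n)" by (intro mult_left_mono) auto
      then show ?thesis by (simp add: power2_eq_square power3_eq_cube algebra_simps)
    qed
    have "real (card (degenerate n S 3)) \<le> real (u * n ^ 1 + card S * (4 * n ^ 0))"
      using card_degenerate_le[OF P, of 3] unfolding u_def by (intro of_nat_mono) simp
    also have "\<dots> = u * real n + 4 * real m" using mixed_packing_counts(1)[OF S] by (simp add: m_def)
    also have "u * real n \<le> \<delta> * (real n)\<^sup>2 / 2 * real n" using u(2) by (intro mult_right_mono) auto
    finally have d3: "card (degenerate n S 3) \<le> \<delta> * real n ^ 3" using n2 m6 by (simp add: power2_eq_square power3_eq_cube)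
    have "real (card (degenerate n S 4)) \<le> real (u * n ^ 2 + card S * (4 * n ^ 1))"
      using card_degenerate_le[OF P, of 4] unfolding u_def by (intro of_nat_mono) simp
    also have "\<dots> = u * (real n)\<^sup>2 + 4 * real m * n" using mixed_packing_counts(1)[OF S] by (simp add: m_def)
    also have "u * (real n)\<^sup>2 \<le> \<delta> * (real n)\<^sup>2 / 2 * (real n)\<^sup>2" using u(2) by (intro mult_right_mono) auto
    also have "4 * real m * n \<le> (\<delta> * real n ^ 3 / 2) * n" using n2 m6 by (intro mult_right_mono) auto
    finally have d4: "card (degenerate n S 4) \<le> \<delta> * real n ^ 4" by (simp add: power2_eq_square power3_eq_cube power4_eq_xxxx)
    show ?thesis using d3 d4 m6 by simp
  qed
  define a3 where "a3 = \<alpha> * 6 / real n ^ 3"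
  define a4 where "a4 = (\<lambda>i. \<beta> * 24 / real n ^ 4 / \<rho> i ^ 3)"
  define B where "B = {b. b \<subseteq> {..<n} \<and> card b \<in> {3, 4}}"
  define ok where "ok = (\<lambda>R (b :: nat set). \<forall>c\<in>R. card (b \<inter> c) \<le> 1)"
  define w where "w = (\<lambda>i (b :: nat set). if card b = 3 then a3 else a4 i)"
  define z where "z = (\<lambda>i. \<rho> i ^ 3 + 24 * \<delta> / \<rho> i ^ 3)"
  define L where "L = (\<Sum>i<m. ln (\<rho> i))"
  define G where "G = T * - ln a3 + Q * - ln (\<beta> * 24 / real n ^ 4) + 3 * Q / m * L"
  have a3: "0 < a3" using \<alpha>\<beta> n0 by (simp add: a3_def)
  have a4: "0 < a4 i" if "i < m" for i using \<alpha>\<beta> n0 \<rho>[OF that] by (simp add: a4_def)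
  have "card (mixed_packings n T Q) * fact m \<le> exp ((\<Sum>i<m. ln (z i)) + G)"
  proof (rule card_times_fact_le[where B = B and ok = ok and w = w])
    show "finite B" unfolding B_def by (rule finite_subset[of _ "Pow {..<n}"]) auto
    show "finite (mixed_packings n T Q)" unfolding mixed_packings_def by (rule finite_packings)
    show "S \<subseteq> B \<and> card S = m" if "S \<in> mixed_packings n T Q" for S
      using mixed_packing_counts(1)[OF that] that by (auto simp: m_def B_def mixed_packings_def packing_def)
    show "ok R b" if "S \<in> mixed_packings n T Q" "R \<subseteq> S" "b \<in> S - R" for S R b
      unfolding ok_def
    proof
      fix c assume "c \<in> R"
      then have "c \<in> S" "b \<in> S" "b \<noteq> c" using that by auto
      moreover have "packing n S" using that(1) by (simp add: mixed_packings_def)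
      ultimately show "card (b \<inter> c) \<le> 1" unfolding packing_def by blast
    qed
    show "0 < w i b" if "i < m" for i b using a3 a4[OF that] by (simp add: w_def)
    show "0 < z i" if "i < m" for i using \<rho>[OF that] \<delta>0 by (simp add: z_def add_pos_pos)
    show "(\<Sum>xs\<in>permutations_of_set S. available_weight B ok (w i) (set (take i xs))) \<le> fact m * z i"
      if S: "S \<in> mixed_packings n T Q" and i: "i < m" for S i
    proof -
      have "(\<Sum>xs\<in>permutations_of_set S. available_weight B ok (w i) (set (take i xs))) \<le>
        fact m * (a3 * (real n ^ 3 / 6 * \<rho> i ^ 3 + \<delta> * real n ^ 3) + a4 i * (real n ^ 4 / 24 * \<rho> i ^ 6 + \<delta> * real n ^ 4))"
        using average_available_weight_le[OF S, of i a3 "a4 i" \<delta>] i a3 a4[OF i] deg[OF S]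
        unfolding B_def ok_def w_def m_def \<rho>_def by simp
      also have "a3 * (real n ^ 3 / 6 * \<rho> i ^ 3 + \<delta> * real n ^ 3) = \<alpha> * \<rho> i ^ 3 + \<alpha> * 6 * \<delta>"
        using n0 by (simp add: a3_def field_simps)
      also have "a4 i * (real n ^ 4 / 24 * \<rho> i ^ 6 + \<delta> * real n ^ 4) = \<beta> * \<rho> i ^ 3 + \<beta> * 24 * \<delta> / \<rho> i ^ 3"
        using n0 \<rho>[OF i] power_add[of "\<rho> i" 3 3] by (simp add: a4_def field_simps)
      also have "\<alpha> * \<rho> i ^ 3 + \<alpha> * 6 * \<delta> + (\<beta> * \<rho> i ^ 3 + \<beta> * 24 * \<delta> / \<rho> i ^ 3) \<le> z i"
      proof -
        have r: "0 < \<rho> i ^ 3" "\<rho> i ^ 3 \<le> 1" using \<rho>[OF i] by (auto simp: power_le_one)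
        have "\<alpha> * 6 * \<delta> \<le> \<alpha> * 24 * \<delta> / 1" using \<alpha>\<beta> \<delta>0 by simp
        also have "\<dots> \<le> \<alpha> * 24 * \<delta> / \<rho> i ^ 3" using \<alpha>\<beta> \<delta>0 r by (intro divide_left_mono) auto
        finally have "\<alpha> * \<rho> i ^ 3 + \<alpha> * 6 * \<delta> + (\<beta> * \<rho> i ^ 3 + \<beta> * 24 * \<delta> / \<rho> i ^ 3) \<le>
            (\<alpha> + \<beta>) * \<rho> i ^ 3 + (\<alpha> + \<beta>) * (24 * \<delta>) / \<rho> i ^ 3" by (simp add: distrib_right add_divide_distrib mult.assoc)
        then show ?thesis by (simp add: \<alpha>\<beta>(3) z_def)
      qed
      finally show ?thesis by simp
    qed
    show "(\<Sum>xs\<in>permutations_of_set S. \<Sum>i<m. - ln (w i (xs ! i))) \<le> fact m * G" if S: "S \<in> mixed_packings n T Q" for S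
    proof -
      have fS: "finite S" using S packing_finite by (auto simp: mixed_packings_def)
      have cS: "card S = m" using mixed_packing_counts(1)[OF S] by (simp add: m_def)
      define b4 where "b4 = - ln (\<beta> * 24 / real n ^ 4)"
      have "(\<Sum>xs\<in>permutations_of_set S. \<Sum>i<m. - ln (w i (xs ! i))) = (\<Sum>i<m. \<Sum>xs\<in>permutations_of_set S. - ln (w i (xs ! i)))"
        by (rule sum.swap)
      also have "\<dots> = (\<Sum>i<m. fact (m - 1) * (T * - ln a3 + Q * (b4 + 3 * ln (\<rho> i))))"
      proof (rule sum.cong[OF refl])
        fix i assume "i \<in> {..<m}"
        then have i: "i < m" by simp
        have "(\<Sum>xs\<in>permutations_of_set S. - ln (w i (xs ! i))) = fact (m - 1) * (\<Sum>b\<in>S. - ln (w i b))"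
          using sum_permutations_nth[OF fS, of i "\<lambda>b. - ln (w i b)"] i cS by simp
        also have "(\<Sum>b\<in>S. - ln (w i b)) = T * - ln a3 + Q * - ln (a4 i)"
          using mixed_packing_sum[OF S, of "\<lambda>k. - ln (if k = 3 then a3 else a4 i)"] by (simp add: w_def)
        also have "- ln (a4 i) = b4 + 3 * ln (\<rho> i)"
        proof -
          have "0 < \<beta> * 24 / real n ^ 4" "0 < \<rho> i ^ 3" using \<alpha>\<beta> n0 \<rho>[OF i] by simp_all
          then have "ln (a4 i) = ln (\<beta> * 24 / real n ^ 4) - ln (\<rho> i ^ 3)" unfolding a4_def by (rule ln_divide_pos)
          then show ?thesis using \<rho>[OF i] by (simp add: b4_def ln_realpow)
        qed
        finally show "(\<Sum>xs\<in>permutations_of_set S. - ln (w i (xs ! i))) = fact (m - 1) * (T * - ln a3 + Q * (b4 + 3 * ln (\<rho> i)))" .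
      qed
      also have "\<dots> = fact (m - 1) * (m * (T * - ln a3 + Q * b4) + 3 * Q * L)"
      proof -
        have "(\<Sum>i<m. T * - ln a3 + Q * (b4 + 3 * ln (\<rho> i))) = m * (T * - ln a3 + Q * b4) + 3 * Q * L"
        proof -
          have "(\<Sum>i<m. T * - ln a3 + Q * (b4 + 3 * ln (\<rho> i))) = (\<Sum>i<m. (T * - ln a3 + Q * b4) + (3 * Q) * ln (\<rho> i))"
            by (intro sum.cong refl) (simp add: algebra_simps)
          also have "\<dots> = (\<Sum>i<m. T * - ln a3 + Q * b4) + 3 * Q * L"
            unfolding L_def sum.distrib sum_distrib_left ..
          finally show ?thesis by simp
        qed
        then show ?thesis by (simp only: sum_distrib_left[symmetric])
      qed
      also have "\<dots> = (real m * fact (m - 1)) * (T * - ln a3 + Q * b4 + 3 * Q / m * L)" using m0 by (simp add: field_simps)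
      also have "\<dots> = fact m * G" using m0 by (simp add: G_def b4_def fact_reduce)
      finally show ?thesis by simp
    qed
  qed
  moreover have "(\<Sum>i<m. ln (z i)) \<le> 3 * L + 24 * \<eta> * m"
  proof -
    \<comment> \<open>The twelfth power in $24 \delta = \eta^{12}$ turns $\ln (1 + 24 \delta \rho^{-6})$ into a summable error.\<close>
    have "ln (z i) \<le> 3 * ln (\<rho> i) + 12 * \<eta> * (1 / sqrt (\<rho> i))" if i: "i < m" for i
    proof -
      have r: "0 < \<rho> i" using \<rho>[OF i] by simp
      have "sqrt (\<rho> i) ^ 12 = (sqrt (\<rho> i) ^ 2) ^ 6" by (simp only: power_mult[symmetric]) simp
      then have s: "sqrt (\<rho> i) ^ 12 = \<rho> i ^ 6" using r by simp
      have "z i = \<rho> i ^ 3 * (1 + (\<eta> / sqrt (\<rho> i)) ^ 12)"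
        using r power_add[of "\<rho> i" 3 3] unfolding power_divide s by (simp add: z_def \<delta> field_simps)
      then have "ln (z i) = ln (\<rho> i ^ 3) + ln (1 + (\<eta> / sqrt (\<rho> i)) ^ 12)" using r \<eta>
        by (simp add: ln_mult_pos add_pos_nonneg)
      also have "ln (1 + (\<eta> / sqrt (\<rho> i)) ^ 12) \<le> 12 * (\<eta> / sqrt (\<rho> i))"
        using ln_one_plus_power_le[of "\<eta> / sqrt (\<rho> i)" 12] \<eta> r by simp
      finally show ?thesis using r by (simp add: ln_realpow)
    qed
    then have "(\<Sum>i<m. ln (z i)) \<le> (\<Sum>i<m. 3 * ln (\<rho> i) + 12 * \<eta> * (1 / sqrt (\<rho> i)))" by (intro sum_mono) auto
    also have "\<dots> = 3 * L + 12 * \<eta> * (\<Sum>i<m. 1 / sqrt (\<rho> i))" by (simp add: L_def sum.distrib sum_distrib_left)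
    also have "\<dots> \<le> 3 * L + 12 * \<eta> * (2 * m)"
      using sum_inverse_sqrt_remaining[of m] m0 \<eta> by (intro add_left_mono mult_left_mono) (auto simp: \<rho>_def)
    finally show ?thesis by simp
  qed
  ultimately have e: "card (mixed_packings n T Q) * fact m \<le> exp (3 * L + 24 * \<eta> * m + G)"
    by (smt (verit) exp_le_cancel_iff)
  have L1: "L = ln (fact m) - m * ln m" unfolding L_def \<rho>_def using m0 by (intro sum_ln_remaining) simp
  have L2: "L \<le> - real m + ln m + 1" unfolding L1 using ln_fact_le[of m] m0 by simp
  obtain S where S: "S \<in> mixed_packings n T Q" using False by blast
  have m6: "6 * real m \<le> (real n)\<^sup>2" using deg[OF S] by simp
  define X where "X = (real n)\<^sup>2 / 6 * (1 - p / 2)"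
  have X: "0 < X" using n0 p by (simp add: X_def)
  \<comment> \<open>Tangent of the convex function $m \ln m$ at $X$.\<close>
  have lf: "- ln (fact m) \<le> X - m * ln X"
  proof -
    have "real m ^ m \<le> exp m * fact m" by (rule power_le_exp_fact)
    then have "ln (real m ^ m) \<le> ln (exp m * fact m)" using m0 by (subst ln_le_cancel_iff) auto
    then have "m * ln m \<le> m + ln (fact m)" using m0 by (simp add: ln_mult ln_realpow)
    moreover have "m * ln (X / m) \<le> m * (X / m - 1)" using X m0 by (intro mult_left_mono ln_le_minus_one) auto
    then have "m * ln X - m * ln m \<le> X - m" using X m0 by (simp add: ln_div algebra_simps)
    ultimately show ?thesis by simp
  qed
  define \<Lambda> where "\<Lambda> = ln ((1 + sqrt 3) / 2)"
  have \<Lambda>: "\<Lambda> = - ln (1 - p)" unfolding \<Lambda>_def p(4) using p by (simp add: ln_div)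
  have t3: "- ln a3 - ln X = ln n + \<Lambda>"
  proof -
    have "a3 * X = (1 - p) / n" using p n0 by (simp add: a3_def \<alpha>_def X_def field_simps power2_eq_square power3_eq_cube)
    then have "ln a3 + ln X = ln ((1 - p) / n)" using a3 X by (metis ln_mult_pos)
    then show ?thesis using p n0 by (simp add: ln_div \<Lambda>)
  qed
  have t4: "- ln (\<beta> * 24 / real n ^ 4) - ln X = 2 * (ln n + \<Lambda>)"
  proof -
    have "\<beta> * 24 / real n ^ 4 * X = 2 * p / (real n)\<^sup>2" using p(1,2) n0 by (simp add: \<beta>_def X_def field_simps power2_eq_square power4_eq_xxxx)
    also have "\<dots> = ((1 - p) / n)\<^sup>2" by (simp add: p(3) power_divide)
    finally have "\<beta> * 24 / real n ^ 4 * X = ((1 - p) / n)\<^sup>2" .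
    moreover have "0 < \<beta> * 24 / real n ^ 4" using \<alpha>\<beta> n0 by simp
    ultimately have "ln (\<beta> * 24 / real n ^ 4) + ln X = ln (((1 - p) / n)\<^sup>2)" using X by (metis ln_mult_pos)
    also have "\<dots> = 2 * ln ((1 - p) / n)" using p n0 by (simp add: ln_realpow)
    finally show ?thesis using p n0 by (simp add: ln_div \<Lambda>)
  qed
  have X3: "X = sqrt 3 / 12 * (real n)\<^sup>2" by (simp add: X_def p_def field_simps)
  have lm: "ln m \<le> 2 * ln n"
  proof -
    have "real m \<le> (real n)\<^sup>2" using m6 m0 by linarith
    then have "ln m \<le> ln ((real n)\<^sup>2)" using m0 n0 by (subst ln_le_cancel_iff) auto
    then show ?thesis using n0 by (simp add: ln_realpow)
  qed
  have mT: "real m = T + real Q" by (simp add: m_def)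
  have final: "3 * L + 24 * \<eta> * m + G - ln (fact m) \<le>
      (T + 2 * real Q) * (ln n + \<Lambda> - 3) + sqrt 3 / 12 * (real n)\<^sup>2 + 6 * (1 + 2 * ln n) + 4 * \<eta> * (real n)\<^sup>2"
  proof -
    define qm where "qm = Q / real m"
    have qm: "0 \<le> qm" "qm \<le> 1" "qm * m = Q" using m0 mT by (auto simp: qm_def)
    have "3 * (1 + qm) * L \<le> 3 * (1 + qm) * (- real m + ln m + 1)" using L2 qm by (intro mult_left_mono) auto
    also have "\<dots> = - 3 * (T + 2 * real Q) + 3 * (1 + qm) * (1 + ln m)" using qm(3) mT by (simp add: algebra_simps)
    also have "3 * (1 + qm) * (1 + ln m) \<le> 6 * (1 + ln m)" using qm m0 M by (intro mult_right_mono) (auto simp: m_def)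
    finally have 1: "3 * L + 3 * qm * L \<le> - 3 * (T + 2 * real Q) + 6 * (1 + ln m)" by (simp add: algebra_simps)
    have 2: "G - 3 * qm * L + (X - m * ln X) = (T + 2 * real Q) * (ln n + \<Lambda>) + X"
    proof -
      have "G - 3 * qm * L + (X - m * ln X) = T * (- ln a3 - ln X) + Q * (- ln (\<beta> * 24 / real n ^ 4) - ln X) + X"
        by (simp add: G_def qm_def mT algebra_simps)
      then show ?thesis unfolding t3 t4 by (simp add: algebra_simps)
    qed
    have 3: "24 * \<eta> * m \<le> 4 * \<eta> * (real n)\<^sup>2" using mult_left_mono[OF m6, of "4 * \<eta>"] \<eta> by simp
    have "(T + 2 * real Q) * (ln n + \<Lambda> - 3) = (T + 2 * real Q) * (ln n + \<Lambda>) - 3 * (T + 2 * real Q)" by (simp add: algebra_simps)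
    moreover have "a + b + g - f \<le> d + x + 6 * (1 + v) + e"
      if "d = c - k" "a + ql \<le> - 3 * k' + 6 * (1 + u)" "k = 3 * k'" "g - ql + (x - xx) = c + x" "b \<le> e" "- f \<le> x - xx" "u \<le> v"
      for a b c d e f g k k' x xx ql u v :: real
    proof -
      have g: "g = c + ql + xx" using that(4) by simp
      have aq: "a + ql \<le> - 3 * k' + 6 * (1 + v)"
        by (rule order_trans[OF that(2)]) (simp add: that(7))
      have "a + b + g - f = (a + ql) + b + c + (xx + - f)" by (simp add: g)
      also have "\<dots> \<le> (- 3 * k' + 6 * (1 + v)) + e + c + (xx + (x - xx))"
        by (rule add_mono[OF add_mono[OF add_mono[OF aq that(5)] order_refl] add_left_mono[OF that(6)]])
      also have "\<dots> = d + x + 6 * (1 + v) + e" using that(1,3) by simp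
      finally show ?thesis .
    qed
    ultimately show ?thesis using 1 2 3 lf lm X3 by blast
  qed
  have "real (card (mixed_packings n T Q)) \<le> exp (3 * L + 24 * \<eta> * m + G) / fact m"
    using e by (simp add: pos_le_divide_eq)
  also have "\<dots> = exp (3 * L + 24 * \<eta> * m + G - ln (fact m))" by (simp add: exp_diff)
  also have "\<dots> \<le> exp ((T + 2 * real Q) * (ln n + \<Lambda> - 3) + sqrt 3 / 12 * (real n)\<^sup>2 + 6 * (1 + 2 * ln n) + 4 * \<eta> * (real n)\<^sup>2)"
    using final by simp
  finally show ?thesis by (simp add: \<Lambda>_def)
qed

section \<open>Packings with large blocks\<close>

lemma card_single_valued_le:
  assumes "finite A" "finite B"
  shows "card {C. C \<subseteq> A \<times> B \<and> single_valued C \<and> card C = s} \<le> (card A choose s) * card B ^ s"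
proof -
  \<comment> \<open>A single-valued relation is a domain together with a function on it.\<close>
  define f where "f = (\<lambda>C :: ('a \<times> 'b) set. (Domain C, restrict (\<lambda>p. THE s. (p, s) \<in> C) (Domain C)))"
  have val: "(THE s. (p, s) \<in> C) = s" if "single_valued C" "(p, s) \<in> C" for C :: "('a \<times> 'b) set" and p s
    using that by (auto simp: single_valued_def)
  have "card {C. C \<subseteq> A \<times> B \<and> single_valued C \<and> card C = s} \<le> card (SIGMA X:{X. X \<subseteq> A \<and> card X = s}. X \<rightarrow>\<^sub>E B)"
  proof (rule card_inj_on_le[of f])
    show "inj_on f {C. C \<subseteq> A \<times> B \<and> single_valued C \<and> card C = s}"
    proof (rule inj_onI)
      fix C C' assume C: "C \<in> {C. C \<subseteq> A \<times> B \<and> single_valued C \<and> card C = s}"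
        "C' \<in> {C. C \<subseteq> A \<times> B \<and> single_valued C \<and> card C = s}" and eq: "f C = f C'"
      have eq': "Domain C = Domain C' \<and> restrict (\<lambda>p. THE s. (p, s) \<in> C) (Domain C) = restrict (\<lambda>p. THE s. (p, s) \<in> C') (Domain C')"
        using eq unfolding f_def by (rule prod.inject[THEN iffD1])
      note dom = conjunct1[OF eq'] and fe = conjunct2[OF eq']
      have the: "(THE s. (p, s) \<in> C) = (THE s. (p, s) \<in> C')" if "p \<in> Domain C" for p
    proof -
        have "p \<in> Domain C'" using that dom by simp
        then show ?thesis using fun_cong[OF fe, of p] that by (simp only: restrict_apply if_True)
      qed
      have sv: "single_valued C" "single_valued C'" using C by auto
      have "(p, s) \<in> C \<longleftrightarrow> (p, s) \<in> C'" for p s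
      proof
        assume ps: "(p, s) \<in> C"
        then obtain s' where s': "(p, s') \<in> C'" using dom DomainI DomainE by metis
        moreover have "s = s'" using the[OF DomainI[OF ps]] unfolding val[OF sv(1) ps] val[OF sv(2) s'] .
        ultimately show "(p, s) \<in> C'" by simp
      next
        assume ps: "(p, s) \<in> C'"
        then obtain s' where s': "(p, s') \<in> C" using dom DomainI DomainE by metis
        moreover have "s' = s" using the[OF DomainI[OF s']] unfolding val[OF sv(2) ps] val[OF sv(1) s'] .
        ultimately show "(p, s) \<in> C" by simp
      qed
      then show "C = C'" by auto
    qed
    show "f ` {C. C \<subseteq> A \<times> B \<and> single_valued C \<and> card C = s} \<subseteq> (SIGMA X:{X. X \<subseteq> A \<and> card X = s}. X \<rightarrow>\<^sub>E B)"
    proof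
      fix y assume "y \<in> f ` {C. C \<subseteq> A \<times> B \<and> single_valued C \<and> card C = s}"
      then obtain C where C: "C \<subseteq> A \<times> B" "single_valued C" "card C = s" "y = f C" by auto
      have "inj_on fst C" using C(2) by (auto simp: inj_on_def single_valued_def)
      then have "card (Domain C) = s" using C(3) by (simp add: Domain_fst card_image)
      moreover have "Domain C \<subseteq> A" using C(1) by auto
      ultimately have m1: "Domain C \<in> {X. X \<subseteq> A \<and> card X = s}" by simp
      have "(THE s. (p, s) \<in> C) \<in> B" if p: "p \<in> Domain C" for p
      proof -
        obtain t where t: "(p, t) \<in> C" using p by (rule DomainE)
        then have "t \<in> B" using C(1) by blast
        then show ?thesis by (simp only: val[OF C(2) t])
      qed
      then have m2: "restrict (\<lambda>p. THE s. (p, s) \<in> C) (Domain C) \<in> Domain C \<rightarrow>\<^sub>E B"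
        unfolding restrict_PiE_iff by (rule ballI)
      show "y \<in> (SIGMA X:{X. X \<subseteq> A \<and> card X = s}. X \<rightarrow>\<^sub>E B)"
        unfolding C(4) f_def by (rule SigmaI, rule m1, rule m2)
    qed
    show "finite (SIGMA X:{X. X \<subseteq> A \<and> card X = s}. X \<rightarrow>\<^sub>E B)"
      using assms by (intro finite_SigmaI finite_PiE) (auto intro: finite_subset)
  qed
  also have "\<dots> = (\<Sum>X\<in>{X. X \<subseteq> A \<and> card X = s}. card (X \<rightarrow>\<^sub>E B))"
    using assms by (intro card_SigmaI ballI finite_PiE) (auto intro: finite_subset)
  also have "\<dots> = (\<Sum>X\<in>{X. X \<subseteq> A \<and> card X = s}. card B ^ s)"
  proof (rule sum.cong[OF refl])
    fix X assume X: "X \<in> {X. X \<subseteq> A \<and> card X = s}"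
    then have "finite X" using finite_subset[OF _ assms(1)] by simp
    then show "card (X \<rightarrow>\<^sub>E B) = card B ^ s" using X by (simp add: card_PiE)
  qed
  also have "\<dots> = (card A choose s) * card B ^ s" using assms by (simp add: n_subsets)
  finally show ?thesis .
qed

text \<open>A block with \<open>k\<close> points is encoded by \<open>k - 2\<close> labels, with \<open>n\<close> choices for each; so this is an exponent of \<open>n\<close>.\<close>
definition excess :: "nat set set \<Rightarrow> nat" where
  "excess P = (\<Sum>b\<in>P. card b - 2)"

definition first_point :: "nat set \<Rightarrow> nat" where "first_point b = Min b"
definition second_point :: "nat set \<Rightarrow> nat" where "second_point b = Min (b - {Min b})"

text \<open>For each point \<open>y\<close> of a block other than its two smallest points $a < s$, the pair $\{a, y\}$ is labelled
  with \<open>s\<close>. All other points that carry the label \<open>s\<close> at \<open>a\<close> form, together with \<open>a\<close> and \<open>s\<close>, the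
  block. A partial labelling of the pairs by points is easy to count.\<close>
definition packing_code :: "nat set set \<Rightarrow> (nat set \<times> nat) set" where
  "packing_code P = (\<Union>b\<in>P. (\<lambda>y. ({first_point b, y}, second_point b)) ` (b - {first_point b, second_point b}))"

lemma packing_code_iff:
  "(p, s) \<in> packing_code P \<longleftrightarrow> (\<exists>b y. b \<in> P \<and> y \<in> b - {first_point b, second_point b} \<and> p = {first_point b, y} \<and> s = second_point b)"
proof
  assume "(p, s) \<in> packing_code P"
  then obtain b where b: "b \<in> P" "(p, s) \<in> (\<lambda>y. ({first_point b, y}, second_point b)) ` (b - {first_point b, second_point b})"
    unfolding packing_code_def by (rule UN_E)
  from b(2) obtain y where "(p, s) = ({first_point b, y}, second_point b)" "y \<in> b - {first_point b, second_point b}" by (rule imageE)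
  then show "\<exists>b y. b \<in> P \<and> y \<in> b - {first_point b, second_point b} \<and> p = {first_point b, y} \<and> s = second_point b" using b(1) by auto
next
  assume "\<exists>b y. b \<in> P \<and> y \<in> b - {first_point b, second_point b} \<and> p = {first_point b, y} \<and> s = second_point b"
  then obtain b y where b: "b \<in> P" "y \<in> b - {first_point b, second_point b}" "p = {first_point b, y}" "s = second_point b" by (elim exE conjE)
  show "(p, s) \<in> packing_code P" unfolding packing_code_def b(3,4) by (rule UN_I[OF b(1)], rule imageI, rule b(2))
qed

lemma first_points:
  assumes "finite b" "3 \<le> card b"
  shows "first_point b \<in> b" "second_point b \<in> b" "first_point b < second_point b"
    and "\<And>y. y \<in> b \<Longrightarrow> y \<noteq> first_point b \<Longrightarrow> first_point b < y" and "card (b - {first_point b, second_point b}) = card b - 2"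
proof -
  have ne: "b \<noteq> {}" using assms by auto
  show 1: "first_point b \<in> b" unfolding first_point_def using assms ne by (intro Min_in) auto
  have lt: "first_point b < y" if "y \<in> b" "y \<noteq> first_point b" for y
    using Min_le[OF assms(1) that(1)] that(2) by (simp add: first_point_def)
  then show "\<And>y. y \<in> b \<Longrightarrow> y \<noteq> first_point b \<Longrightarrow> first_point b < y" .
  have "card (b - {first_point b}) = card b - 1" using 1 by simp
  then have "0 < card (b - {first_point b})" using assms(2) by linarith
  then have "b - {first_point b} \<noteq> {}" by (metis card_gt_0_iff)
  moreover have "second_point b = Min (b - {first_point b})" by (simp add: second_point_def first_point_def)
  ultimately have s: "second_point b \<in> b - {first_point b}" using assms(1) Min_in[of "b - {first_point b}"] by simp
  then show "second_point b \<in> b" "first_point b < second_point b" using lt by auto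
  then show "card (b - {first_point b, second_point b}) = card b - 2" using 1 by (simp add: card_Diff_subset)
qed

lemma packing_code_unique:
  assumes P: "packing n P" and b: "b \<in> P" "c \<in> P" and y: "y \<in> b" "y \<noteq> first_point b" and z: "z \<in> c" "z \<noteq> first_point c"
    and eq: "{first_point b, y} = {first_point c, z}"
  shows "b = c" "y = z"
proof -
  have "first_point b < y" "first_point c < z" using first_points(4) packing_block[OF P b(1)] packing_block[OF P b(2)] y z by auto
  then have e: "first_point b = first_point c" "y = z" using eq by (auto simp: doubleton_eq_iff)
  then show "y = z" by simp
  have "first_point b \<in> b" using first_points(1)[of b] packing_block[OF P b(1)] by simp
  moreover have "first_point c \<in> c" using first_points(1)[of c] packing_block[OF P b(2)] by simp
  ultimately have "{first_point b, y} \<subseteq> b" "{first_point b, y} \<subseteq> c" using y(1) z(1) e by simp_all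
  then show "b = c" using y(2) by (intro packing_unique[OF P b, of "first_point b" y]) simp_all
qed

lemma packing_code_in:
  assumes P: "packing n P"
  shows "packing_code P \<subseteq> pairs {..<n} \<times> {..<n}" "single_valued (packing_code P)" "card (packing_code P) = excess P"
proof -
  note pb = packing_block[OF P] and fp = first_points
  show "packing_code P \<subseteq> pairs {..<n} \<times> {..<n}"
  proof
    fix e assume "e \<in> packing_code P"
    then obtain b y where b: "b \<in> P" "y \<in> b - {first_point b, second_point b}" "e = ({first_point b, y}, second_point b)"
      by (auto simp: packing_code_def)
    have "first_point b \<in> b" "second_point b \<in> b" "first_point b \<noteq> y" using fp(1,2)[of b] pb[OF b(1)] b(2) by auto
    then show "e \<in> pairs {..<n} \<times> {..<n}" using pb[OF b(1)] b by (auto simp: pairs_def)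
  qed
  show "single_valued (packing_code P)"
  proof (rule single_valuedI)
    fix p s t assume "(p, s) \<in> packing_code P" "(p, t) \<in> packing_code P"
    then obtain b y c z where *: "b \<in> P" "y \<in> b - {first_point b, second_point b}" "p = {first_point b, y}" "s = second_point b"
      "c \<in> P" "z \<in> c - {first_point c, second_point c}" "p = {first_point c, z}" "t = second_point c"
      unfolding packing_code_iff by blast
    have "b = c" using *(2,3,6,7) by (intro packing_code_unique(1)[OF P *(1) *(5), of y z]) simp_all
    then show "s = t" using *(4,8) by simp
  qed
  have "card (packing_code P) = (\<Sum>b\<in>P. card ((\<lambda>y. ({first_point b, y}, second_point b)) ` (b - {first_point b, second_point b})))"
    unfolding packing_code_def
  proof (rule card_UN_disjoint)
    show "finite P" by (rule packing_finite[OF P])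
    show "\<forall>b\<in>P. finite ((\<lambda>y. ({first_point b, y}, second_point b)) ` (b - {first_point b, second_point b}))" using pb by auto
    show "\<forall>b\<in>P. \<forall>c\<in>P. b \<noteq> c \<longrightarrow> (\<lambda>y. ({first_point b, y}, second_point b)) ` (b - {first_point b, second_point b}) \<inter>
        (\<lambda>y. ({first_point c, y}, second_point c)) ` (c - {first_point c, second_point c}) = {}"
    proof (intro ballI impI, rule ccontr)
      fix b c assume bc: "b \<in> P" "c \<in> P" "b \<noteq> c"
        and "(\<lambda>y. ({first_point b, y}, second_point b)) ` (b - {first_point b, second_point b}) \<inter>
        (\<lambda>y. ({first_point c, y}, second_point c)) ` (c - {first_point c, second_point c}) \<noteq> {}"
      then obtain y z where "y \<in> b - {first_point b, second_point b}" "z \<in> c - {first_point c, second_point c}" "{first_point b, y} = {first_point c, z}"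
        by blast
      then have "b = c" by (intro packing_code_unique(1)[OF P bc(1,2), of y z]) simp_all
      then show False using bc(3) by simp
    qed
  qed
  also have "\<dots> = (\<Sum>b\<in>P. card b - 2)"
  proof (rule sum.cong[OF refl])
    fix b assume b: "b \<in> P"
    have "inj_on (\<lambda>y. ({first_point b, y}, second_point b)) (b - {first_point b, second_point b})"
      by (auto simp: inj_on_def doubleton_eq_iff)
    then show "card ((\<lambda>y. ({first_point b, y}, second_point b)) ` (b - {first_point b, second_point b})) = card b - 2"
      using fp(5)[of b] pb[OF b] by (simp add: card_image)
  qed
  finally show "card (packing_code P) = excess P" by (simp add: excess_def)
qed

lemma packing_code_block_subset:
  assumes P: "packing n P" and P': "packing n P'" and eq: "packing_code P = packing_code P'" and b: "b \<in> P"
  shows "\<exists>c\<in>P'. b \<subseteq> c"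
proof -
  have pb: "finite b" "3 \<le> card b" using packing_block[OF P b] by blast+
  note fp = first_points[OF pb]
  have "0 < card (b - {first_point b, second_point b})" unfolding fp(5) using pb(2) by linarith
  then have "b - {first_point b, second_point b} \<noteq> {}" by (metis card_gt_0_iff)
  then obtain y where y: "y \<in> b - {first_point b, second_point b}" by blast
  have img: "\<exists>c z. c \<in> P' \<and> z \<in> c - {first_point c, second_point c} \<and> {first_point b, x} = {first_point c, z} \<and> second_point b = second_point c"
    if "x \<in> b - {first_point b, second_point b}" for x
  proof -
    have "({first_point b, x}, second_point b) \<in> packing_code P'" unfolding eq[symmetric] packing_code_iff using b that by blast
    then show ?thesis unfolding packing_code_iff .
  qed
  have block': "finite c" "3 \<le> card c" if "c \<in> P'" for c using packing_block[OF P' that] by blast+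
  have eqs: "first_point b = first_point c \<and> x = z"
    if c: "c \<in> P'" "z \<in> c - {first_point c, second_point c}" and e: "{first_point b, x} = {first_point c, z}" and x: "x \<in> b - {first_point b, second_point b}" for x c z
  proof -
    have "first_point b < x" using fp(4)[of x] x by blast
    moreover have "first_point c < z" using first_points(4)[OF block'[OF c(1)], of z] c(2) by blast
    ultimately show ?thesis using e by (metis doubleton_eq_iff less_asym)
  qed
  obtain c z where c: "c \<in> P'" "z \<in> c - {first_point c, second_point c}" "{first_point b, y} = {first_point c, z}" "second_point b = second_point c"
    using img[OF y] by blast
  have fc: "first_point b = first_point c" using eqs[OF c(1-3) y] by (rule conjunct1)
  note pc = first_points(1-3)[OF block'[OF c(1)]]
  have "x \<in> c" if x: "x \<in> b" for x
  proof (cases "x \<in> {first_point b, second_point b}")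
    case True then show ?thesis using pc(1,2) unfolding fc c(4) by blast
  next
    case False
    then have x': "x \<in> b - {first_point b, second_point b}" using x by simp
    obtain d w where d: "d \<in> P'" "w \<in> d - {first_point d, second_point d}" "{first_point b, x} = {first_point d, w}" "second_point b = second_point d"
      using img[OF x'] by blast
    have e: "first_point b = first_point d" "x = w" using eqs[OF d(1-3) x'] by blast+
    note pd = first_points(1,2)[OF block'[OF d(1)]]
    have "{first_point c, second_point c} \<subseteq> d" using pd unfolding fc[symmetric] c(4)[symmetric] e(1) d(4) by blast
    then have "c = d" using pc by (intro packing_unique[OF P' c(1) d(1), of "first_point c" "second_point c"]) auto
    then show ?thesis using d(2) e(2) by blast
  qed
  then show ?thesis using c(1) by blast
qed

lemma packing_code_decode:
  assumes P: "packing n P" and P': "packing n P'" and eq: "packing_code P = packing_code P'"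
  shows "P \<subseteq> P'"
proof
  fix b assume b: "b \<in> P"
  obtain c where c: "c \<in> P'" "b \<subseteq> c" using packing_code_block_subset[OF P P' eq b] by blast
  obtain d where d: "d \<in> P" "c \<subseteq> d" using packing_code_block_subset[OF P' P eq[symmetric] c(1)] by blast
  have "b \<inter> d = b" using c d by blast
  then have "\<not> card (b \<inter> d) \<le> 1" using packing_block[OF P b] by simp
  then have "b = d" using P b d(1) unfolding packing_def by blast
  then show "b \<in> P'" using c d by auto
qed

theorem card_packings_excess_le:
  "card {P. packing n P \<and> excess P = s} \<le> ((n choose 2) choose s) * n ^ s"
proof -
  have "card {P. packing n P \<and> excess P = s} \<le> card {C. C \<subseteq> pairs {..<n} \<times> {..<n} \<and> single_valued C \<and> card C = s}"
  proof (rule card_inj_on_le[of packing_code])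
    show "inj_on packing_code {P. packing n P \<and> excess P = s}"
    proof (rule inj_onI)
      fix P P' assume "P \<in> {P. packing n P \<and> excess P = s}" "P' \<in> {P. packing n P \<and> excess P = s}" "packing_code P = packing_code P'"
      then show "P = P'" using packing_code_decode[of n P P'] packing_code_decode[of n P' P] by auto
    qed
    show "packing_code ` {P. packing n P \<and> excess P = s} \<subseteq> {C. C \<subseteq> pairs {..<n} \<times> {..<n} \<and> single_valued C \<and> card C = s}"
      using packing_code_in by blast
    show "finite {C. C \<subseteq> pairs {..<n} \<times> {..<n} \<and> single_valued C \<and> card C = s}"
      by (rule finite_subset[of _ "Pow (pairs {..<n} \<times> {..<n})"]) (auto simp: pairs_finite)
  qed
  also have "\<dots> \<le> (card (pairs {..<n}) choose s) * card {..<n} ^ s"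
    by (rule card_single_valued_le) (auto simp: pairs_finite)
  finally show ?thesis by (simp add: card_pairs)
qed

text \<open>Comparison of one term of the binomial expansion of $(1+t)^N$ with the whole sum.\<close>
lemma binomial_le_exp:
  fixes t :: real
  assumes "0 < t" "t \<le> 1" "real s \<le> t\<^sup>2 * N"
  shows "real (N choose s) \<le> exp (2 * t * N)"
proof (cases "s \<le> N")
  case False then show ?thesis by (simp add: binomial_eq_0)
next
  case True
  have "real (N choose s) * t ^ s \<le> (\<Sum>k\<le>N. real (N choose k) * t ^ k)"
  proof (rule member_le_sum[of s "{..N}" "\<lambda>k. real (N choose k) * t ^ k"])
    show "0 \<le> real (N choose k) * t ^ k" for k using assms(1) by simp
  qed (use True in simp_all)
  also have "\<dots> = (1 + t) ^ N" using binomial_ring[of t 1 N] by (simp add: add.commute)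
  also have "\<dots> \<le> exp t ^ N" using assms by (intro power_mono) auto
  also have "\<dots> = exp (N * t)" by (simp add: exp_of_nat_mult)
  finally have 1: "real (N choose s) * t ^ s \<le> exp (N * t)" .
  have "t ^ s = exp (s * ln t)" using assms by (simp add: exp_of_nat_mult)
  have "- ln t \<le> 1 / t" 
  proof -
    have "ln (1 / t) \<le> 1 / t - 1" using assms by (intro ln_le_minus_one) auto
    then show ?thesis using assms by (simp add: ln_div)
  qed
  then have "real s * - ln t \<le> real s * (1 / t)" by (intro mult_left_mono) auto
  also have "\<dots> \<le> t\<^sup>2 * N * (1 / t)" using assms by (intro mult_right_mono) auto
  also have "\<dots> = t * N" using assms by (simp add: power2_eq_square)
  finally have "- (real s * ln t) \<le> t * N" by simp
  have "real (N choose s) \<le> exp (N * t) / t ^ s" using 1 assms by (simp add: pos_le_divide_eq)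
  also have "\<dots> = exp (N * t - s * ln t)" using \<open>t ^ s = exp (s * ln t)\<close> by (simp add: exp_diff)
  also have "\<dots> \<le> exp (2 * t * N)" using \<open>- (real s * ln t) \<le> t * N\<close> by (simp add: algebra_simps)
  finally show ?thesis .
qed

section \<open>The upper bound\<close>

definition big_blocks :: "nat set set \<Rightarrow> nat set set" where
  "big_blocks P = {b \<in> P. 5 \<le> card b}"

definition small_blocks :: "nat set set \<Rightarrow> nat set set" where
  "small_blocks P = {b \<in> P. card b \<in> {3, 4}}"

lemma packing_subset: "packing n P \<Longrightarrow> P' \<subseteq> P \<Longrightarrow> packing n P'"
  unfolding packing_def by blast

lemma small_un_big:
  assumes "packing n P" shows "P = small_blocks P \<union> big_blocks P" "small_blocks P \<inter> big_blocks P = {}"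
proof -
  have "3 \<le> card b" if "b \<in> P" for b using packing_block[OF assms that] by simp
  then show "P = small_blocks P \<union> big_blocks P" unfolding small_blocks_def big_blocks_def by force
  show "small_blocks P \<inter> big_blocks P = {}" unfolding small_blocks_def big_blocks_def by auto
qed

lemma small_blocks_mixed:
  assumes "packing n P"
  shows "small_blocks P \<in> mixed_packings n (card {b \<in> P. card b = 3}) (card {b \<in> P. card b = 4})"
proof -
  have "packing n (small_blocks P)" by (rule packing_subset[OF assms]) (simp add: small_blocks_def)
  moreover have "{b \<in> small_blocks P. card b = 3} = {b \<in> P. card b = 3}" "{b \<in> small_blocks P. card b = 4} = {b \<in> P. card b = 4}"
    by (auto simp: small_blocks_def)
  ultimately show ?thesis unfolding mixed_packings_def by (simp add: small_blocks_def)
qed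

text \<open>A block with \<open>k \<ge> 5\<close> points has $k - 2 \le \frac{3}{10} \cdot k(k-1)/2$, whereas triples and quadruples
  attain the factor $1/3$. Hence every pair outside the triples and quadruples costs at least a
  thirtieth in the exponent of \<open>n\<close>.\<close>
lemma packing_weights:
  assumes P: "packing n P"
  defines "T \<equiv> card {b \<in> P. card b = 3}" and "Q \<equiv> card {b \<in> P. card b = 4}"
  defines "gap \<equiv> real (n choose 2) - (3 * T + 6 * Q)"
  shows "excess P = T + 2 * Q + excess (big_blocks P)"
    and "0 \<le> gap" "3 * real (excess (big_blocks P)) \<le> 9 / 10 * gap" "3 * real (excess P) + gap / 10 \<le> real (n choose 2)"
proof -
  have fP: "finite P" by (rule packing_finite[OF P])
  have fin: "finite (small_blocks P)" "finite (big_blocks P)" using fP by (simp_all add: small_blocks_def big_blocks_def)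
  have split: "(\<Sum>b\<in>P. f (card b)) = (\<Sum>b\<in>small_blocks P. f (card b)) + (\<Sum>b\<in>big_blocks P. f (card b))" for f :: "nat \<Rightarrow> nat"
    by (subst small_un_big(1)[OF P], rule sum.union_disjoint[OF fin small_un_big(2)[OF P]])
  note sm = mixed_packing_sum[OF small_blocks_mixed[OF P], folded T_def Q_def]
  show e: "excess P = T + 2 * Q + excess (big_blocks P)"
    using split[of "\<lambda>k. k - 2"] sm[of "\<lambda>k. k - 2"] by (simp add: excess_def)
  define W where "W = (\<Sum>b\<in>big_blocks P. card b choose 2)"
  have "(\<Sum>b\<in>P. card b choose 2) = 3 * T + 6 * Q + W"
    using split[of "\<lambda>k. k choose 2"] sm[of "\<lambda>k. k choose 2"] by (simp add: W_def choose_two)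
  then have "3 * T + 6 * Q + W \<le> n choose 2" using packing_pair_count[OF P] by linarith
  then have "real (3 * T + 6 * Q + W) \<le> real (n choose 2)" by (rule of_nat_mono)
  then have W: "real W \<le> gap" by (simp add: gap_def)
  then show "0 \<le> gap" by linarith
  have "10 * (card b - 2) \<le> 3 * (card b choose 2)" if "b \<in> big_blocks P" for b
  proof -
    define k where "k = card b - 5"
    have k: "card b = k + 5" using that by (simp add: k_def big_blocks_def)
    have "2 * (card b choose 2) = (k + 5) * (k + 4)" unfolding k by (simp add: choose_two)
    then have "20 * (card b - 2) \<le> 6 * (card b choose 2)" unfolding k by (simp add: algebra_simps)
    then show ?thesis by linarith
  qed
  then have "(\<Sum>b\<in>big_blocks P. 10 * (card b - 2)) \<le> (\<Sum>b\<in>big_blocks P. 3 * (card b choose 2))" by (rule sum_mono)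
  then have "10 * excess (big_blocks P) \<le> 3 * W" by (simp add: excess_def W_def sum_distrib_left)
  then have "10 * real (excess (big_blocks P)) \<le> 3 * real W" by linarith
  then show b: "3 * real (excess (big_blocks P)) \<le> 9 / 10 * gap" using W by linarith
  show "3 * real (excess P) + gap / 10 \<le> real (n choose 2)"
  proof -
    have "real (n choose 2) = gap + (3 * T + 6 * Q)" by (simp add: gap_def)
    moreover have "3 * real (excess (big_blocks P)) + gap / 10 \<le> gap" using b by (simp add: field_simps)
    ultimately show ?thesis by (simp add: e)
  qed
qed

text \<open>If \<open>d\<close> is of order $n^2$, then the exponent of \<open>n\<close> is lowered by a multiple of $n^2$, which outweighs
  every factor $e^{O(n^2)}$; so a crude count is enough.\<close>
lemma card_wasteful_packings_le:
  assumes n: "1 \<le> n"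
  shows "card {P. packing n P \<and> d \<le> real (n choose 2) - (3 * card {b \<in> P. card b = 3} + 6 * card {b \<in> P. card b = 4})}
     \<le> 2 ^ (n choose 2) * real n powr ((real (n choose 2) - d / 10) / 3)" (is "real (card ?A) \<le> _")
proof -
  define N where "N = n choose 2"
  define I where "I = {s. s \<le> N \<and> real s \<le> (real N - d / 10) / 3}"
  have fI: "finite I" unfolding I_def by (rule finite_subset[of _ "{..N}"]) auto
  have "?A \<subseteq> (\<Union>s\<in>I. {P. packing n P \<and> excess P = s})"
  proof
    fix P assume "P \<in> ?A"
    then have P: "packing n P" "d \<le> real N - (3 * card {b \<in> P. card b = 3} + 6 * card {b \<in> P. card b = 4})" by (auto simp: N_def)
    define gap where "gap = real N - (3 * card {b \<in> P. card b = 3} + 6 * card {b \<in> P. card b = 4})"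
    have "0 \<le> gap" "3 * real (excess P) + gap / 10 \<le> real N"
      using packing_weights(2,4)[OF P(1)] unfolding gap_def N_def .
    moreover have "d \<le> gap" using P(2) by (simp add: gap_def)
    ultimately have "3 * real (excess P) + d / 10 \<le> real N" "3 * real (excess P) \<le> real N" by simp_all
    then have "excess P \<in> I" unfolding I_def by simp
    then show "P \<in> (\<Union>s\<in>I. {P. packing n P \<and> excess P = s})" using P(1) by blast
  qed
  then have "card ?A \<le> card (\<Union>s\<in>I. {P. packing n P \<and> excess P = s})"
    using fI finite_packings by (intro card_mono) auto
  also have "\<dots> \<le> (\<Sum>s\<in>I. card {P. packing n P \<and> excess P = s})" by (rule card_UN_le[OF fI])
  also have "\<dots> \<le> (\<Sum>s\<in>I. (N choose s) * n ^ s)" unfolding N_def by (intro sum_mono card_packings_excess_le)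
  finally have "real (card ?A) \<le> real (\<Sum>s\<in>I. (N choose s) * n ^ s)" by (rule of_nat_mono)
  also have "\<dots> = (\<Sum>s\<in>I. real (N choose s) * real n ^ s)" by simp
  also have "\<dots> \<le> (\<Sum>s\<in>I. real (N choose s) * real n powr ((real N - d / 10) / 3))"
  proof (intro sum_mono mult_left_mono)
    fix s assume "s \<in> I"
    then have "real n powr real s \<le> real n powr ((real N - d / 10) / 3)" using n by (intro powr_mono) (auto simp: I_def)
    then show "real n ^ s \<le> real n powr ((real N - d / 10) / 3)" using n by (simp add: powr_realpow)
  qed simp
  also have "\<dots> \<le> (\<Sum>s\<le>N. real (N choose s) * real n powr ((real N - d / 10) / 3))"
    by (rule sum_mono2) (auto simp: I_def)
  also have "\<dots> = real (\<Sum>s\<le>N. N choose s) * real n powr ((real N - d / 10) / 3)" by (simp add: sum_distrib_right)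
  also have "\<dots> = 2 ^ N * real n powr ((real N - d / 10) / 3)" by (simp add: choose_row_sum)
  finally show ?thesis by (simp add: N_def)
qed

text \<open>If the gap is small, the large blocks are few. They are encoded separately: there are at most
  $e^{\eta n^2}$ ways to choose the pairs that carry the labels of the code, and each label costs a
  factor \<open>n\<close>, for which at least three pairs are used up.
  The remaining blocks are counted by \<open>card_mixed_packings_le\<close>.\<close>
lemma card_efficient_packings_le:
  fixes \<eta> \<delta> :: real
  assumes n: "2 \<le> n" "2 / \<delta> \<le> n" and \<eta>: "0 < \<eta>" "\<eta> \<le> 1" and \<delta>: "\<delta> = \<eta> ^ 12 / 24"
  shows "card {P. packing n P \<and> real (n choose 2) - (3 * card {b \<in> P. card b = 3} + 6 * card {b \<in> P. card b = 4}) \<le> \<delta> * (real n)\<^sup>2 / 2}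
     \<le> exp ((real n)\<^sup>2 / 6 * (ln n + ln growth_constant) + 6 * \<eta> * (real n)\<^sup>2 + n / 2 + 6 + 18 * ln n)" (is "real (card ?A) \<le> _")
proof -
  define N where "N = n choose 2"
  define d where "d = \<delta> * (real n)\<^sup>2 / 2"
  define \<Lambda> where "\<Lambda> = ln ((1 + sqrt 3) / 2)"
  have n0: "0 < real n" "2 \<le> real n" using n by auto
  have \<delta>0: "0 < \<delta>" "\<delta> \<le> \<eta> / 24" "\<delta> \<le> 1 / 24"
  proof -
    have "\<eta> ^ 12 \<le> \<eta> ^ 1" using \<eta> by (intro power_decreasing) auto
    then show "0 < \<delta>" "\<delta> \<le> \<eta> / 24" "\<delta> \<le> 1 / 24" unfolding \<delta> using \<eta> by auto
  qed
  have Nr: "real N = real n * (real n - 1) / 2" by (simp add: N_def real_choose_2)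
  have N4: "(real n)\<^sup>2 / 4 \<le> real N"
  proof -
    have "real n * (real n / 2) \<le> real n * (real n - 1)" using n0 by (intro mult_left_mono) auto
    then show ?thesis by (simp add: Nr power2_eq_square)
  qed
  have N2: "real N \<le> (real n)\<^sup>2 / 2" by (simp add: Nr power2_eq_square algebra_simps)
  have \<Lambda>: "0 < \<Lambda>" "\<Lambda> < 3"
  proof -
    have sq: "1 < sqrt (3::real)" "sqrt (3::real) < 2" by (auto intro: real_less_lsqrt)
    show "0 < \<Lambda>" unfolding \<Lambda>_def using sq by (intro ln_gt_zero) auto
    have "0 < (1 + sqrt 3) / (2::real)" by (intro divide_pos_pos add_pos_pos) auto
    then have "\<Lambda> \<le> (1 + sqrt 3) / 2 - 1" unfolding \<Lambda>_def by (rule ln_le_minus_one)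
    then show "\<Lambda> < 3" using sq by simp
  qed
  define I where "I = {(T, Q, s). T \<le> N \<and> Q \<le> N \<and> s \<le> N \<and> real N - (3 * T + 6 * Q) \<le> d \<and> 3 * (real T + 2 * real Q + real s) \<le> N \<and> 3 * real s \<le> 9 / 10 * d}"
  have Isub: "I \<subseteq> {..N} \<times> {..N} \<times> {..N}" by (auto simp: I_def)
  have fI: "finite I" by (rule finite_subset[OF Isub]) auto
  have cI: "card I \<le> (N + 1) ^ 3"
  proof -
    have "card I \<le> card ({..N} \<times> {..N} \<times> {..N})" by (rule card_mono[OF _ Isub]) auto
    also have "\<dots> = (N + 1) ^ 3" by (simp add: card_cartesian_product power3_eq_cube)
    finally show ?thesis .
  qed
  define E where "E = (\<lambda>(T, Q, s). {R. packing n R \<and> excess R = s} \<times> mixed_packings n T Q)"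
  have fE: "finite (E i)" for i unfolding E_def mixed_packings_def
    by (cases i) (auto intro!: finite_cartesian_product finite_packings)
  have "card ?A \<le> card (\<Union>i\<in>I. E i)"
  proof (rule card_inj_on_le[of "\<lambda>P. (big_blocks P, small_blocks P)"])
    show "inj_on (\<lambda>P. (big_blocks P, small_blocks P)) ?A"
    proof (rule inj_onI)
      fix P P' assume "P \<in> ?A" "P' \<in> ?A" "(big_blocks P, small_blocks P) = (big_blocks P', small_blocks P')"
      then show "P = P'" using small_un_big(1)[of n P] small_un_big(1)[of n P'] by simp
    qed
    show "(\<lambda>P. (big_blocks P, small_blocks P)) ` ?A \<subseteq> (\<Union>i\<in>I. E i)"
    proof
      fix y assume "y \<in> (\<lambda>P. (big_blocks P, small_blocks P)) ` ?A"
      then obtain P where P: "P \<in> ?A" and y: "y = (big_blocks P, small_blocks P)" by (rule imageE)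
      have pP: "packing n P" using P by simp
      define T where "T = card {b \<in> P. card b = 3}"
      define Q where "Q = card {b \<in> P. card b = 4}"
      define s where "s = excess (big_blocks P)"
      have gap: "real N - (3 * T + 6 * Q) \<le> d" using P by (simp add: N_def d_def T_def Q_def)
      note w = packing_weights[OF pP, folded T_def Q_def s_def N_def]
      have "3 * (real T + 2 * real Q + real s) \<le> N" using w(1,2,4) by (simp add: field_simps)
      moreover have "3 * real s \<le> 9 / 10 * d" by (rule order_trans[OF w(3)]) (use gap in simp)
      ultimately have "(T, Q, s) \<in> I" using gap by (simp add: I_def)
      moreover have "packing n (big_blocks P)" by (rule packing_subset[OF pP]) (simp add: big_blocks_def)
      then have "y \<in> E (T, Q, s)" using small_blocks_mixed[OF pP] by (simp add: y E_def s_def T_def Q_def)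
      ultimately show "y \<in> (\<Union>i\<in>I. E i)" by (rule UN_I)
    qed
    show "finite (\<Union>i\<in>I. E i)" using fI fE by (rule finite_UN_I)
  qed
  also have "\<dots> \<le> (\<Sum>i\<in>I. card (E i))" by (rule card_UN_le[OF fI])
  finally have "real (card ?A) \<le> real (\<Sum>i\<in>I. card (E i))" by (rule of_nat_mono)
  then have AE: "real (card ?A) \<le> (\<Sum>i\<in>I. real (card (E i)))" by (simp only: of_nat_sum)
  define B where "B = (real n)\<^sup>2 / 6 * (ln n + ln growth_constant) + 6 * \<eta> * (real n)\<^sup>2 + n / 2 + 6 + 12 * ln n"
  have bound: "real (card (E i)) \<le> exp B" if i: "i \<in> I" for i
  proof -
    obtain T Q s where i': "i = (T, Q, s)" by (cases i)
    have I: "real N - (3 * T + 6 * Q) \<le> d" "3 * (real T + 2 * real Q + real s) \<le> N" "3 * real s \<le> 9 / 10 * d"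
      using i by (auto simp: I_def i')
    have dN: "d < real N"
    proof -
      have "\<delta> * (real n)\<^sup>2 \<le> 1 / 24 * (real n)\<^sup>2" using \<delta>0 by (intro mult_right_mono) auto
      then have "d \<le> 1 / 24 * (real n)\<^sup>2 / 2" unfolding d_def by (rule divide_right_mono) simp
      also have "\<dots> < (real n)\<^sup>2 / 4" using n0 by simp
      also note N4
      finally show ?thesis .
    qed
    have TQ: "0 < T + Q" using I(1) dN by (cases "T + Q = 0") auto
    have s1: "real (N choose s) \<le> exp (2 * \<eta> ^ 6 * N)"
    proof (rule binomial_le_exp)
      show "0 < \<eta> ^ 6" "\<eta> ^ 6 \<le> 1" using \<eta> by (auto simp: power_le_one)
      have "real s \<le> 3 / 20 * \<delta> * (real n)\<^sup>2" using I(3) by (simp add: d_def)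
      also have "\<dots> \<le> 24 * \<delta> * ((real n)\<^sup>2 / 4)" using \<delta>0 by simp
      also have "\<dots> \<le> 24 * \<delta> * real N" using N4 \<delta>0 by (intro mult_left_mono) auto
      also have "24 * \<delta> = (\<eta> ^ 6)\<^sup>2" by (simp add: \<delta> power_mult[symmetric])
      finally show "real s \<le> (\<eta> ^ 6)\<^sup>2 * real N" .
    qed
    have "2 * \<eta> ^ 6 * N \<le> 2 * \<eta> * ((real n)\<^sup>2 / 2)"
    proof (rule mult_mono)
      have "\<eta> ^ 6 \<le> \<eta> ^ 1" using \<eta> by (intro power_decreasing) auto
      then show "2 * \<eta> ^ 6 \<le> 2 * \<eta>" by simp
    qed (use N2 \<eta> in auto)
    then have s2: "real (N choose s) \<le> exp (\<eta> * (real n)\<^sup>2)" 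
      by (intro order_trans[OF s1]) simp
    have ns: "real n ^ s = exp (s * ln n)" using n0 by (simp add: exp_of_nat_mult)
    have K: "real (card (mixed_packings n T Q)) \<le> exp ((T + 2 * real Q) * (ln n + \<Lambda> - 3) + sqrt 3 / 12 * (real n)\<^sup>2 + 6 * (1 + 2 * ln n) + 4 * \<eta> * (real n)\<^sup>2)"
      unfolding \<Lambda>_def using I(1) n TQ by (intro card_mixed_packings_le[OF _ n(2) \<eta>(1) \<delta>]) (auto simp: N_def d_def)
    have "real (card (E i)) = real (card {R. packing n R \<and> excess R = s}) * real (card (mixed_packings n T Q))"
      by (simp add: E_def i' card_cartesian_product)
    also have "\<dots> \<le> real ((N choose s) * n ^ s) * real (card (mixed_packings n T Q))"
      using card_packings_excess_le[of n s] unfolding N_def by (intro mult_right_mono of_nat_mono) auto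
    also have "\<dots> \<le> (exp (\<eta> * (real n)\<^sup>2) * exp (s * ln n)) * exp ((T + 2 * real Q) * (ln n + \<Lambda> - 3) + sqrt 3 / 12 * (real n)\<^sup>2 + 6 * (1 + 2 * ln n) + 4 * \<eta> * (real n)\<^sup>2)"
      using s2 K by (intro mult_mono) (auto simp: ns)
    also have "\<dots> = exp ((T + 2 * real Q + s) * ln n - (3 - \<Lambda>) * (T + 2 * real Q) + (sqrt 3 / 12 * (real n)\<^sup>2 + 6 * (1 + 2 * ln n) + 5 * \<eta> * (real n)\<^sup>2))"
      unfolding exp_add[symmetric] by (intro arg_cong[where f = exp]) (simp add: algebra_simps)
    also have "\<dots> \<le> exp B"
    proof -
      have 1: "(T + 2 * real Q + s) * ln n \<le> (real n)\<^sup>2 / 6 * ln n" using I(2) N2 n0 by (intro mult_right_mono) auto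
      have "(3 - \<Lambda>) * ((real N - d) / 3) \<le> (3 - \<Lambda>) * (T + 2 * real Q)" using I(1) \<Lambda> by (intro mult_left_mono) auto
      moreover have "(real N - d) / 3 = (real n)\<^sup>2 / 6 - (n / 6 + \<delta> * (real n)\<^sup>2 / 6)"
        by (simp add: Nr d_def power2_eq_square algebra_simps diff_divide_distrib)
      moreover have "(3 - \<Lambda>) * (n / 6 + \<delta> * (real n)\<^sup>2 / 6) \<le> 3 * (n / 6 + \<delta> * (real n)\<^sup>2 / 6)"
        using \<Lambda> \<delta>0 by (intro mult_right_mono) auto
      ultimately have 2: "(3 - \<Lambda>) * ((real n)\<^sup>2 / 6) - (n / 2 + \<delta> * (real n)\<^sup>2 / 2) \<le> (3 - \<Lambda>) * (T + 2 * real Q)"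
        by (simp add: right_diff_distrib)
      have "\<delta> * (real n)\<^sup>2 \<le> \<eta> / 24 * (real n)\<^sup>2" using \<delta>0 by (intro mult_right_mono) auto
      moreover have "0 \<le> \<eta> * (real n)\<^sup>2" using \<eta> by simp
      ultimately have 3: "\<delta> * (real n)\<^sup>2 / 2 \<le> \<eta> * (real n)\<^sup>2" by simp
      have 4: "(real n)\<^sup>2 / 6 * (ln n + ln growth_constant) = (real n)\<^sup>2 / 6 * ln n - (3 - \<Lambda>) * ((real n)\<^sup>2 / 6) + sqrt 3 / 12 * (real n)\<^sup>2"
        unfolding ln_growth_constant \<Lambda>_def by (simp add: algebra_simps)
      have "(T + 2 * real Q + s) * ln n - (3 - \<Lambda>) * (T + 2 * real Q) + (sqrt 3 / 12 * (real n)\<^sup>2 + 6 * (1 + 2 * ln n) + 5 * \<eta> * (real n)\<^sup>2) \<le> B"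
      proof -
        have "a - k + (c + e + f) \<le> a' - k' + c + g + h + 6 + 12 * l"
          if "a \<le> a'" "k' - (h + x) \<le> k" "x \<le> y" "e = 6 + 12 * l" "g = f + y" for a a' k k' c e f g h l x y :: real
          using that by linarith
        note this[OF 1 2 3]
        from this[of "6 * (1 + 2 * ln n)" "ln n" "6 * \<eta> * (real n)\<^sup>2" "5 * \<eta> * (real n)\<^sup>2" "sqrt 3 / 12 * (real n)\<^sup>2"]
        show ?thesis unfolding B_def 4 by (simp add: algebra_simps)
      qed
      then show ?thesis by simp
    qed
    finally show ?thesis .
  qed
  have "(\<Sum>i\<in>I. real (card (E i))) \<le> (\<Sum>i\<in>I. exp B)" by (rule sum_mono[OF bound])
  also have "\<dots> = card I * exp B" by simp
  also have "\<dots> \<le> exp (6 * ln n) * exp B"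
  proof (rule mult_right_mono)
    have "real N + 1 \<le> (real n)\<^sup>2" using N2 n0 mult_mono[of 2 "real n" 2 "real n"] by (simp add: power2_eq_square)
    then have "(real N + 1) ^ 3 \<le> ((real n)\<^sup>2) ^ 3" by (intro power_mono) auto
    moreover have "real (card I) \<le> (real N + 1) ^ 3" using of_nat_mono[OF cI, where 'a = real] by (simp add: add.commute)
    moreover have "exp (6 * ln n) = ((real n)\<^sup>2) ^ 3" using n0 exp_of_nat_mult[of 6 "ln n"] by (simp add: power_mult[symmetric])
    ultimately show "real (card I) \<le> exp (6 * ln n)" by linarith
  qed simp
  also have "\<dots> = exp (B + 6 * ln n)" by (simp add: exp_add)
  finally have "(\<Sum>i\<in>I. real (card (E i))) \<le> exp (B + 6 * ln n)" .
  moreover note AE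
  moreover have "B + 6 * ln n = (real n)\<^sup>2 / 6 * (ln n + ln growth_constant) + 6 * \<eta> * (real n)\<^sup>2 + n / 2 + 6 + 18 * ln n"
    by (simp add: B_def)
  ultimately show ?thesis by simp
qed

theorem ln_num_matroids_le:
  assumes \<epsilon>: "0 < \<epsilon>"
  shows "\<forall>\<^sub>F n in sequentially. 0 < num_matroids n 3 \<longrightarrow>
     ln (num_matroids n 3) \<le> (real n)\<^sup>2 / 6 * (ln n + ln growth_constant + \<epsilon>)"
proof -
  \<comment> \<open>Half of \<open>\<epsilon>\<close> pays for the term \<open>6 * \<eta> * n\<^sup>2\<close>, the other half for the lower-order terms.\<close>
  define \<eta> where "\<eta> = min 1 (\<epsilon> / 72)"
  define \<delta> where "\<delta> = \<eta> ^ 12 / 24"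
  have \<eta>: "0 < \<eta>" "\<eta> \<le> 1" "\<eta> \<le> \<epsilon> / 72" using \<epsilon> by (auto simp: \<eta>_def)
  have \<delta>: "0 < \<delta>" using \<eta> by (simp add: \<delta>_def)
  define c where "c = ln growth_constant"
  define F where "F = (\<lambda>n::nat. (real n)\<^sup>2 / 6 * (ln n + c) + 6 * \<eta> * (real n)\<^sup>2 + n / 2 + 6 + 18 * ln n)"
  have e1: "\<forall>\<^sub>F n::nat in sequentially. real n * (real n - 1) / 2 * ln 2 + (real n * (real n - 1) / 2 - \<delta> * (real n)\<^sup>2 / 2 / 10) / 3 * ln n \<le> F n"
  proof -
    have "filterlim (\<lambda>n::nat. F n - (real n * (real n - 1) / 2 * ln 2 + (real n * (real n - 1) / 2 - \<delta> * (real n)\<^sup>2 / 2 / 10) / 3 * ln n)) at_top sequentially"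
      unfolding F_def using \<delta> \<eta>(1) by real_asymp
    then have "\<forall>\<^sub>F n::nat in sequentially. 0 \<le> F n - (real n * (real n - 1) / 2 * ln 2 + (real n * (real n - 1) / 2 - \<delta> * (real n)\<^sup>2 / 2 / 10) / 3 * ln n)"
      by (simp only: filterlim_at_top) 
    then show ?thesis by eventually_elim simp
  qed
  have e2: "\<forall>\<^sub>F n::nat in sequentially. n * ln (real n + 1) + ln 2 + F n \<le> (real n)\<^sup>2 / 6 * (ln n + c + \<epsilon>)"
  proof -
    have "filterlim (\<lambda>n::nat. (real n)\<^sup>2 / 12 * \<epsilon> - (n * ln (real n + 1) + ln 2 + n / 2 + 6 + 18 * ln n)) at_top sequentially"
      using \<epsilon> by real_asymp
    then have "\<forall>\<^sub>F n::nat in sequentially. 0 \<le> (real n)\<^sup>2 / 12 * \<epsilon> - (n * ln (real n + 1) + ln 2 + n / 2 + 6 + 18 * ln n)"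
      by (simp only: filterlim_at_top)
    then show ?thesis
    proof eventually_elim
      case (elim n)
      have "6 * \<eta> * (real n)\<^sup>2 \<le> \<epsilon> / 12 * (real n)\<^sup>2" using \<eta>(3) by (intro mult_right_mono) auto
      moreover have "(real n)\<^sup>2 / 6 * (ln n + c + \<epsilon>) = (real n)\<^sup>2 / 6 * (ln n + c) + (\<epsilon> / 12 * (real n)\<^sup>2 + (real n)\<^sup>2 / 12 * \<epsilon>)"
        by (simp add: distrib_left)
      ultimately show ?case using elim unfolding F_def by linarith
    qed
  qed
  have e3: "\<forall>\<^sub>F n::nat in sequentially. 2 / \<delta> \<le> n"
    by (metis eventually_at_top_linorder le_nat_floor nat_le_iff order_trans real_nat_ceiling_ge of_nat_mono)
  show ?thesis
    using e1 e2 e3 eventually_ge_at_top[of 2]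
  proof eventually_elim
    case (elim n)
    define N where "N = n choose 2"
    define gap where "gap = (\<lambda>P :: nat set set. real (n choose 2) - (3 * card {b \<in> P. card b = 3} + 6 * card {b \<in> P. card b = 4}))"
    define d where "d = \<delta> * (real n)\<^sup>2 / 2"
    have n: "2 \<le> n" "1 \<le> n" using elim(4) by auto
    have Nr: "real (n choose 2) = real n * (real n - 1) / 2" by (rule real_choose_2)
    have "card {P. packing n P \<and> gap P \<le> d} \<le> exp (F n)"
      unfolding gap_def d_def F_def c_def by (rule card_efficient_packings_le[OF n(1) elim(3) \<eta>(1,2) \<delta>_def])
    moreover have "card {P. packing n P \<and> d \<le> gap P} \<le> exp (F n)"
    proof -
      have "card {P. packing n P \<and> d \<le> gap P} \<le> 2 ^ (n choose 2) * real n powr ((real (n choose 2) - d / 10) / 3)"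
        unfolding gap_def by (rule card_wasteful_packings_le[OF n(2)])
      also have "\<dots> = exp (real (n choose 2) * ln 2 + (real (n choose 2) - d / 10) / 3 * ln n)"
        using n by (simp add: exp_add powr_def exp_of_nat_mult)
      also have "\<dots> \<le> exp (F n)" using elim(1) by (simp add: Nr d_def)
      finally show ?thesis .
    qed
    moreover have "card {P. packing n P} \<le> card {P. packing n P \<and> gap P \<le> d} + card {P. packing n P \<and> d \<le> gap P}"
    proof -
      have "{P. packing n P} = {P. packing n P \<and> gap P \<le> d} \<union> {P. packing n P \<and> d \<le> gap P}" by auto
      then show ?thesis using card_Un_le by metis
    qed
    ultimately have cP: "real (card {P. packing n P}) \<le> 2 * exp (F n)" by simp
    have "real (num_matroids n 3) \<le> real ((n + 1) ^ n * card {P. packing n P})"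
      using num_matroids_le_packings by (rule of_nat_mono)
    also have "\<dots> = (real n + 1) ^ n * card {P. packing n P}" by (simp add: add.commute)
    also have "\<dots> \<le> (real n + 1) ^ n * (2 * exp (F n))" using cP by (intro mult_left_mono) auto
    also have "\<dots> = exp (n * ln (real n + 1) + ln 2 + F n)" by (simp add: exp_add exp_of_nat_mult)
    also have "\<dots> \<le> exp ((real n)\<^sup>2 / 6 * (ln n + c + \<epsilon>))" using elim(2) by simp
    finally have le: "real (num_matroids n 3) \<le> exp ((real n)\<^sup>2 / 6 * (ln n + c + \<epsilon>))" .
    show ?case
    proof
      assume pos: "0 < num_matroids n 3"
      then have "ln (num_matroids n 3) \<le> ln (exp ((real n)\<^sup>2 / 6 * (ln n + c + \<epsilon>)))" using le by (subst ln_le_cancel_iff) auto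
      then show "ln (num_matroids n 3) \<le> (real n)\<^sup>2 / 6 * (ln n + ln growth_constant + \<epsilon>)" by (simp add: c_def)
    qed
  qed
qed

section \<open>The asymptotic formula\<close>

lemma root_num_matroids_limit:
  "(\<lambda>n. real (num_matroids n 3) powr (6 / (real n)\<^sup>2) / real n) \<longlonglongrightarrow> growth_constant"
proof -
  define G where "G = (\<lambda>n. 6 / (real n)\<^sup>2 * ln (num_matroids n 3) - ln n)"
  have "G \<longlonglongrightarrow> ln growth_constant"
  proof (rule tendstoI)
    fix \<epsilon> :: real assume "0 < \<epsilon>"
    then have e: "0 < \<epsilon> / 2" by simp
    show "\<forall>\<^sub>F n in sequentially. dist (G n) (ln growth_constant) < \<epsilon>"
      using ln_num_matroids_ge[OF e] ln_num_matroids_le[OF e] eventually_gt_at_top[of 0]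
    proof eventually_elim
      case (elim n)
      define q where "q = (real n)\<^sup>2 / 6"
      have q: "0 < q" "6 / (real n)\<^sup>2 = 1 / q" using elim(3) by (simp_all add: q_def)
      have "q * (ln n + ln growth_constant - \<epsilon> / 2) \<le> ln (num_matroids n 3)"
        "ln (num_matroids n 3) \<le> q * (ln n + ln growth_constant + \<epsilon> / 2)"
        using elim(1,2) by (auto simp: q_def)
      then have v: "ln n + ln growth_constant - \<epsilon> / 2 \<le> ln (num_matroids n 3) / q"
        "ln (num_matroids n 3) / q \<le> ln n + ln growth_constant + \<epsilon> / 2"
        using q(1) by (simp_all add: pos_le_divide_eq pos_divide_le_eq mult.commute)
      have G: "G n = ln (num_matroids n 3) / q - ln n" by (simp only: G_def q(2)) simp
      have "\<bar>(u - l) - c\<bar> < \<epsilon>" if "l + c - \<epsilon> / 2 \<le> u" "u \<le> l + c + \<epsilon> / 2" for u l c :: real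
        using that \<open>0 < \<epsilon>\<close> by linarith
      from this[OF v] show ?case unfolding dist_real_def G .
    qed
  qed
  then have "(\<lambda>n. exp (G n)) \<longlonglongrightarrow> exp (ln growth_constant)" by (rule tendsto_exp)
  then have lim: "(\<lambda>n. exp (G n)) \<longlonglongrightarrow> growth_constant" using growth_constant_pos by simp
  show ?thesis
  proof (rule Lim_transform_eventually[OF lim])
    have "\<forall>\<^sub>F n in sequentially. 0 < num_matroids n 3" using ln_num_matroids_ge[of 1] by (auto elim: eventually_mono)
    then show "\<forall>\<^sub>F n in sequentially. exp (G n) = real (num_matroids n 3) powr (6 / (real n)\<^sup>2) / real n"
      using eventually_gt_at_top[of 0]
      by eventually_elim (simp add: G_def exp_diff powr_def)
  qed
qed

theorem theorem1p1:
  shows "\<exists>g :: nat \<Rightarrow> real.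
           ((\<lambda>n. g n / real n) \<longlonglongrightarrow> 0) \<and>
           (\<forall>n\<ge>1.
              (1 + sqrt 3) / 2 * exp (sqrt 3 / 2 - 3) * real n + g n \<ge> 0 \<and>
              real (num_matroids n 3) =
                ((1 + sqrt 3) / 2 * exp (sqrt 3 / 2 - 3) * real n + g n)
                  powr ((real n)\<^sup>2 / 6))"
proof (intro exI conjI allI impI)
  define r where "r = (\<lambda>n. real (num_matroids n 3) powr (6 / (real n)\<^sup>2))"
  let ?g = "\<lambda>n. r n - growth_constant * real n"
  have base: "(1 + sqrt 3) / 2 * exp (sqrt 3 / 2 - 3) * real n + ?g n = r n" for n
    by (simp add: growth_constant_def)
  have "(\<lambda>n. r n / real n - growth_constant) \<longlonglongrightarrow> growth_constant - growth_constant"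
    unfolding r_def by (intro tendsto_diff root_num_matroids_limit tendsto_const)
  then have lim: "(\<lambda>n. r n / real n - growth_constant) \<longlonglongrightarrow> 0" by simp
  show "(\<lambda>n. ?g n / real n) \<longlonglongrightarrow> 0"
  proof (rule Lim_transform_eventually[OF lim])
    show "\<forall>\<^sub>F n in sequentially. r n / real n - growth_constant = ?g n / real n"
      using eventually_gt_at_top[of 0] by eventually_elim (simp add: diff_divide_distrib)
  qed
  fix n :: nat assume n: "1 \<le> n"
  show "0 \<le> (1 + sqrt 3) / 2 * exp (sqrt 3 / 2 - 3) * real n + ?g n" unfolding base by (simp add: r_def)
  show "real (num_matroids n 3) = ((1 + sqrt 3) / 2 * exp (sqrt 3 / 2 - 3) * real n + ?g n) powr ((real n)\<^sup>2 / 6)"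
    unfolding base unfolding r_def using n by (cases "num_matroids n 3 = 0") (simp_all add: powr_powr)
qed

end
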